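(* For integers $a,k \geq 0$, let $RS_a = \sum_{i\geq 0} (-1)^i h_{a+i}\, e_i^\perp$ and define $$CS_{a^k} = \sum_\lambda (-1)^{|\lambda|}\, (RS_a)^k(s_\lambda)\, s_{\lambda'}^\perp ,$$ the sum over all partitions $\lambda$, where $(RS_a)^k(s_\lambda)$ acts by multiplication. Then $CS_{a^k} s_\lambda = s_{\lambda + a^k}$ if $l(\lambda) \leq k$, and $CS_{a^k} s_\lambda = 0$ if $l(\lambda) > k$.
   Context: $h_j$, $e_i$, $s_\lambda$ are the complete homogeneous, elementary and Schur symmetric functions ($h_0=e_0=1$); $g^\perp$ is the adjoint of multiplication by $g$ with respect to the Hall inner product; $\lambda'$ is the conjugate partition. For $l(\lambda)\le k$, $\lambda+a^k=(\lambda_1+a,\ldots,\lambda_k+a)$ with $\lambda_i=0$ for $i>l(\lambda)$. *)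

theory Defs
  imports
    "HOL-Library.Multiset"
    "HOL-Library.FuncSet"
    "HOL-Library.Groups_Big_Fun"
begin

section \<open>Formal power series in countably many variables\<close>

text \<open>
  The variables are \<open>x\<^sub>0, x\<^sub>1, x\<^sub>2, \<dots>\<close>. A monomial is encoded as the finite multiset of the
  indices of its variables, so \<open>x\<^sub>0\<^sup>2 x\<^sub>3\<close> is \<open>{#0, 0, 3#}\<close>, the product of monomials is the sum of
  multisets and the degree is \<^const>\<open>size\<close>.
\<close>

typedef 'a mseries = "UNIV :: (nat multiset \<Rightarrow> 'a) set"
  morphisms mcoeff Abs_mseries
  by simp

setup_lifting type_definition_mseries

lemma mseries_eqI: "(\<And>m. mcoeff f m = mcoeff g m) \<Longrightarrow> f = g"
  by transfer auto

definition msplits :: "nat multiset \<Rightarrow> (nat multiset \<times> nat multiset) set" where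
  "msplits m = {(p, q). p + q = m}"

lemma mem_msplits [simp]: "(p, q) \<in> msplits m \<longleftrightarrow> p + q = m"
  by (simp add: msplits_def)

lemma finite_submsets: "finite {p. p \<subseteq># (m :: nat multiset)}"
proof (induction m)
  case empty
  then show ?case by simp
next
  case (add x m)
  have "{p. p \<subseteq># add_mset x m} \<subseteq> {p. p \<subseteq># m} \<union> add_mset x ` {p. p \<subseteq># m}"
  proof
    fix p assume p: "p \<in> {p. p \<subseteq># add_mset x m}"
    show "p \<in> {p. p \<subseteq># m} \<union> add_mset x ` {p. p \<subseteq># m}"
    proof (cases "x \<in># p")
      case True
      then obtain q where "p = add_mset x q" by (meson multi_member_split)
      with p show ?thesis by auto
    next
      case False
      with p show ?thesis
        by (metis (mono_tags, lifting) CollectD CollectI UnI1 add_mset_remove_trivial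
            diff_single_trivial subset_eq_diff_conv add_mset_add_single)
    qed
  qed
  with add show ?case by (meson finite_UnI finite_imageI finite_subset)
qed

lemma finite_msplits [simp]: "finite (msplits m)"
proof -
  have "msplits m \<subseteq> {p. p \<subseteq># m} \<times> {p. p \<subseteq># m}" by auto
  then show ?thesis by (rule finite_subset) (intro finite_cartesian_product finite_submsets)
qed

instantiation mseries :: (comm_ring_1) comm_ring_1
begin

lift_definition zero_mseries :: "'a mseries" is "\<lambda>_. 0" .
lift_definition one_mseries :: "'a mseries" is "\<lambda>m. if m = {#} then 1 else 0" .
lift_definition plus_mseries :: "'a mseries \<Rightarrow> 'a mseries \<Rightarrow> 'a mseries"
  is "\<lambda>f g m. f m + g m" .
lift_definition minus_mseries :: "'a mseries \<Rightarrow> 'a mseries \<Rightarrow> 'a mseries"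
  is "\<lambda>f g m. f m - g m" .
lift_definition uminus_mseries :: "'a mseries \<Rightarrow> 'a mseries"
  is "\<lambda>f m. - f m" .
lift_definition times_mseries :: "'a mseries \<Rightarrow> 'a mseries \<Rightarrow> 'a mseries"
  is "\<lambda>f g m. \<Sum>(p, q)\<in>msplits m. f p * g q" .

instance
proof
  fix f g h :: "'a mseries"
  show "f + g + h = f + (g + h)" by transfer (simp add: add.assoc)
  show "f + g = g + f" by transfer (simp add: add.commute)
  show "0 + f = f" by transfer simp
  show "- f + f = 0" by transfer simp
  show "f - g = f + - g" by transfer simp
  show "(0 :: 'a mseries) \<noteq> 1" by transfer (metis zero_neq_one)
  show "f * g = g * f"
  proof transfer
    fix f g :: "nat multiset \<Rightarrow> 'a"
    show "(\<lambda>m. \<Sum>(p, q)\<in>msplits m. f p * g q) = (\<lambda>m. \<Sum>(p, q)\<in>msplits m. g p * f q)"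
      by (intro ext sum.reindex_bij_witness[where i = prod.swap and j = prod.swap])
        (auto simp: add.commute mult.commute)
  qed
  show "(f + g) * h = f * h + g * h"
    by transfer (simp add: distrib_right sum.distrib case_prod_unfold)
  show "1 * f = f"
  proof transfer
    fix f :: "nat multiset \<Rightarrow> 'a"
    have "(\<Sum>(p, q)\<in>msplits m. (if p = {#} then 1 else 0) * f q) = f m" for m
    proof -
      have "(\<Sum>(p, q)\<in>msplits m. (if p = {#} then 1 else 0) * f q)
          = (\<Sum>(p, q)\<in>{({#} :: nat multiset, m)}. (if p = {#} then 1 else 0) * f q)"
        by (rule sum.mono_neutral_right) (auto split: if_splits)
      then show ?thesis by simp
    qed
    then show "(\<lambda>m. \<Sum>(p, q)\<in>msplits m. (if p = {#} then 1 else 0) * f q) = f" by auto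
  qed
  show "f * g * h = f * (g * h)"
  proof transfer
    fix f g h :: "nat multiset \<Rightarrow> 'a"
    have "(\<Sum>(p, c)\<in>msplits m. (\<Sum>(a, b)\<in>msplits p. f a * g b) * h c)
        = (\<Sum>(a, q)\<in>msplits m. f a * (\<Sum>(b, c)\<in>msplits q. g b * h c))" for m
    proof -
      have "(\<Sum>(p, c)\<in>msplits m. (\<Sum>(a, b)\<in>msplits p. f a * g b) * h c)
          = (\<Sum>((p, c), (a, b))\<in>Sigma (msplits m) (\<lambda>(p, c). msplits p). f a * g b * h c)"
        by (subst sum.Sigma[symmetric]) (auto simp: sum_distrib_right case_prod_unfold)
      also have "\<dots> = (\<Sum>((a, q), (b, c))\<in>Sigma (msplits m) (\<lambda>(a, q). msplits q).
          f a * (g b * h c))"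
        by (rule sum.reindex_bij_witness[where
              i = "\<lambda>((a, q), (b, c)). ((a + b, c), (a, b))" and
              j = "\<lambda>((p, c), (a, b)). ((a, b + c), (b, c))"])
          (auto simp: add.assoc mult.assoc)
      also have "\<dots> = (\<Sum>(a, q)\<in>msplits m. f a * (\<Sum>(b, c)\<in>msplits q. g b * h c))"
        by (subst sum.Sigma[symmetric]) (auto simp: sum_distrib_left case_prod_unfold)
      finally show ?thesis .
    qed
    then show "(\<lambda>m. \<Sum>(p, c)\<in>msplits m. (\<Sum>(a, b)\<in>msplits p. f a * g b) * h c)
      = (\<lambda>m. \<Sum>(a, q)\<in>msplits m. f a * (\<Sum>(b, c)\<in>msplits q. g b * h c))" by auto
  qed
qed

end

lift_definition mconst :: "'a::zero \<Rightarrow> 'a mseries" is "\<lambda>c m. if m = {#} then c else 0" .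


section \<open>The ring of symmetric functions\<close>

definition symfun :: "'a::comm_ring_1 mseries set" where
  "symfun = {f. (\<forall>\<sigma> m. bij \<sigma> \<longrightarrow> mcoeff f (image_mset \<sigma> m) = mcoeff f m) \<and>
                (\<exists>d. \<forall>m. mcoeff f m \<noteq> 0 \<longrightarrow> size m \<le> d)}"

lift_definition hsym :: "nat \<Rightarrow> 'a::comm_ring_1 mseries"
  is "\<lambda>n m. if size m = n then 1 else 0" .

lift_definition esym :: "nat \<Rightarrow> 'a::comm_ring_1 mseries"
  is "\<lambda>n m. if size m = n \<and> (\<forall>i. count m i \<le> 1) then 1 else 0" .


section \<open>Partitions\<close>

text \<open>A partition is the sequence of its parts, continued by zeros and indexed from 0.\<close>

typedef nat_partition = "{p :: nat \<Rightarrow> nat. antimono p \<and> finite {i. p i \<noteq> 0}}"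
  morphisms part Abs_nat_partition
  by (rule exI[of _ "\<lambda>_. 0"]) (auto simp: antimono_def)

setup_lifting type_definition_nat_partition

definition plength :: "nat_partition \<Rightarrow> nat" where
  "plength lam = card {i. part lam i \<noteq> 0}"

definition psize :: "nat_partition \<Rightarrow> nat" where
  "psize lam = (\<Sum>i<plength lam. part lam i)"

lift_definition pconj :: "nat_partition \<Rightarrow> nat_partition"
  is "\<lambda>p j. card {i. j < p i}"
proof
  fix p :: "nat \<Rightarrow> nat"
  assume p: "antimono p \<and> finite {i. p i \<noteq> 0}"
  have fin: "finite {i. j < p i}" for j
    using p by (elim conjE finite_subset[rotated]) auto
  show "antimono (\<lambda>j. card {i. j < p i})"
    by (intro antimonoI card_mono fin) auto
  have "{j. card {i. j < p i} \<noteq> 0} \<subseteq> {..<p 0}"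
  proof
    fix j assume "j \<in> {j. card {i. j < p i} \<noteq> 0}"
    then obtain i where "j < p i" using fin by auto
    moreover have "p i \<le> p 0" using p by (auto dest: antimonoD[of p 0 i])
    ultimately show "j \<in> {..<p 0}" by simp
  qed
  then show "finite {j. card {i. j < p i} \<noteq> 0}" by (rule finite_subset) simp
qed

text \<open>
  \<open>padd lam a k\<close> is the partition \<open>lam + a\<^sup>k\<close>; this reading is intended when \<open>plength lam \<le> k\<close>,
  where all parts with index at least \<open>k\<close> vanish.
\<close>

lift_definition padd :: "nat_partition \<Rightarrow> nat \<Rightarrow> nat \<Rightarrow> nat_partition"
  is "\<lambda>p a k i. if i < k then p i + a else p i"
proof
  fix p :: "nat \<Rightarrow> nat" and a k :: nat
  assume p: "antimono p \<and> finite {i. p i \<noteq> 0}"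
  show "antimono (\<lambda>i. if i < k then p i + a else p i)"
    using p by (auto simp: antimono_def trans_le_add1)
  have "{i. (if i < k then p i + a else p i) \<noteq> 0} \<subseteq> {..<k} \<union> {i. p i \<noteq> 0}" by auto
  then show "finite {i. (if i < k then p i + a else p i) \<noteq> 0}"
    by (rule finite_subset) (use p in auto)
qed


section \<open>Complete homogeneous, monomial and Schur functions indexed by partitions\<close>

definition hprod :: "nat_partition \<Rightarrow> 'a::comm_ring_1 mseries" where
  "hprod lam = (\<Prod>i<plength lam. hsym (part lam i))"

lift_definition msym :: "nat_partition \<Rightarrow> 'a::comm_ring_1 mseries"
  is "\<lambda>mu m. if \<exists>\<sigma>. bij \<sigma> \<and> (\<forall>i. count m (\<sigma> i) = part mu i) then 1 else 0" .

definition cells :: "nat_partition \<Rightarrow> (nat \<times> nat) set" where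
  "cells lam = {(i, j). j < part lam i}"

text \<open>
  Semistandard tableaux, with the variable indices \<open>0, 1, 2, \<dots>\<close> as entries. Extensionality makes
  a tableau a function on the diagram only, so that the tableaux of a given content can be counted.
\<close>

definition ssyt :: "nat_partition \<Rightarrow> (nat \<times> nat \<Rightarrow> nat) set" where
  "ssyt lam = {T \<in> extensional (cells lam).
     (\<forall>i j. (i, Suc j) \<in> cells lam \<longrightarrow> T (i, j) \<le> T (i, Suc j)) \<and>
     (\<forall>i j. (Suc i, j) \<in> cells lam \<longrightarrow> T (i, j) < T (Suc i, j))}"

lift_definition schur :: "nat_partition \<Rightarrow> 'a::comm_ring_1 mseries"
  is "\<lambda>lam m. of_nat (card {T \<in> ssyt lam. image_mset T (mset_set (cells lam)) = m})" .


section \<open>The Hall inner product and adjoints of multiplication\<close>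

definition hall_form ::
    "('a::comm_ring_1 mseries \<Rightarrow> 'a mseries \<Rightarrow> 'a) \<Rightarrow> bool" where
  "hall_form B \<longleftrightarrow>
     (\<forall>c. \<forall>f\<in>symfun. \<forall>g\<in>symfun. \<forall>u\<in>symfun.
        B (mconst c * f + g) u = c * B f u + B g u \<and>
        B u (mconst c * f + g) = c * B u f + B u g) \<and>
     (\<forall>lam mu. B (hprod lam) (msym mu) = (if lam = mu then 1 else 0))"

text \<open>
  The \<open>h\<^sub>\<lambda>\<close> and the \<open>m\<^sub>\<mu>\<close> are bases of the symmetric functions, so \<^const>\<open>hall_form\<close> determines
  the form on \<^const>\<open>symfun\<close>; the arbitrary values chosen elsewhere are never used.
\<close>

definition hall :: "'a::comm_ring_1 mseries \<Rightarrow> 'a mseries \<Rightarrow> 'a" where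
  "hall = (SOME B. hall_form B)"

definition perp :: "'a::comm_ring_1 mseries \<Rightarrow> 'a mseries \<Rightarrow> 'a mseries" where
  "perp g f = (THE u. u \<in> symfun \<and> (\<forall>v\<in>symfun. hall u v = hall f (g * v)))"


section \<open>The operators\<close>

text \<open>
  The operator sums are taken pointwise. Applied to a symmetric function they have only finitely
  many nonzero terms, since \<open>g\<^sup>\<bottom> f = 0\<close> for homogeneous \<open>g\<close> of degree larger than that of \<open>f\<close>;
  \<^const>\<open>Sum_any\<close> adds the nonzero terms.
\<close>

definition RS :: "nat \<Rightarrow> 'a::comm_ring_1 mseries \<Rightarrow> 'a mseries" where
  "RS a f = Sum_any (\<lambda>i. (-1) ^ i * hsym (a + i) * perp (esym i) f)"

definition CS :: "nat \<Rightarrow> nat \<Rightarrow> 'a::comm_ring_1 mseries \<Rightarrow> 'a mseries" where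
  "CS a k f = Sum_any (\<lambda>lam.
     (-1) ^ psize lam * (RS a ^^ k) (schur lam) * perp (schur (pconj lam)) f)"

end

theory Submission
  imports Defs
begin

text \<open>
  Write \<open>S\<close> for the antipode, so that \<open>S s\<^sub>\<mu>\<^sub>' = (-1)\<^sup>|\<^sup>\<mu>\<^sup>| s\<^sub>\<mu>\<close>. The sum defining \<open>CS\<close> is the
  convolution product \<open>(RS\<^sub>a\<^sup>k \<circ> S) * id\<close>. The product rule for \<open>e\<^sub>i\<^sup>\<bottom>\<close> gives
  \<open>RS\<^sub>a (g \<cdot> S f) = \<Sum>\<^sub>j RS\<^sub>a\<^sub>+\<^sub>j g \<cdot> S (h\<^sub>j\<^sup>\<bottom> f)\<close>, and \<open>S * id\<close> is the counit; hence \<open>CS f\<close> is the sum, over all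
  \<open>\<beta>\<close> with \<open>k\<close> entries, of the coefficient of \<open>x\<^sup>\<beta>\<close> in \<open>f\<close> times \<open>RS\<^sub>a\<^sub>+\<^sub>\<beta>\<^sub>1 \<cdots> RS\<^sub>a\<^sub>+\<^sub>\<beta>\<^sub>k 1\<close>.
  Because \<open>RS\<^sub>a RS\<^sub>b = - RS\<^sub>b\<^sub>-\<^sub>1 RS\<^sub>a\<^sub>+\<^sub>1\<close>, nearly all terms cancel when \<open>f\<close> is a multiple of \<open>h\<^sub>n\<close>, and one
  obtains \<open>CS RS\<^sub>b = RS\<^sub>a\<^sub>+\<^sub>b CS\<close>, where \<open>CS\<close> belongs to \<open>a\<^sup>k\<^sup>+\<^sup>1\<close> on the left and to \<open>a\<^sup>k\<close> on the right. As
  \<open>s\<^sub>\<lambda> = RS\<^sub>\<lambda>\<^sub>1 RS\<^sub>\<lambda>\<^sub>2 \<cdots> 1\<close>, the theorem follows by induction on \<open>k\<close>.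
\<close>


text \<open>The Hall form is only chosen by \<open>SOME\<close> and the adjoints by
  \<open>THE\<close>, so \<open>perp\<close> is unusable until a form is shown to exist and to be
  nondegenerate on \<open>symfun\<close>. Hence the algebra is done first with concrete operators:
  \<open>hperp\<close> reads off coefficients, \<open>eperp\<close> is its formal inverse, and
  \<open>bern\<close> combines \<open>eperp\<close> with multiplication by complete functions. Only
  afterwards are they identified with adjoints. The Schur basis, which supplies the form, is itself
  obtained from \<open>bern\<close>: tableaux and products of Bernstein operators lose their largest
  variable by the same rule. The coefficient ring is arbitrary, which excludes power-sum arguments
  and division by 2; the diagonal terms of sign-reversing involutions therefore need a vanishing
  lemma of their own. Infinite sums are truncated at some \<open>N\<close> that bounds the
  degree.\<close>

lemma mcoeff_simps [simp]:
  "mcoeff 0 m = 0"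
  "mcoeff 1 m = (if m = {#} then 1 else 0)"
  "mcoeff (f + g) m = mcoeff f m + mcoeff g m"
  "mcoeff (f - g) m = mcoeff f m - mcoeff g m"
  "mcoeff (- f) m = - mcoeff f m"
  "mcoeff (mconst c) m = (if m = {#} then c else 0)"
  "mcoeff (hsym n) m = (if size m = n then 1 else 0)"
  "mcoeff (esym n) m = (if size m = n \<and> (\<forall>i. count m i \<le> 1) then 1 else 0)"
  by (transfer, simp)+

lemma mcoeff_times: "mcoeff (f * g) m = (\<Sum>(p, q)\<in>msplits m. mcoeff f p * mcoeff g q)"
  by transfer simp

lemma mcoeff_sum [simp]: "mcoeff (\<Sum>x\<in>A. f x) m = (\<Sum>x\<in>A. mcoeff (f x) m)"
  by (induction A rule: infinite_finite_induct) auto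

lemma mcoeff_mconst_mult [simp]: "mcoeff (mconst c * f) m = c * mcoeff f m"
proof -
  have "(\<Sum>(p, q)\<in>msplits m. mcoeff (mconst c) p * mcoeff f q)
      = (\<Sum>(p, q)\<in>{({#}, m)}. mcoeff (mconst c) p * mcoeff f q)"
    by (rule sum.mono_neutral_right) (auto split: if_splits)
  then show ?thesis by (simp add: mcoeff_times)
qed

lemma mcoeff_mult_empty [simp]: "mcoeff (f * g) {#} = mcoeff f {#} * mcoeff g {#}"
proof -
  have "msplits {#} = {({#}, {#})}" by (auto simp: msplits_def)
  then show ?thesis by (simp add: mcoeff_times)
qed

lemma mconst_simps [simp]: "mconst 0 = 0" "mconst 1 = 1"
  by (rule mseries_eqI; simp)+

lemma mconst_ring:
  "mconst (c + d) = mconst c + mconst d" "mconst (c - d) = mconst c - mconst d"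
  "mconst (- c) = - mconst c" "mconst (c * d) = mconst c * mconst d"
  by (rule mseries_eqI; simp)+

text \<open>Signs become scalars, so that the linearity lemmas, stated for \<open>mconst\<close>,
  apply to them.\<close>

lemma neg_one_power_mult:
  "(- 1) ^ n * (f :: 'a::comm_ring_1 mseries) = mconst ((- 1) ^ n) * f"
  by (induction n) (auto simp: mconst_ring)


section \<open>Symmetry and degree\<close>

definition symmetric :: "'a::comm_ring_1 mseries \<Rightarrow> bool" where
  "symmetric f \<longleftrightarrow> (\<forall>\<sigma> m. bij \<sigma> \<longrightarrow> mcoeff f (image_mset \<sigma> m) = mcoeff f m)"

definition deg_le :: "nat \<Rightarrow> 'a::comm_ring_1 mseries \<Rightarrow> bool" where
  "deg_le d f \<longleftrightarrow> (\<forall>m. mcoeff f m \<noteq> 0 \<longrightarrow> size m \<le> d)"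

lemma symfun_iff: "f \<in> symfun \<longleftrightarrow> symmetric f \<and> (\<exists>d. deg_le d f)"
  by (simp add: symfun_def symmetric_def deg_le_def)

lemma symfunD: "f \<in> symfun \<Longrightarrow> bij \<sigma> \<Longrightarrow> mcoeff f (image_mset \<sigma> m) = mcoeff f m"
  by (simp add: symfun_def)

lemma symfun_deg: "f \<in> symfun \<Longrightarrow> \<exists>d. deg_le d f"
  by (simp add: symfun_iff)

lemma deg_leD: "deg_le d f \<Longrightarrow> d < size m \<Longrightarrow> mcoeff f m = 0"
  by (auto simp: deg_le_def not_less)

lemma deg_leI: "(\<And>m. d < size m \<Longrightarrow> mcoeff f m = 0) \<Longrightarrow> deg_le d f"
  by (auto simp: deg_le_def not_less[symmetric])

lemma deg_le_mono: "deg_le d f \<Longrightarrow> d \<le> e \<Longrightarrow> deg_le e f"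
  by (auto simp: deg_le_def intro: le_trans)

lemma deg_le_0 [simp]: "deg_le d 0"
  by (simp add: deg_le_def)

lemma deg_le_1 [simp]: "deg_le d 1"
  by (simp add: deg_le_def)

lemma deg_le_add: "deg_le d f \<Longrightarrow> deg_le d g \<Longrightarrow> deg_le d (f + g)"
  by (force intro: deg_leI simp: deg_leD)

lemma deg_le_uminus: "deg_le d f \<Longrightarrow> deg_le d (- f)"
  by (force intro: deg_leI simp: deg_leD)

lemma deg_le_sum: "(\<And>x. x \<in> A \<Longrightarrow> deg_le d (f x)) \<Longrightarrow> deg_le d (\<Sum>x\<in>A. f x)"
  by (intro deg_leI) (auto intro!: sum.neutral intro: deg_leD)

lemma deg_le_scale: "deg_le d f \<Longrightarrow> deg_le d (mconst c * f)"
  by (force intro: deg_leI simp: deg_leD)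

lemma deg_le_mult: "deg_le d f \<Longrightarrow> deg_le e g \<Longrightarrow> deg_le (d + e) (f * g)"
proof (rule deg_leI)
  fix m :: "nat multiset"
  assume fg: "deg_le d f" "deg_le e g" and m: "d + e < size m"
  have "mcoeff f p * mcoeff g q = 0" if "p + q = m" for p q
  proof -
    have "size p + size q = size m" using that by auto
    with m have "d < size p \<or> e < size q" by linarith
    then show ?thesis using fg by (auto simp: deg_leD)
  qed
  then show "mcoeff (f * g) m = 0" by (auto simp: mcoeff_times intro!: sum.neutral)
qed

lemma deg_le_hsym: "deg_le n (hsym n)"
  by (simp add: deg_le_def)

lemma symmetric_mult: "symmetric f \<Longrightarrow> symmetric g \<Longrightarrow> symmetric (f * g)"
proof (unfold symmetric_def, intro allI impI)
  fix \<sigma> :: "nat \<Rightarrow> nat" and m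
  assume f: "\<forall>\<sigma> m. bij \<sigma> \<longrightarrow> mcoeff f (image_mset \<sigma> m) = mcoeff f m"
    and g: "\<forall>\<sigma> m. bij \<sigma> \<longrightarrow> mcoeff g (image_mset \<sigma> m) = mcoeff g m" and \<sigma>: "bij \<sigma>"
  have inv: "image_mset (inv \<sigma>) (image_mset \<sigma> p) = p" "image_mset \<sigma> (image_mset (inv \<sigma>) p) = p" for p
    using \<sigma> by (simp_all add: multiset.map_comp inv_o_cancel bij_is_inj surj_iff[THEN iffD1] bij_is_surj)
  have union_inv: "image_mset (inv \<sigma>) p + image_mset (inv \<sigma>) q = m"
    if "p + q = image_mset \<sigma> m" for p q
    using that by (metis image_mset_union inv(1))
  show "mcoeff (f * g) (image_mset \<sigma> m) = mcoeff (f * g) m"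
    unfolding mcoeff_times
    by (rule sum.reindex_bij_witness[where
          i = "map_prod (image_mset \<sigma>) (image_mset \<sigma>)" and
          j = "map_prod (image_mset (inv \<sigma>)) (image_mset (inv \<sigma>))"])
      (use f g \<sigma> in \<open>auto simp: inv bij_imp_bij_inv union_inv simp flip: image_mset_union\<close>)
qed

lemma symfun_0 [simp]: "0 \<in> symfun"
  by (simp add: symfun_def)

lemma symfun_mconst [simp]: "mconst c \<in> symfun"
  by (auto simp: symfun_def)

lemma symfun_1 [simp]: "1 \<in> symfun"
  using symfun_mconst[of 1] by simp

lemma symfun_hsym [simp]: "hsym n \<in> symfun"
  by (auto simp: symfun_def)

lemma symfun_add: "f \<in> symfun \<Longrightarrow> g \<in> symfun \<Longrightarrow> f + g \<in> symfun"
proof -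
  assume "f \<in> symfun" "g \<in> symfun"
  moreover from this obtain d e where "deg_le d f" "deg_le e g" by (auto simp: symfun_iff)
  then have "deg_le (max d e) (f + g)"
    by (meson deg_le_add deg_le_mono max.cobounded1 max.cobounded2)
  ultimately show ?thesis by (auto simp: symfun_iff symmetric_def)
qed

lemma symfun_mult: "f \<in> symfun \<Longrightarrow> g \<in> symfun \<Longrightarrow> f * g \<in> symfun"
  by (auto simp: symfun_iff symmetric_mult intro: deg_le_mult)

lemma symfun_uminus: "f \<in> symfun \<Longrightarrow> - f \<in> symfun"
  using symfun_mult[of "mconst (-1)" f, OF symfun_mconst] by (simp add: mconst_ring)

lemma symfun_sum: "(\<And>x. x \<in> A \<Longrightarrow> f x \<in> symfun) \<Longrightarrow> (\<Sum>x\<in>A. f x) \<in> symfun"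
  by (induction A rule: infinite_finite_induct) (auto simp: symfun_add)


section \<open>The adjoints of the complete and elementary functions\<close>

text \<open>Each monomial arises from exactly one pair \<open>c\<close>, \<open>m\<close>, so fixing
  the exponent of x_0 leaves a series in countably many variables again.\<close>

definition shiftm :: "nat \<Rightarrow> nat multiset \<Rightarrow> nat multiset" where
  "shiftm c m = replicate_mset c 0 + image_mset Suc m"

lemma size_shiftm [simp]: "size (shiftm c m) = c + size m"
  by (simp add: shiftm_def)

lemma count_shiftm: "count (shiftm c m) i = (case i of 0 \<Rightarrow> c | Suc j \<Rightarrow> count m j)"
proof (cases i)
  case 0
  have "count (image_mset Suc m) 0 = 0" by (auto simp: count_eq_zero_iff)
  with 0 show ?thesis by (simp add: shiftm_def)
next
  case (Suc j)
  have "count (image_mset Suc m) (Suc j) = count m j"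
    by (induction m) auto
  with Suc show ?thesis by (simp add: shiftm_def)
qed

lemma shiftm_eq_iff [simp]: "shiftm c m = shiftm d n \<longleftrightarrow> c = d \<and> m = n"
proof
  assume "shiftm c m = shiftm d n"
  then have eq: "count (shiftm c m) i = count (shiftm d n) i" for i by simp
  have "c = d" using eq[of 0] by (simp add: count_shiftm)
  moreover have "count m i = count n i" for i using eq[of "Suc i"] by (simp add: count_shiftm)
  then have "m = n" by (rule multiset_eqI)
  ultimately show "c = d \<and> m = n" by simp
qed simp

lemma shiftm_add: "shiftm c p + shiftm d q = shiftm (c + d) (p + q)"
  by (rule multiset_eqI) (simp add: count_shiftm split: nat.split)

definition unshiftm :: "nat multiset \<Rightarrow> nat multiset" where
  "unshiftm m = image_mset (\<lambda>i. i - 1) (filter_mset (\<lambda>i. i > 0) m)"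

lemma count_unshiftm: "count (unshiftm m) j = count m (Suc j)"
proof (induction m)
  case (add x m)
  then show ?case by (cases x) (simp_all add: unshiftm_def)
qed (simp add: unshiftm_def)

lemma unshiftm_shiftm [simp]: "unshiftm (shiftm c m) = m"
  by (rule multiset_eqI) (simp add: count_shiftm count_unshiftm)

lemma shiftm_unshiftm [simp]: "shiftm (count m 0) (unshiftm m) = m"
  by (rule multiset_eqI) (simp add: count_shiftm count_unshiftm split: nat.split)

lemma shiftm_cases: obtains c m' where "m = shiftm c m'"
  by (rule that[of "count m 0" "unshiftm m"]) simp

text \<open>
  On symmetric functions \<open>hperp n\<close> is \<open>h\<^sub>n\<^sup>\<bottom>\<close>: it extracts the coefficient of \<open>x\<^sub>0\<^sup>n\<close> and
  renames the other variables back to \<open>x\<^sub>0, x\<^sub>1, \<dots>\<close>.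
\<close>

lift_definition hperp :: "nat \<Rightarrow> 'a::comm_ring_1 mseries \<Rightarrow> 'a mseries"
  is "\<lambda>c f m. f (shiftm c m)" .

lemma mcoeff_hperp [simp]: "mcoeff (hperp c f) m = mcoeff f (shiftm c m)"
  by transfer simp

lemma hperp_linear [simp]:
  "hperp c 0 = 0" "hperp c (f + g) = hperp c f + hperp c g"
  "hperp c (f - g) = hperp c f - hperp c g" "hperp c (- f) = - hperp c f"
  "hperp c (mconst a * f) = mconst a * hperp c f"
  by (rule mseries_eqI; simp)+

lemma hperp_sum [simp]: "hperp c (\<Sum>x\<in>A. f x) = (\<Sum>x\<in>A. hperp c (f x))"
  by (rule mseries_eqI) simp

lemma shiftm_eq_empty [simp]: "shiftm c m = {#} \<longleftrightarrow> c = 0 \<and> m = {#}"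
  by (auto simp: shiftm_def)

lemma hperp_1 [simp]: "hperp c 1 = (if c = 0 then 1 else 0)"
  by (rule mseries_eqI) simp

lemma bij_betw_msplits_shiftm:
  "bij_betw (\<lambda>(i, p, q). (shiftm i p, shiftm (c - i) q)) ({..c} \<times> msplits m) (msplits (shiftm c m))"
proof (rule bij_betw_imageI)
  show "inj_on (\<lambda>(i, p, q). (shiftm i p, shiftm (c - i) q)) ({..c} \<times> msplits m)"
    by (auto simp: inj_on_def)
  have "(p, q) \<in> (\<lambda>(i, p, q). (shiftm i p, shiftm (c - i) q)) ` ({..c} \<times> msplits m)"
    if "(p, q) \<in> msplits (shiftm c m)" for p q
  proof -
    obtain i p' where p: "p = shiftm i p'" by (rule shiftm_cases)
    obtain j q' where q: "q = shiftm j q'" by (rule shiftm_cases)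
    from that have "i + j = c" "p' + q' = m" by (auto simp: p q shiftm_add)
    then show ?thesis by (intro image_eqI[of _ _ "(i, p', q')"]) (auto simp: p q)
  qed
  moreover have "(\<lambda>(i, p, q). (shiftm i p, shiftm (c - i) q)) x \<in> msplits (shiftm c m)"
    if "x \<in> {..c} \<times> msplits m" for x
    using that by (auto simp: shiftm_add)
  ultimately show "(\<lambda>(i, p, q). (shiftm i p, shiftm (c - i) q)) ` ({..c} \<times> msplits m)
      = msplits (shiftm c m)"
    by (intro equalityI subsetI) auto
qed

text \<open>In a product of monomials the exponent c of x_0 splits as i + (c - i); this is the
  coproduct of h_c.\<close>

lemma hperp_mult: "hperp c (f * g) = (\<Sum>i\<le>c. hperp i f * hperp (c - i) g)"
proof (rule mseries_eqI)
  fix m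
  have "mcoeff (hperp c (f * g)) m = (\<Sum>(p, q)\<in>msplits (shiftm c m). mcoeff f p * mcoeff g q)"
    by (simp add: mcoeff_times)
  also have "\<dots> = (\<Sum>x\<in>{..c} \<times> msplits m.
      case (case x of (i, p, q) \<Rightarrow> (shiftm i p, shiftm (c - i) q)) of
        (p, q) \<Rightarrow> mcoeff f p * mcoeff g q)"
    by (rule sum.reindex_bij_betw[OF bij_betw_msplits_shiftm, symmetric])
  also have "\<dots> = (\<Sum>(i, pq)\<in>{..c} \<times> msplits m. case pq of (p, q) \<Rightarrow>
      mcoeff f (shiftm i p) * mcoeff g (shiftm (c - i) q))"
    by (rule sum.cong) auto
  also have "\<dots> = (\<Sum>i\<le>c. \<Sum>(p, q)\<in>msplits m.
      mcoeff f (shiftm i p) * mcoeff g (shiftm (c - i) q))"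
    by (rule sum.cartesian_product[symmetric])
  also have "\<dots> = mcoeff (\<Sum>i\<le>c. hperp i f * hperp (c - i) g) m"
    by (simp add: mcoeff_times)
  finally show "mcoeff (hperp c (f * g)) m = mcoeff (\<Sum>i\<le>c. hperp i f * hperp (c - i) g) m" .
qed

lemma bij_swap: "bij (\<lambda>x. if x = a then b else if x = b then a else x)"
  by (rule o_bij[of "\<lambda>x. if x = a then b else if x = b then a else x"]) (auto simp: fun_eq_iff)

lemma symfun_hperp: "f \<in> symfun \<Longrightarrow> hperp c f \<in> symfun"
proof -
  assume f: "f \<in> symfun"
  then obtain d where "deg_le d f" by (auto simp: symfun_iff)
  then have "deg_le d (hperp c f)" by (intro deg_leI) (simp add: deg_leD)
  moreover have "mcoeff (hperp c f) (image_mset \<sigma> m) = mcoeff (hperp c f) m" if "bij \<sigma>" for \<sigma> m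
  proof -
    \<comment> \<open>A permutation of the renamed variables extends to one that fixes x_0 and so
      leaves the extracted exponent alone.\<close>
    define \<tau> where "\<tau> = (\<lambda>i. case i of 0 \<Rightarrow> 0 | Suc j \<Rightarrow> Suc (\<sigma> j))"
    have "bij \<tau>"
      by (rule o_bij[where g = "\<lambda>i. case i of 0 \<Rightarrow> 0 | Suc j \<Rightarrow> Suc (inv \<sigma> j)"])
        (use that in \<open>auto simp: \<tau>_def fun_eq_iff bij_is_inj bij_is_surj surj_f_inv_f split: nat.split\<close>)
    moreover have "image_mset \<tau> (shiftm c m) = shiftm c (image_mset \<sigma> m)"
      by (simp add: shiftm_def \<tau>_def multiset.map_comp o_def)
    ultimately show ?thesis using symfunD[OF f, of \<tau>] by (metis mcoeff_hperp)
  qed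
  ultimately show ?thesis by (auto simp: symfun_iff symmetric_def)
qed

text \<open>Both sides read off the exponents of the first two variables; transposing x_0 and x_1
  exchanges them.\<close>

lemma hperp_commute: "f \<in> symfun \<Longrightarrow> hperp i (hperp j f) = hperp j (hperp i f)"
proof (rule mseries_eqI)
  fix m assume f: "f \<in> symfun"
  define \<tau> where "\<tau> = (\<lambda>x. if x = 0 then 1 else if x = 1 then 0 else (x::nat))"
  have "image_mset \<tau> (shiftm j (shiftm i m)) = shiftm i (shiftm j m)"
    by (simp add: shiftm_def multiset.map_comp o_def \<tau>_def)
  then show "mcoeff (hperp i (hperp j f)) m = mcoeff (hperp j (hperp i f)) m"
    using symfunD[OF f bij_swap[of 0 1], folded \<tau>_def, of "shiftm j (shiftm i m)"] by simp
qed

lemma deg_le_hperp: "deg_le d f \<Longrightarrow> deg_le (d - c) (hperp c f)"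
  by (rule deg_leI) (simp add: deg_leD)

lemma hperp_eq_0: "deg_le d f \<Longrightarrow> d < c \<Longrightarrow> hperp c f = 0"
  by (rule mseries_eqI) (simp add: deg_leD)

text \<open>Any variable of a nonconstant monomial can be moved to x_0; the coefficient then belongs
  to some \<open>hperp n f\<close> with \<open>n > 0\<close>.\<close>

lemma hperp_0_unique:
  assumes "f \<in> symfun" "\<And>n. n > 0 \<Longrightarrow> hperp n f = 0"
  shows "f = mconst (mcoeff f {#})"
proof (rule mseries_eqI)
  fix m
  show "mcoeff f m = mcoeff (mconst (mcoeff f {#})) m"
  proof (cases "m = {#}")
    case False
    then obtain i where i: "i \<in># m" by auto
    let ?\<tau> = "\<lambda>x. if x = i then 0 else if x = 0 then i else x"
    let ?m = "image_mset ?\<tau> m"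
    have "0 \<in># ?m" using i by force
    then have "count ?m 0 > 0" by simp
    then have "mcoeff (hperp (count ?m 0) f) (unshiftm ?m) = 0" using assms(2) by simp
    then have "mcoeff f ?m = 0" by simp
    then show ?thesis using symfunD[OF assms(1) bij_swap[of i 0], of m] False by simp
  qed simp
qed

lemma bij_rotate: "bij (\<lambda>i. if i = r then 0 else if i < r then Suc i else i)"
  by (rule o_bij[where g = "\<lambda>i. if i = 0 then r else if i \<le> r then i - 1 else i"])
    (auto simp: fun_eq_iff)

text \<open>The largest variable is rotated into the place of x_0 while the smaller ones move up by
  one. This gives recursions that remove the largest variable, as needed for comparison with
  tableaux.\<close>

lemma mcoeff_eq_hperp:
  assumes "f \<in> symfun" "set_mset m \<subseteq> {..<r}"
  shows "mcoeff f (m + replicate_mset c r) = mcoeff (hperp c f) m"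
proof -
  let ?\<sigma> = "\<lambda>i. if i = r then 0 else if i < r then Suc i else i"
  have "image_mset ?\<sigma> m = image_mset Suc m"
    by (rule image_mset_cong) (use assms(2) in auto)
  then have "image_mset ?\<sigma> (m + replicate_mset c r) = shiftm c m"
    by (simp add: shiftm_def add.commute)
  then show ?thesis using symfunD[OF assms(1) bij_rotate[of r]] by (metis mcoeff_hperp)
qed

lemma hperp_0_idx: "f \<in> symfun \<Longrightarrow> hperp 0 f = f"
proof (rule mseries_eqI)
  fix m :: "nat multiset" assume f: "f \<in> symfun"
  obtain r where "set_mset m \<subseteq> {..<r}"
    using finite_nat_set_iff_bounded[of "set_mset m"] by blast
  from mcoeff_eq_hperp[OF f this, of 0] show "mcoeff (hperp 0 f) m = mcoeff f m" by simp
qed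

text \<open>On symmetric functions \<open>eperp n\<close> is \<open>(-1)\<^sup>n e\<^sub>n\<^sup>\<bottom>\<close>; as generating functions, the two families are inverse to each other.\<close>

fun eperp :: "nat \<Rightarrow> 'a::comm_ring_1 mseries \<Rightarrow> 'a mseries" where
  "eperp 0 f = f"
| "eperp (Suc n) f = - (\<Sum>i\<le>n. eperp i (hperp (Suc n - i) f))"

declare eperp.simps(2) [simp del]

lemmas eperp_Suc = eperp.simps(2)

lemma eperp_linear [simp]:
  "eperp n 0 = 0" "eperp n (f + g) = eperp n f + eperp n g"
  "eperp n (f - g) = eperp n f - eperp n g" "eperp n (- f) = - eperp n f"
  "eperp n (mconst a * f) = mconst a * eperp n f"
proof -
  show add: "eperp n (f + g) = eperp n f + eperp n g" for f g
    by (induction n f arbitrary: g rule: eperp.induct) (simp_all add: eperp_Suc sum.distrib)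
  show scale: "eperp n (mconst a * f) = mconst a * eperp n f" for a f
    by (induction n f rule: eperp.induct) (simp_all add: eperp_Suc sum_distrib_left)
  show "eperp n 0 = 0" using add[of 0 0] by simp
  show neg: "eperp n (- f) = - eperp n f" for f
    using scale[of "-1" f] by (simp add: mconst_ring)
  show "eperp n (f - g) = eperp n f - eperp n g"
    using add[of f "- g"] by (simp add: neg)
qed

lemma eperp_sum [simp]: "eperp n (\<Sum>x\<in>A. f x) = (\<Sum>x\<in>A. eperp n (f x))"
  by (induction A rule: infinite_finite_induct) auto

lemma symfun_eperp: "f \<in> symfun \<Longrightarrow> eperp n f \<in> symfun"
  by (induction n f rule: eperp.induct)
    (auto simp: eperp_Suc intro!: symfun_uminus symfun_sum symfun_hperp)

lemma deg_le_eperp: "deg_le d f \<Longrightarrow> deg_le d (eperp n f)"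
proof (induction n f rule: eperp.induct)
  case (2 n f)
  have "deg_le d (hperp (Suc n - i) f)" for i
    using deg_le_mono[OF deg_le_hperp[OF "2.prems"]] by simp
  with "2.IH" show ?case by (auto simp: eperp_Suc intro!: deg_le_uminus deg_le_sum)
qed simp

lemma eperp_eq_0: "deg_le d f \<Longrightarrow> d < n \<Longrightarrow> eperp n f = 0"
proof (induction n f arbitrary: d rule: eperp.induct)
  case (2 n f)
  have "eperp i (hperp (Suc n - i) f) = 0" if "i \<le> n" for i
  proof (cases "d < Suc n - i")
    case True
    then show ?thesis using hperp_eq_0[OF "2.prems"(1)] by simp
  next
    case False
    with "2.prems"(2) that have "d - (Suc n - i) < i" by simp
    with that show ?thesis by (intro "2.IH"[OF _ deg_le_hperp[OF "2.prems"(1)]]) auto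
  qed
  then show ?case by (simp add: eperp_Suc)
qed simp

lemma eperp_hperp_convolution:
  "f \<in> symfun \<Longrightarrow> (\<Sum>i\<le>n. eperp i (hperp (n - i) f)) = (if n = 0 then f else 0)"
  by (cases n) (simp_all add: hperp_0_idx eperp_Suc)

lemma hperp_eperp_commute: "f \<in> symfun \<Longrightarrow> hperp j (eperp n f) = eperp n (hperp j f)"
proof (induction n f rule: eperp.induct)
  case (2 n f)
  then show ?case by (simp add: eperp_Suc symfun_hperp hperp_commute[of f j])
qed simp

lemma hperp_eperp_convolution:
  assumes "f \<in> symfun"
  shows "(\<Sum>i\<le>n. hperp i (eperp (n - i) f)) = (if n = 0 then f else 0)"
proof -
  have "(\<Sum>i\<le>n. hperp i (eperp (n - i) f)) = (\<Sum>i\<le>n. eperp i (hperp (n - i) f))"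
    using assms by (subst sum.atLeastAtMost_rev[of _ 0 n, simplified atLeast0AtMost])
      (simp add: hperp_eperp_commute atLeast0AtMost)
  then show ?thesis using assms by (simp add: eperp_hperp_convolution)
qed


section \<open>Multiplication by complete functions\<close>

text \<open>With integer indices the formulas for \<open>hperp\<close> and \<open>eperp\<close> on
  complete functions have no boundary cases.\<close>

definition hz :: "int \<Rightarrow> 'a::comm_ring_1 mseries" where
  "hz n = (if n < 0 then 0 else hsym (nat n))"

lemma hz_of_nat [simp]: "hz (int n) = hsym n"
  by (simp add: hz_def)

lemma hz_neg: "n < 0 \<Longrightarrow> hz n = 0"
  by (simp add: hz_def)

lemma hsym_0: "hsym 0 = 1"
  by (rule mseries_eqI) simp

lemma hz_0 [simp]: "hz 0 = 1"
  by (simp add: hz_def hsym_0)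

lemma hperp_hsym: "hperp c (hsym n) = (if c \<le> n then hsym (n - c) else 0)"
  by (rule mseries_eqI) auto

lemma hperp_hz: "hperp c (hz n) = hz (n - int c)"
  by (cases "n < int c") (auto simp: hz_def hperp_hsym nat_diff_distrib le_nat_iff)

lemma symfun_hz [simp]: "hz n \<in> symfun"
  by (simp add: hz_def)

lemma deg_le_hz: "deg_le (nat n) (hz n)"
  by (simp add: hz_def deg_le_hsym)

lemma hperp_hz_mult: "hperp c (hz n * f) = (\<Sum>i\<le>c. hz (n - int i) * hperp (c - i) f)"
  by (simp add: hperp_mult hperp_hz)

lemma hperp_Suc_hz_mult: "hperp (Suc c) (hz n * f) = hperp c (hz (n - 1) * f) + hz n * hperp (Suc c) f"
  unfolding hperp_hz_mult by (subst sum.atMost_Suc_shift) (simp add: algebra_simps)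

text \<open>The generating series of the \<open>eperp n\<close> with t^n is multiplicative and sends
  h_k to h_k - t h_{k-1}, because e_n^perp kills h_k for n > 1. The induction uses only the defining
  recursion.\<close>

lemma eperp_Suc_hz_mult:
  "f \<in> symfun \<Longrightarrow> eperp (Suc n) (hz k * f) = hz k * eperp (Suc n) f - hz (k - 1) * eperp n f"
proof (induction n arbitrary: f rule: less_induct)
  case (less n)
  have IH: "eperp i (hz k * g) = hz k * eperp i g - (if i = 0 then 0 else hz (k - 1) * eperp (i - 1) g)"
    if "i \<le> n" "g \<in> symfun" for i and g :: "'a mseries"
    using less.IH[of "i - 1" g] that by (cases i) auto
  \<comment> \<open>\<open>hperp_Suc_hz_mult\<close> splits off the part with h_{k-1}, whose sum
    collapses because the two families are inverse.\<close>
  have "eperp (Suc n) (hz k * f) = - (\<Sum>i\<le>n. eperp i (hperp (n - i) (hz (k - 1) * f)))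
      - (\<Sum>i\<le>n. eperp i (hz k * hperp (Suc n - i) f))"
    by (simp add: eperp_Suc hperp_Suc_hz_mult Suc_diff_le sum.distrib)
  also have "(\<Sum>i\<le>n. eperp i (hperp (n - i) (hz (k - 1) * f))) = (if n = 0 then hz (k - 1) * f else 0)"
    using less.prems by (simp add: eperp_hperp_convolution symfun_mult)
  also have "(\<Sum>i\<le>n. eperp i (hz k * hperp (Suc n - i) f)) = (\<Sum>i\<le>n. hz k * eperp i (hperp (Suc n - i) f))
      - (\<Sum>i\<le>n. if i = 0 then 0 else hz (k - 1) * eperp (i - 1) (hperp (Suc n - i) f))"
    by (simp add: IH symfun_hperp less.prems sum_subtractf)
  also have "(\<Sum>i\<le>n. hz k * eperp i (hperp (Suc n - i) f)) = - hz k * eperp (Suc n) f"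
    by (simp add: eperp_Suc sum_distrib_left sum_negf)
  also have "(\<Sum>i\<le>n. if i = 0 then 0 else hz (k - 1) * eperp (i - 1) (hperp (Suc n - i) f))
     = (if n = 0 then 0 else - hz (k - 1) * eperp n f)"
  proof (cases n)
    case (Suc n')
    then show ?thesis by (simp add: eperp_Suc sum.atMost_Suc_shift sum_distrib_left sum_negf del: sum.atMost_Suc)
  qed simp
  finally show ?case by (cases "n = 0") (simp_all add: algebra_simps)
qed

lemma eperp_1 [simp]: "eperp n 1 = (if n = 0 then 1 else 0)"
  by (cases n) (simp_all add: eperp_eq_0[of 0])

lemma eperp_commute: "f \<in> symfun \<Longrightarrow> eperp i (eperp j f) = eperp j (eperp i f)"
proof (induction i f rule: eperp.induct)
  case (2 n f)
  then show ?case by (simp add: eperp_Suc symfun_hperp hperp_eperp_commute)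
qed simp

text \<open>The antidiagonals up to N + M cover the rectangle that supports the terms.\<close>

lemma sum_triangle_rect:
  fixes \<phi> :: "nat \<Rightarrow> nat \<Rightarrow> 'b::comm_monoid_add"
  assumes "\<And>j l. N < j \<or> M < l \<Longrightarrow> \<phi> j l = 0"
  shows "(\<Sum>i\<le>N + M. \<Sum>j\<le>i. \<phi> j (i - j)) = (\<Sum>j\<le>N. \<Sum>l\<le>M. \<phi> j l)"
proof -
  have le: "j \<le> N \<and> l \<le> M" if "\<phi> j l \<noteq> 0" for j l
    using that assms by (meson not_le)
  have fin: "finite {(i, j). i + j \<le> N + M}"
    by (rule finite_subset[of _ "{..N + M} \<times> {..N + M}"]) auto
  have "(\<Sum>i\<le>N + M. \<Sum>j\<le>i. \<phi> j (i - j)) = (\<Sum>(i, j)\<in>{(i, j). i + j \<le> N + M}. \<phi> i j)"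
    by (rule sum.triangle_reindex_eq[symmetric])
  also have "\<dots> = (\<Sum>(i, j)\<in>{..N} \<times> {..M}. \<phi> i j)"
    by (rule sum.mono_neutral_right[OF fin]) (use le in auto)
  finally show ?thesis by (simp add: sum.cartesian_product)
qed


section \<open>Bernstein operators\<close>

text \<open>Bernstein's operator, with the sign inside \<open>eperp\<close>. The index is an integer
  since the exchange relation lowers it by one, possibly below 0.\<close>

definition bern :: "int \<Rightarrow> 'a::comm_ring_1 mseries \<Rightarrow> 'a mseries" where
  "bern a f = Sum_any (\<lambda>i. hz (a + int i) * eperp i f)"

lemma bern_eq_sum:
  assumes "deg_le N f"
  shows "bern a f = (\<Sum>i\<le>N. hz (a + int i) * eperp i f)"
proof -
  have "i \<le> N" if "hz (a + int i) * eperp i f \<noteq> 0" for i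
    using that eperp_eq_0[OF assms, of i] by (cases "i \<le> N") auto
  then have "{i. hz (a + int i) * eperp i f \<noteq> 0} \<subseteq> {..N}" by auto
  then show ?thesis by (simp add: bern_def Sum_any.expand_superset)
qed

lemma bern_add:
  assumes "f \<in> symfun" "g \<in> symfun"
  shows "bern a (f + g) = bern a f + bern a g"
proof -
  obtain d e where "deg_le d f" "deg_le e g" using assms by (auto simp: symfun_iff)
  then have "deg_le (max d e) f" "deg_le (max d e) g" by (auto intro: deg_le_mono)
  then show ?thesis
    by (simp add: bern_eq_sum[of "max d e"] deg_le_add sum.distrib distrib_left)
qed

lemma bern_scale:
  assumes "f \<in> symfun"
  shows "bern a (mconst c * f) = mconst c * bern a f"
proof -
  obtain d where "deg_le d f" using assms by (auto simp: symfun_iff)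
  then show ?thesis
    by (simp add: bern_eq_sum[of d] deg_le_scale sum_distrib_left mult.left_commute)
qed

lemma bern_0 [simp]: "bern a 0 = 0"
  by (simp add: bern_def)

lemma bern_uminus: "f \<in> symfun \<Longrightarrow> bern a (- f) = - bern a f"
  using bern_scale[of f a "-1"] by (simp add: mconst_ring)

lemma bern_diff: "f \<in> symfun \<Longrightarrow> g \<in> symfun \<Longrightarrow> bern a (f - g) = bern a f - bern a g"
  using bern_add[of f "- g" a] by (simp add: bern_uminus symfun_uminus)

lemma bern_sum:
  "(\<And>x. x \<in> A \<Longrightarrow> f x \<in> symfun) \<Longrightarrow> bern a (\<Sum>x\<in>A. f x) = (\<Sum>x\<in>A. bern a (f x))"
  by (induction A rule: infinite_finite_induct) (auto simp: bern_add symfun_sum)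

lemma symfun_bern: "f \<in> symfun \<Longrightarrow> bern a f \<in> symfun"
  using symfun_deg[of f] by (auto simp: bern_eq_sum intro!: symfun_sum symfun_mult symfun_eperp)

lemma bern_1 [simp]: "bern a 1 = hz a"
  using bern_eq_sum[of 0 1 a] by simp

text \<open>As \<open>hperp\<close> and \<open>eperp\<close> commute, only the factor
  \<open>hz (b + int i)\<close> is affected, and lowering its index lowers that of the
  operator.\<close>

lemma hperp_bern:
  assumes "f \<in> symfun"
  shows "hperp c (bern b f) = (\<Sum>j\<le>c. bern (b - int j) (hperp (c - j) f))"
proof -
  obtain N where N: "deg_le N f" using assms by (auto simp: symfun_iff)
  have N': "deg_le N (hperp j f)" for j
    using deg_le_mono[OF deg_le_hperp[OF N, of j]] by simp
  have "hperp c (bern b f)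
      = (\<Sum>i\<le>N. \<Sum>j\<le>c. hz (b + int i - int j) * eperp i (hperp (c - j) f))"
    by (simp add: bern_eq_sum[OF N] hperp_hz_mult hperp_eperp_commute assms)
  also have "\<dots> = (\<Sum>j\<le>c. bern (b - int j) (hperp (c - j) f))"
    by (subst sum.swap) (simp add: bern_eq_sum[OF N'] algebra_simps)
  finally show ?thesis .
qed

lemma eperp_Suc_bern:
  assumes "f \<in> symfun"
  shows "eperp (Suc n) (bern b f) = bern b (eperp (Suc n) f) - bern (b - 1) (eperp n f)"
proof -
  obtain N where N: "deg_le N f" using assms by (auto simp: symfun_iff)
  have "eperp (Suc n) (bern b f) = (\<Sum>i\<le>N. hz (b + int i) * eperp i (eperp (Suc n) f))
     - (\<Sum>i\<le>N. hz (b + int i - 1) * eperp i (eperp n f))"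
    by (simp add: bern_eq_sum[OF N] eperp_Suc_hz_mult symfun_eperp assms sum_subtractf
        eperp_commute[of f "Suc n"] eperp_commute[of f n])
  then show ?thesis
    by (simp add: bern_eq_sum[OF deg_le_eperp[OF N]] algebra_simps)
qed

text \<open>The two-term rule for \<open>eperp\<close> on a multiple of h_n produces a second sum
  with \<open>eperp\<close> shifted by one, which is the operator of index
  \<open>a + 1\<close>.\<close>

lemma bern_hz_mult:
  assumes "f \<in> symfun"
  shows "bern a (hz n * f) = hz n * bern a f - hz (n - 1) * bern (a + 1) f"
proof -
  obtain N where N: "deg_le N f" using assms by (auto simp: symfun_iff)
  define M where "M = N + nat n"
  have M: "deg_le M f" "deg_le (Suc M) (hz n * f)"
    using deg_le_mult[OF deg_le_hz[of n] N] deg_le_mono[OF N] by (auto simp: M_def intro: deg_le_mono)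
  have "bern a (hz n * f) = hz a * (hz n * f)
      + (\<Sum>i\<le>M. hz (a + int (Suc i)) * eperp (Suc i) (hz n * f))"
    unfolding bern_eq_sum[OF M(2)] by (subst sum.atMost_Suc_shift) simp
  also have "(\<Sum>i\<le>M. hz (a + int (Suc i)) * eperp (Suc i) (hz n * f))
      = (\<Sum>i\<le>M. hz (a + int (Suc i)) * (hz n * eperp (Suc i) f - hz (n - 1) * eperp i f))"
    by (simp add: eperp_Suc_hz_mult assms)
  also have "\<dots> = hz n * (\<Sum>i\<le>M. hz (a + int (Suc i)) * eperp (Suc i) f)
        - hz (n - 1) * (\<Sum>i\<le>M. hz (a + 1 + int i) * eperp i f)"
    by (simp add: sum_distrib_left sum_subtractf algebra_simps)
  also have "(\<Sum>i\<le>M. hz (a + int (Suc i)) * eperp (Suc i) f) = bern a f - hz a * f"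
    unfolding bern_eq_sum[OF deg_le_mono[OF M(1) le_SucI[OF le_refl]]]
    by (subst sum.atMost_Suc_shift) simp
  also have "(\<Sum>i\<le>M. hz (a + 1 + int i) * eperp i f) = bern (a + 1) f"
    by (simp add: bern_eq_sum[OF M(1)])
  finally show ?thesis by (simp add: algebra_simps)
qed

text \<open>\<open>bern_hz_mult\<close> solved for the product on its right, by repeated
  substitution.\<close>

lemma hsym_mult_bern:
  "f \<in> symfun \<Longrightarrow> hsym n * bern a f = (\<Sum>c\<le>n. bern (a + int c) (hsym (n - c) * f))"
proof (induction n arbitrary: a)
  case 0
  then show ?case by (simp add: hsym_0)
next
  case (Suc n)
  have "bern a (hsym (Suc n) * f) = hsym (Suc n) * bern a f - hsym n * bern (a + 1) f"
    using bern_hz_mult[OF Suc.prems, of a "int (Suc n)"] by (simp del: of_nat_Suc)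
      (simp add: hz_def nat_add_distrib)
  then have "hsym (Suc n) * bern a f = bern a (hsym (Suc n) * f) + hsym n * bern (a + 1) f"
    by simp
  also have "\<dots> = (\<Sum>c\<le>Suc n. bern (a + int c) (hsym (Suc n - c) * f))"
    by (subst sum.atMost_Suc_shift) (simp add: Suc algebra_simps)
  finally show ?case .
qed


section \<open>The span of the products of complete functions\<close>

text \<open>A temporary substitute for \<open>symfun\<close> that allows induction over
  multiplication by generators. Schur functions later show that it is all of \<open>symfun\<close>
  (\<open>hspan_eq_symfun\<close>).\<close>

inductive_set hspan :: "'a::comm_ring_1 mseries set" where
  hspan_0 [simp]: "0 \<in> hspan"
| hspan_1 [simp]: "1 \<in> hspan"
| hspan_hz_mult: "f \<in> hspan \<Longrightarrow> hz n * f \<in> hspan"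
| hspan_lin: "f \<in> hspan \<Longrightarrow> g \<in> hspan \<Longrightarrow> mconst c * f + g \<in> hspan"

lemma hspan_symfun: "f \<in> hspan \<Longrightarrow> f \<in> symfun"
  by (induction rule: hspan.induct) (auto intro: symfun_mult symfun_add symfun_mconst symfun_hz)

lemma hspan_scale: "f \<in> hspan \<Longrightarrow> mconst c * f \<in> hspan"
  using hspan_lin[of f 0 c] by simp

lemma hspan_add: "f \<in> hspan \<Longrightarrow> g \<in> hspan \<Longrightarrow> f + g \<in> hspan"
  using hspan_lin[of f g 1] by simp

lemma hspan_diff: "f \<in> hspan \<Longrightarrow> g \<in> hspan \<Longrightarrow> f - g \<in> hspan"
  using hspan_lin[of g f "-1"] by (simp add: mconst_ring)

lemma hspan_sum: "(\<And>x. x \<in> A \<Longrightarrow> f x \<in> hspan) \<Longrightarrow> (\<Sum>x\<in>A. f x) \<in> hspan"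
  by (induction A rule: infinite_finite_induct) (auto simp: hspan_add)

lemma hspan_hperp: "f \<in> hspan \<Longrightarrow> hperp c f \<in> hspan"
  by (induction arbitrary: c rule: hspan.induct)
    (auto simp: hperp_hz_mult intro: hspan_add hspan_scale hspan_sum hspan_hz_mult)

lemma hspan_eperp: "f \<in> hspan \<Longrightarrow> eperp n f \<in> hspan"
proof (induction arbitrary: n rule: hspan.induct)
  case (hspan_hz_mult f k)
  then show ?case
    by (cases n) (auto simp: eperp_Suc_hz_mult hspan_symfun
        intro: hspan_diff hspan.hspan_hz_mult)
qed (auto intro: hspan_add hspan_scale)

lemma hspan_bern: "f \<in> hspan \<Longrightarrow> bern a f \<in> hspan"
  using symfun_deg[OF hspan_symfun, of f]
  by (auto simp: bern_eq_sum intro!: hspan_sum hspan_hz_mult hspan_eperp)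

text \<open>The two-term rule for one generator h_k is applied once to h_k times f g and once to h_k
  times f.\<close>

lemma eperp_mult:
  "f \<in> hspan \<Longrightarrow> g \<in> symfun \<Longrightarrow> eperp n (f * g) = (\<Sum>i\<le>n. eperp i f * eperp (n - i) g)"
proof (induction arbitrary: n rule: hspan.induct)
  case hspan_1
  have "(\<Sum>i\<le>n. eperp i 1 * eperp (n - i) g) = (\<Sum>i\<in>{0}. eperp i 1 * eperp (n - i) g)"
    by (rule sum.mono_neutral_right) auto
  then show ?case by simp
next
  case (hspan_hz_mult f k)
  show ?case
  proof (cases n)
    case (Suc n')
    have "eperp n (hz k * (f * g)) = hz k * eperp n (f * g) - hz (k - 1) * eperp n' (f * g)"
      using hspan_hz_mult by (simp add: Suc eperp_Suc_hz_mult symfun_mult hspan_symfun)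
    also have "\<dots> = hz k * (f * eperp n g)
       + (\<Sum>i\<le>n'. (hz k * eperp (Suc i) f - hz (k - 1) * eperp i f) * eperp (n' - i) g)"
      unfolding hspan_hz_mult.IH[OF hspan_hz_mult.prems] unfolding Suc
      by (subst sum.atMost_Suc_shift)
        (simp add: algebra_simps sum_distrib_left sum_subtractf sum.distrib)
    also have "\<dots> = (\<Sum>i\<le>n. eperp i (hz k * f) * eperp (n - i) g)"
      unfolding Suc using hspan_hz_mult.hyps
      by (subst sum.atMost_Suc_shift)
        (simp add: eperp_Suc_hz_mult hspan_symfun mult.assoc)
    finally show ?thesis by (simp add: mult.assoc)
  qed simp
next
  case (hspan_lin f f' c)
  have "eperp n ((mconst c * f + f') * g) = mconst c * eperp n (f * g) + eperp n (f' * g)"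
    by (simp add: distrib_right mult.assoc)
  then show ?case using hspan_lin
    by (simp add: sum_distrib_left sum.distrib distrib_right[of _ _ "eperp _ _"] mult.assoc)
qed simp

text \<open>The product rule for \<open>eperp\<close>, regrouped by the degree j that falls on
  \<open>x\<close>; what is left is an operator on \<open>g\<close> with index raised by j.\<close>

lemma bern_mult:
  assumes "g \<in> hspan" "x \<in> symfun" "deg_le N x"
  shows "bern a (g * x) = (\<Sum>j\<le>N. bern (a + int j) g * eperp j x)"
proof -
  obtain M where M: "deg_le M g" using hspan_symfun[OF assms(1)] by (auto simp: symfun_iff)
  have "deg_le (N + M) (g * x)" using deg_le_mult[OF M assms(3)] by (simp add: add.commute)
  then have "bern a (g * x) = (\<Sum>i\<le>N + M. \<Sum>j\<le>i. hz (a + int i) * (eperp (i - j) g * eperp j x))"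
    unfolding bern_eq_sum[OF \<open>deg_le (N + M) (g * x)\<close>] eperp_mult[OF assms(1,2)]
    by (intro sum.cong refl, subst sum.atLeastAtMost_rev[of _ 0, simplified atLeast0AtMost])
      (simp add: sum_distrib_left)
  also have "\<dots> = (\<Sum>i\<le>N + M. \<Sum>j\<le>i. hz (a + int (j + (i - j))) * (eperp (i - j) g * eperp j x))"
    by simp
  also have "\<dots> = (\<Sum>j\<le>N. \<Sum>l\<le>M. hz (a + int (j + l)) * (eperp l g * eperp j x))"
    by (rule sum_triangle_rect[where \<phi> = "\<lambda>j l. hz (a + int (j + l)) * (eperp l g * eperp j x)"])
      (use eperp_eq_0[OF M] eperp_eq_0[OF assms(3)] in auto)
  also have "\<dots> = (\<Sum>j\<le>N. bern (a + int j) g * eperp j x)"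
    by (simp add: bern_eq_sum[OF M] sum_distrib_right mult.assoc add.assoc)
  finally show ?thesis .
qed

text \<open>On 1 the two sides are 2 by 2 Jacobi-Trudi determinants with rows exchanged. Pulling h_n
  out of both operators gives four terms with indices shifted by 0 or 1; the relation matches them
  with the four terms of the other side, exchanging the middle two.\<close>

lemma bern_antisym:
  "f \<in> hspan \<Longrightarrow> bern a (bern b f) = - bern (b - 1) (bern (a + 1) f)"
proof (induction arbitrary: a b rule: hspan.induct)
  case hspan_1
  have "bern a (hz b :: 'a mseries) = hz b * hz a - hz (b - 1) * hz (a + 1)" for a b :: int
    using bern_hz_mult[OF symfun_1, of a b] by simp
  from this[of a b] this[of "b - 1" "a + 1"] show ?case by (simp add: mult.commute)
next
  case (hspan_hz_mult f n)
  have f: "f \<in> symfun" using hspan_hz_mult.hyps by (rule hspan_symfun)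
  have expand: "bern a (bern b (hz n * f)) = hz n * bern a (bern b f) - hz (n - 1) * bern (a + 1) (bern b f)
     - hz (n - 1) * bern a (bern (b + 1) f) + hz (n - 2) * bern (a + 1) (bern (b + 1) f)" for a b
    using f by (simp add: bern_hz_mult bern_diff symfun_mult symfun_bern)
  let ?B = "\<lambda>a b. bern a (bern b f)"
  have I: "?B a (b + 1) = - ?B b (a + 1)" "?B (a + 1) (b + 1) = - ?B b (a + 1 + 1)"
    using hspan_hz_mult.IH[of a "b + 1"] hspan_hz_mult.IH[of "a + 1" "b + 1"]
    unfolding add_diff_cancel_right' by blast+
  have R: "bern (b - 1) (bern (a + 1) (hz n * f)) = hz n * ?B (b - 1) (a + 1) - hz (n - 1) * ?B b (a + 1)
     - hz (n - 1) * ?B (b - 1) (a + 1 + 1) + hz (n - 2) * ?B b (a + 1 + 1)"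
    using expand[of "b - 1" "a + 1"] unfolding diff_add_cancel by blast
  show ?case
    unfolding expand[of a b] hspan_hz_mult.IH[of a b] hspan_hz_mult.IH[of "a + 1" b] I R
    by (simp add: algebra_simps)
next
  case (hspan_lin f g c)
  from hspan_lin.hyps show ?case
    by (simp add: bern_add bern_scale hspan_symfun symfun_mult symfun_bern
        hspan_lin.IH(1)[of a b] hspan_lin.IH(2)[of a b])
qed simp

text \<open>\<open>bern_antisym\<close> says only that this is its own negative, which over an
  arbitrary ring does not make it zero. Hence a separate induction, in which
  \<open>bern_antisym\<close> cancels the two middle terms.\<close>

lemma bern_bern_Suc: "f \<in> hspan \<Longrightarrow> bern a (bern (a + 1) f) = 0"
proof (induction arbitrary: a rule: hspan.induct)
  case hspan_1
  show ?case using bern_hz_mult[OF symfun_1, of a "a + 1"] by simp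
next
  case (hspan_hz_mult f n)
  have f: "f \<in> symfun" using hspan_hz_mult.hyps by (rule hspan_symfun)
  have "bern a (bern (a + 1) (hz n * f)) = hz n * bern a (bern (a + 1) f)
     - hz (n - 1) * (bern (a + 1) (bern (a + 1) f) + bern a (bern (a + 1 + 1) f))
     + hz (n - 2) * bern (a + 1) (bern (a + 1 + 1) f)"
    using f by (simp add: bern_hz_mult bern_diff symfun_mult symfun_bern) (simp add: algebra_simps)
  also have "bern (a + 1) (bern (a + 1) f) = - bern a (bern (a + 1 + 1) f)"
    using bern_antisym[OF hspan_hz_mult.hyps, of "a + 1" "a + 1"] by simp
  finally show ?case using hspan_hz_mult.IH[of a] hspan_hz_mult.IH[of "a + 1"] by simp
next
  case (hspan_lin f g c)
  then show ?case
    by (simp add: bern_add bern_scale hspan_symfun symfun_mult symfun_bern)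
qed simp

section \<open>Strip rules for iterated Bernstein operators\<close>

text \<open>Terms cancel in pairs. At a fixed point the sign rule gives only
  \<open>f x = - f x\<close>, so vanishing there is assumed separately.\<close>

lemma sum_involution_eq_0:
  fixes f :: "'b \<Rightarrow> 'c::ab_group_add"
  assumes "finite S"
    and "\<And>x. x \<in> S \<Longrightarrow> \<tau> x \<in> S" "\<And>x. x \<in> S \<Longrightarrow> \<tau> (\<tau> x) = x"
    and "\<And>x. x \<in> S \<Longrightarrow> f (\<tau> x) = - f x" "\<And>x. x \<in> S \<Longrightarrow> \<tau> x = x \<Longrightarrow> f x = 0"
  shows "sum f S = 0"
  using assms
proof (induction "card S" arbitrary: S rule: less_induct)
  case less
  show ?case
  proof (cases "S = {}")
    case False
    then obtain x where x: "x \<in> S" by auto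
    define S' where "S' = S - {x, \<tau> x}"
    have "card S' < card S"
      unfolding S'_def using x less.prems(1) by (intro psubset_card_mono) auto
    moreover have "\<tau> y \<in> S'" if "y \<in> S'" for y
      using that x less.prems(2,3) unfolding S'_def by (metis Diff_iff insert_iff singletonD)
    ultimately have "sum f S' = 0"
      using less.prems by (intro less.hyps) (auto simp: S'_def)
    moreover have "sum f S = sum f S' + sum f {x, \<tau> x}"
      unfolding S'_def using x less.prems(1,2) by (intro sum.subset_diff) auto
    moreover have "sum f {x, \<tau> x} = 0"
      using x less.prems(4,5) by (cases "\<tau> x = x") auto
    ultimately show ?thesis by simp
  qed simp
qed

text \<open>A coefficient of the product of two generating series. The direction \<open>e\<close> is
  -1 when h_c^perp lowers indices (\<open>hperp_bern\<close>) and 1 when multiplication by h_n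
  raises them (\<open>hsym_mult_bern\<close>).\<close>

definition bconv :: "int \<Rightarrow> int \<Rightarrow> (nat \<Rightarrow> 'a::comm_ring_1 mseries) \<Rightarrow> nat \<Rightarrow> 'a mseries" where
  "bconv e p F c = (\<Sum>j\<le>c. bern (p + e * int j) (F (c - j)))"

text \<open>Because the starting indices differ by exactly 1, the exchange relation merely swaps i
  and j; terms cancel across the diagonal and vanish on it.\<close>

lemma bconv_bconv_Suc:
  assumes "\<And>i. F i \<in> hspan"
  shows "bconv e p (bconv e (p + 1) F) c = 0"
proof -
  define G where "G = (\<lambda>j i. bern (p + e * int j) (bern (p + 1 + e * int i) (F (c - (j + i)))))"
  have fin: "finite {(i, j). i + j \<le> c}"
    by (rule finite_subset[of _ "{..c} \<times> {..c}"]) auto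
  have "bconv e p (bconv e (p + 1) F) c = (\<Sum>j\<le>c. \<Sum>i\<le>c - j. G j i)"
    unfolding bconv_def G_def using assms
    by (auto intro!: sum.cong simp: bern_sum hspan_bern hspan_symfun)
  also have "\<dots> = (\<Sum>(j, i)\<in>{(j, i). j + i \<le> c}. G j i)"
    by (subst sum.Sigma) (auto intro!: sum.cong)
  also have "\<dots> = 0"
  proof (rule sum_involution_eq_0[OF fin, where \<tau> = prod.swap])
    fix x :: "nat \<times> nat" assume x: "x \<in> {(i, j). i + j \<le> c}"
    obtain i j where ij: "x = (i, j)" by (cases x)
    have "G j i = - G i j"
      using bern_antisym[OF assms[of "c - (i + j)"], of "p + e * int j" "p + 1 + e * int i"]
      by (simp add: G_def ac_simps)
    then show "(case prod.swap x of (j, i) \<Rightarrow> G j i) = - (case x of (j, i) \<Rightarrow> G j i)"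
      by (simp add: ij)
    assume "prod.swap x = x"
    then have "i = j" using ij by (metis prod.inject swap_simp)
    then show "(case x of (j, i) \<Rightarrow> G j i) = 0"
      using bern_bern_Suc[OF assms[of "c - (i + j)"], of "p + e * int j"]
      by (simp add: ij G_def ac_simps)
  qed auto
  finally show ?thesis .
qed

text \<open>Here \<open>w\<close> will be the largest displacement that keeps the rows in order. The
  tail beyond it is again a convolution, ready for \<open>bconv_bconv_Suc\<close>.\<close>

lemma bconv_split:
  "bconv e p F c = (\<Sum>j\<in>{j. j \<le> w \<and> j \<le> c}. bern (p + e * int j) (F (c - j)))
     + (if c < Suc w then 0 else bconv e (p + e * (int w + 1)) F (c - Suc w))"
proof (cases "c < Suc w")
  case True
  then have "{j. j \<le> w \<and> j \<le> c} = {..c}" by auto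
  with True show ?thesis by (simp add: bconv_def)
next
  case False
  have "(\<Sum>j\<le>c. bern (p + e * int j) (F (c - j)))
     = (\<Sum>j\<in>{j. j \<le> w \<and> j \<le> c}. bern (p + e * int j) (F (c - j)))
     + (\<Sum>j\<in>{Suc w..c}. bern (p + e * int j) (F (c - j)))"
    by (subst sum.union_disjoint[symmetric]) (auto intro!: sum.cong)
  also have "(\<Sum>j\<in>{Suc w..c}. bern (p + e * int j) (F (c - j)))
     = (\<Sum>j\<le>c - Suc w. bern (p + e * (int w + 1) + e * int j) (F (c - Suc w - j)))"
    using False
    by (intro sum.reindex_bij_witness[where i = "\<lambda>j. j + Suc w" and j = "\<lambda>j. j - Suc w"])
      (auto simp: algebra_simps of_nat_diff)
  finally show ?thesis using False by (simp add: bconv_def)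
qed

lemma bconv_shift:
  "bconv e p (\<lambda>m. if m < s then 0 else G (m - s)) n = (if n < s then 0 else bconv e p G (n - s))"
proof (cases "n < s")
  case False
  have "(\<Sum>j\<le>n. bern (p + e * int j) (if n - j < s then 0 else G (n - j - s)))
     = (\<Sum>j\<le>n - s. bern (p + e * int j) (if n - j < s then 0 else G (n - j - s)))"
    by (rule sum.mono_neutral_right) auto
  also have "\<dots> = (\<Sum>j\<le>n - s. bern (p + e * int j) (G (n - s - j)))"
    using False by (intro sum.cong) (auto simp: add.commute)
  finally show ?thesis using False by (simp add: bconv_def)
qed (auto simp: bconv_def intro!: sum.neutral)

lemma bconv_diff:
  "(\<And>m. F m \<in> hspan) \<Longrightarrow> (\<And>m. G m \<in> hspan) \<Longrightarrow>
   bconv e p (\<lambda>m. F m - G m) n = bconv e p F n - bconv e p G n"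
  by (simp add: bconv_def bern_diff hspan_symfun sum_subtractf)

lemma bconv_delta: "bconv e p (\<lambda>m. if m = 0 then 1 else 0) n = hz (p + e * int n)"
proof -
  have "(\<Sum>j\<le>n. bern (p + e * int j) (if n - j = 0 then 1 else 0))
     = (\<Sum>j\<in>{n}. bern (p + e * int j) (if n - j = 0 then 1 else 0))"
    by (rule sum.mono_neutral_right) auto
  then show ?thesis by (simp add: bconv_def)
qed

lemma hspan_bconv: "(\<And>i. F i \<in> hspan) \<Longrightarrow> bconv e p F n \<in> hspan"
  by (auto simp: bconv_def intro!: hspan_sum hspan_bern)

section \<open>Iterated operators and the removal of horizontal strips by h_c^perp\<close>

fun berns :: "nat list \<Rightarrow> 'a::comm_ring_1 mseries \<Rightarrow> 'a mseries" where
  "berns [] f = f"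
| "berns (p # ps) f = bern (int p) (berns ps f)"

lemma berns_append: "berns (ps @ qs) f = berns ps (berns qs f)"
  by (induction ps) auto

lemma hspan_berns: "f \<in> hspan \<Longrightarrow> berns ps f \<in> hspan"
  by (induction ps) (auto intro: hspan_bern)

definition hd0 :: "nat list \<Rightarrow> nat" where
  "hd0 ps = (case ps of [] \<Rightarrow> 0 | q # _ \<Rightarrow> q)"

lemma hd0_simps [simp]: "hd0 [] = 0" "hd0 (p # ps) = p"
  by (simp_all add: hd0_def)

text \<open>Interlacing rows are what remains after removing a horizontal strip. Rows of length 0
  are kept, so the number of operators does not change.\<close>

fun dstrips :: "nat list \<Rightarrow> nat list set" where
  "dstrips [] = {[]}"
| "dstrips (p # ps) = {r # rs | r rs. hd0 ps \<le> r \<and> r \<le> p \<and> rs \<in> dstrips ps}"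

lemma finite_dstrips [simp]: "finite (dstrips ps)"
proof (induction ps)
  case (Cons p ps)
  have "dstrips (p # ps) \<subseteq> (\<lambda>(r, rs). r # rs) ` ({..p} \<times> dstrips ps)" by auto
  with Cons show ?case by (meson finite_SigmaI finite_atMost finite_imageI finite_subset)
qed simp

lemma sum_list_dstrips: "rs \<in> dstrips ps \<Longrightarrow> sum_list rs \<le> sum_list ps"
  by (induction ps arbitrary: rs) (auto intro!: add_mono)

text \<open>By \<open>hperp_bern\<close> the first row may drop by any amount. The drops below the
  next row \<open>q\<close> form a convolution starting at \<open>q - 1\<close>, which vanishes
  because the inner one starts at \<open>q\<close>.\<close>

lemma hperp_berns:
  assumes "sorted_wrt (\<ge>) ps"
  shows "hperp c (berns ps (1 :: 'a::comm_ring_1 mseries))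
    = (\<Sum>rs\<in>{rs \<in> dstrips ps. sum_list rs + c = sum_list ps}. berns rs 1)"
  using assms
proof (induction ps arbitrary: c)
  case Nil
  have "{rs \<in> dstrips []. sum_list rs + c = sum_list []} = (if c = 0 then {[]} else {})"
    by auto
  then show ?case by simp
next
  case (Cons p ps)
  define F where "F = (\<lambda>i. hperp i (berns ps (1 :: 'a mseries)))"
  define q where "q = hd0 ps"
  have qp: "q \<le> p" using Cons.prems by (cases ps) (auto simp: q_def)
  have F: "F i \<in> hspan" for i unfolding F_def by (intro hspan_hperp hspan_berns) simp
  \<comment> \<open>The excess terms. With no further row, \<open>q\<close> is 0 and they are
    complete functions of negative index.\<close>
  have res: "bconv (-1) (int q - 1) F d = 0" for d
  proof (cases ps)
    case Nil
    then have "F = (\<lambda>i. if i = 0 then 1 else 0)" by (simp add: F_def fun_eq_iff)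
    with Nil show ?thesis by (simp add: bconv_delta q_def hz_neg)
  next
    case (Cons q' ps')
    then have "F = bconv (-1) (int q - 1 + 1) (\<lambda>i. hperp i (berns ps' 1))"
      by (simp add: F_def q_def fun_eq_iff bconv_def hperp_bern hspan_symfun hspan_berns)
    then show ?thesis by (simp only:) (intro bconv_bconv_Suc hspan_hperp hspan_berns hspan_1)
  qed
  have "hperp c (berns (p # ps) (1 :: 'a mseries)) = bconv (-1) (int p) F c"
    by (simp add: bconv_def F_def hperp_bern hspan_symfun hspan_berns)
  also have "\<dots> = (\<Sum>j\<in>{j. j \<le> p - q \<and> j \<le> c}. bern (int p - int j) (F (c - j)))"
  proof -
    have "int p + - 1 * (int (p - q) + 1) = int q - 1" using qp by simp
    then show ?thesis
      unfolding bconv_split[of "-1" "int p" F c "p - q"] by (simp only: res) simp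
  qed
  also have "\<dots> = (\<Sum>j\<in>{j. j \<le> p - q \<and> j \<le> c}.
      \<Sum>rs\<in>{rs \<in> dstrips ps. sum_list rs + (c - j) = sum_list ps}. berns ((p - j) # rs) 1)"
  proof (rule sum.cong[OF refl])
    fix j assume "j \<in> {j. j \<le> p - q \<and> j \<le> c}"
    then have eq: "int p - int j = int (p - j)" by auto
    have "hperp (c - j) (berns ps (1 :: 'a mseries)) =
      (\<Sum>rs\<in>{rs \<in> dstrips ps. sum_list rs + (c - j) = sum_list ps}. berns rs 1)"
      using Cons.prems by (intro Cons.IH) simp
    then show "bern (int p - int j) (F (c - j)) =
      (\<Sum>rs\<in>{rs \<in> dstrips ps. sum_list rs + (c - j) = sum_list ps}. berns ((p - j) # rs) 1)"
      unfolding eq F_def by (simp only:) (simp add: bern_sum hspan_symfun hspan_berns)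
  qed
  also have "\<dots> = (\<Sum>(j, rs)\<in>(SIGMA j:{j. j \<le> p - q \<and> j \<le> c}.
      {rs \<in> dstrips ps. sum_list rs + (c - j) = sum_list ps}). berns ((p - j) # rs) 1)"
    by (rule sum.Sigma) auto
  also have "\<dots> = (\<Sum>rs\<in>{rs \<in> dstrips (p # ps). sum_list rs + c = sum_list (p # ps)}. berns rs 1)"
    using qp
    by (intro sum.reindex_bij_witness[where i = "\<lambda>rs. (p - hd rs, tl rs)" and j = "\<lambda>(j, rs). (p - j) # rs"])
      (auto simp: q_def dest: sum_list_dstrips)
  finally show ?case .
qed

section \<open>The Pieri rule: multiplication by h_n adds horizontal strips\<close>

fun ustrips :: "nat \<Rightarrow> nat list \<Rightarrow> nat list set" where
  "ustrips M [] = (\<lambda>r. [r]) ` {..M}"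
| "ustrips M (q # ps) = {r # rs | r rs. q \<le> r \<and> r \<le> M \<and> rs \<in> ustrips q ps}"

lemma finite_ustrips [simp]: "finite (ustrips M ps)"
proof (induction ps arbitrary: M)
  case (Cons p ps)
  have "ustrips M (p # ps) \<subseteq> (\<lambda>(r, rs). r # rs) ` ({..M} \<times> ustrips p ps)" by auto
  with Cons show ?case by (meson finite_SigmaI finite_atMost finite_imageI finite_subset)
qed simp

lemma sum_list_ustrips: "rs \<in> ustrips M ps \<Longrightarrow> sum_list ps \<le> sum_list rs"
  by (induction ps arbitrary: M rs) (auto intro!: add_mono)

definition upsum :: "nat \<Rightarrow> nat \<Rightarrow> nat list \<Rightarrow> 'a::comm_ring_1 mseries" where
  "upsum m M ps = (\<Sum>rs\<in>{rs \<in> ustrips M ps. sum_list rs = sum_list ps + m}. berns rs 1)"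

text \<open>The rows below the first one of an enlarged \<open>ps\<close>: the head \<open>q\<close>
  caps the first of them. With no head there are no such rows, and only \<open>m = 0\<close>
  remains.\<close>

definition uptail :: "nat list \<Rightarrow> nat \<Rightarrow> 'a::comm_ring_1 mseries" where
  "uptail ps m = (case ps of [] \<Rightarrow> if m = 0 then 1 else 0 | q # ps' \<Rightarrow> upsum m q ps')"

lemma hspan_upsum: "upsum m M ps \<in> hspan"
  by (auto simp: upsum_def intro!: hspan_sum hspan_berns)

lemma hspan_uptail: "uptail ps m \<in> hspan"
  by (cases ps) (auto simp: uptail_def hspan_upsum)

lemma upsum_eq:
  assumes "hd0 ps \<le> M"
  shows "(upsum m M ps :: 'a::comm_ring_1 mseries) = (\<Sum>j\<in>{j. j \<le> M - hd0 ps \<and> j \<le> m}. bern (int (hd0 ps) + 1 * int j) (uptail ps (m - j)))"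
proof (cases ps)
  case Nil
  have "{rs \<in> ustrips M []. sum_list rs = sum_list [] + m} = (if m \<le> M then {[m]} else {})" by auto
  moreover have "(\<Sum>j\<in>{j. j \<le> M \<and> j \<le> m}. bern (int j) (if m \<le> j then 1 else (0 :: 'a mseries)))
    = (\<Sum>j\<in>(if m \<le> M then {m} else {}). bern (int j) (if m \<le> j then 1 else 0))"
    by (rule sum.mono_neutral_right) auto
  ultimately show ?thesis by (simp add: Nil upsum_def uptail_def)
next
  case (Cons q ps')
  have "(\<Sum>j\<in>{j. j \<le> M - q \<and> j \<le> m}. bern (int q + int j) (upsum (m - j) q ps' :: 'a mseries))
    = (\<Sum>j\<in>{j. j \<le> M - q \<and> j \<le> m}. \<Sum>rs\<in>{rs \<in> ustrips q ps'. sum_list rs = sum_list ps' + (m - j)}.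
        berns ((q + j) # rs) 1)"
    by (simp add: upsum_def bern_sum hspan_symfun hspan_berns)
  also have "\<dots> = (\<Sum>(j, rs)\<in>(SIGMA j:{j. j \<le> M - q \<and> j \<le> m}.
      {rs \<in> ustrips q ps'. sum_list rs = sum_list ps' + (m - j)}). berns ((q + j) # rs) 1)"
    by (rule sum.Sigma) auto
  also have "\<dots> = upsum m M ps"
    unfolding upsum_def Cons using assms Cons
    by (intro sum.reindex_bij_witness[where i = "\<lambda>rs. (hd rs - q, tl rs)" and j = "\<lambda>(j, rs). (q + j) # rs"])
      (auto dest: sum_list_ustrips)
  finally show ?thesis by (simp add: Cons uptail_def)
qed

text \<open>The first row is unbounded here. Moving h_m past the operator of \<open>q\<close>
  therefore leaves the second row unbounded too; the terms in which it exceeds \<open>q\<close>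
  cancel.\<close>

lemma hsym_mult_berns_bconv:
  "sorted_wrt (\<ge>) ps \<Longrightarrow>
   hsym m * berns ps (1 :: 'a::comm_ring_1 mseries) = bconv 1 (int (hd0 ps)) (uptail ps) m"
proof (induction ps arbitrary: m)
  case Nil
  have "uptail [] = (\<lambda>m. if m = 0 then 1 else (0 :: 'a mseries))"
    by (simp add: uptail_def fun_eq_iff)
  then show ?case by (simp add: bconv_delta)
next
  case (Cons q ps)
  define q' where "q' = hd0 ps"
  define T :: "nat \<Rightarrow> 'a mseries" where "T = uptail ps"
  \<comment> \<open>The terms with second row larger than \<open>q\<close>; their convolution starts
    at \<open>q + 1\<close>, one above the outer one.\<close>
  define R where "R = (\<lambda>m. if m < Suc (q - q') then 0 else bconv 1 (int q + 1) T (m - Suc (q - q')))"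
  have q': "q' \<le> q" using Cons.prems by (cases ps) (auto simp: q'_def)
  have T: "T i \<in> hspan" for i by (simp add: T_def hspan_uptail)
  have "int q' + 1 * (int (q - q') + 1) = int q + 1" using q' by simp
  then have up: "upsum k q ps = bconv 1 (int q') T k - R k" for k
    unfolding bconv_split[of 1 "int q'" T k "q - q'"] R_def
    using upsum_eq[of ps q k] q' by (simp add: q'_def T_def)
  have "bconv 1 (int q) R m = 0"
    unfolding R_def bconv_shift using bconv_bconv_Suc[OF T, of 1 "int q"] by simp
  have "hsym m * berns (q # ps) (1 :: 'a mseries) = bconv 1 (int q) (\<lambda>k. hsym k * berns ps 1) m"
    by (simp add: bconv_def hsym_mult_bern hspan_symfun hspan_berns)
  also have "\<dots> = bconv 1 (int q) (\<lambda>k. bconv 1 (int q') T k) m"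
    using Cons by (simp add: q'_def T_def)
  also have "\<dots> = bconv 1 (int q) (\<lambda>k. bconv 1 (int q') T k - R k) m"
    using \<open>bconv 1 (int q) R m = 0\<close>
    by (subst bconv_diff) (auto simp: R_def intro!: hspan_bconv T)
  also have "\<dots> = bconv 1 (int (hd0 (q # ps))) (uptail (q # ps)) m"
    by (simp add: up[symmetric] uptail_def[abs_def])
  finally show ?case .
qed

lemma hsym_mult_berns:
  assumes "sorted_wrt (\<ge>) ps" "hd0 ps + m \<le> M"
  shows "hsym m * berns ps (1 :: 'a::comm_ring_1 mseries)
    = (\<Sum>rs\<in>{rs \<in> ustrips M ps. sum_list rs = sum_list ps + m}. berns rs 1)"
proof -
  have "{j. j \<le> M - hd0 ps \<and> j \<le> m} = {..m}" using assms(2) by auto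
  then show ?thesis
    using upsum_eq[of ps M m, where 'a = 'a] assms
    by (simp add: hsym_mult_berns_bconv bconv_def upsum_def[symmetric])
qed

section \<open>Removal of vertical strips by e_n^perp\<close>

fun vstrips :: "nat list \<Rightarrow> nat list set" where
  "vstrips [] = {[]}"
| "vstrips (p # ps) = {r # rs | r rs. r \<le> p \<and> p \<le> Suc r \<and> rs \<in> vstrips ps \<and> hd0 rs \<le> r}"

lemma finite_vstrips [simp]: "finite (vstrips ps)"
proof (induction ps)
  case (Cons p ps)
  have "vstrips (p # ps) \<subseteq> (\<lambda>(r, rs). r # rs) ` ({..p} \<times> vstrips ps)" by auto
  with Cons show ?case by (meson finite_SigmaI finite_atMost finite_imageI finite_subset)
qed simp

lemma hd0_vstrips: "rs \<in> vstrips ps \<Longrightarrow> hd0 rs \<le> hd0 ps"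
  by (cases ps) auto

lemma sum_list_vstrips: "rs \<in> vstrips ps \<Longrightarrow> sum_list rs \<le> sum_list ps"
  by (induction ps arbitrary: rs) (auto intro!: add_mono)

text \<open>If lowering the first row breaks the order, the row below equals \<open>p\<close>, and
  the indices \<open>p - 1\<close>, \<open>p\<close> are killed by \<open>bern_bern_Suc\<close>;
  with no row below, \<open>p = 0\<close> and the result is \<open>hz (-1)\<close>.\<close>

lemma bern_pred_berns_vstrips:
  assumes "rs \<in> vstrips ps" "hd0 ps \<le> p" "p = 0 \<or> \<not> hd0 rs \<le> p - 1"
  shows "bern (int p - 1) (berns rs 1) = 0"
proof -
  have hd: "hd0 rs = p" using hd0_vstrips[OF assms(1)] assms(2,3) by auto
  show ?thesis
  proof (cases rs)
    case Nil
    with hd show ?thesis by (simp add: hz_neg)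
  next
    case (Cons r rs')
    with hd have "r = p" by simp
    then show ?thesis
      using bern_bern_Suc[OF hspan_berns[OF hspan_1], of "int p - 1" rs'] by (simp add: Cons)
  qed
qed

text \<open>By \<open>eperp_Suc_bern\<close> the first row stays or drops by one. Here a drop may
  break the order only by one, and such terms are zero individually, without cancellation.\<close>

lemma eperp_berns:
  assumes "sorted_wrt (\<ge>) ps"
  shows "eperp n (berns ps (1 :: 'a::comm_ring_1 mseries))
    = (- 1) ^ n * (\<Sum>rs\<in>{rs \<in> vstrips ps. sum_list rs + n = sum_list ps}. berns rs 1)"
  using assms
proof (induction ps arbitrary: n)
  case Nil
  have "{rs \<in> vstrips []. sum_list rs + n = sum_list []} = (if n = 0 then {[]} else {})"
    by auto
  then show ?case by simp
next
  case (Cons p ps)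
  define V where "V = (\<lambda>n. {rs \<in> vstrips ps. sum_list rs + n = sum_list ps})"
  \<comment> \<open>The remaining rows that may follow a lowered first row; none if there is nothing
    to lower.\<close>
  define V' where "V' = (\<lambda>n. if p = 0 \<or> n = 0 then {} else {rs \<in> V (n - 1). hd0 rs \<le> p - 1})"
  have fin [simp]: "finite (V n)" "finite (V' n)" for n by (auto simp: V_def V'_def)
  have hp: "hd0 ps \<le> p" using Cons.prems by (cases ps) auto
  have hd_le: "hd0 rs \<le> p" if "rs \<in> vstrips ps" for rs
    using hd0_vstrips[OF that] hp by simp
  have IH: "eperp n (berns ps (1 :: 'a mseries)) = mconst ((- 1) ^ n) * (\<Sum>rs\<in>V n. berns rs 1)" for n
    using Cons by (simp add: V_def neg_one_power_mult)
  have eq: "{rs \<in> vstrips (p # ps). sum_list rs + n = sum_list (p # ps)}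
      = (#) p ` V n \<union> (#) (p - 1) ` V' n" (is "?L = ?R")
  proof (rule equalityI; rule subsetI)
    fix xs assume "xs \<in> ?L"
    then obtain r rs where xs: "xs = r # rs" "r \<le> p" "p \<le> Suc r" "rs \<in> vstrips ps" "hd0 rs \<le> r"
      "r + sum_list rs + n = p + sum_list ps" by auto
    show "xs \<in> ?R"
    proof (cases "r = p")
      case False
      with xs have r: "p = Suc r" by simp
      then have "n \<noteq> 0" using xs sum_list_vstrips[OF xs(4)] by auto
      then have "rs \<in> V' n" using xs r by (auto simp: V_def V'_def)
      with xs r show ?thesis by auto
    qed (use xs in \<open>auto simp: V_def\<close>)
  next
    fix xs assume "xs \<in> ?R"
    then show "xs \<in> ?L"
      using hd_le by (auto simp: V_def V'_def split: if_splits)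
  qed
  have disj: "(#) p ` V n \<inter> (#) (p - 1) ` V' n = {}"
    by (auto simp: V'_def)
  have "(\<Sum>rs\<in>?L. berns rs (1 :: 'a mseries))
     = (\<Sum>rs\<in>V n. bern (int p) (berns rs 1)) + (\<Sum>rs\<in>V' n. bern (int (p - 1)) (berns rs 1))"
    unfolding eq by (subst sum.union_disjoint) (auto simp: disj[simplified] sum.reindex)
  also have "(\<Sum>rs\<in>V' n. bern (int (p - 1)) (berns rs (1 :: 'a mseries)))
     = (if n = 0 then 0 else \<Sum>rs\<in>V (n - 1). bern (int p - 1) (berns rs 1))"
  proof (cases "p = 0 \<or> n = 0")
    case True
    then show ?thesis
      using bern_pred_berns_vstrips[OF _ hp] by (auto simp: V'_def V_def intro!: sum.neutral)
  next
    case False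
    then have "(\<Sum>rs\<in>V' n. bern (int (p - 1)) (berns rs (1 :: 'a mseries)))
        = (\<Sum>rs\<in>V' n. bern (int p - 1) (berns rs 1))" by (simp add: of_nat_diff)
    also have "\<dots> = (\<Sum>rs\<in>V (n - 1). bern (int p - 1) (berns rs 1))"
      using False bern_pred_berns_vstrips[OF _ hp]
      by (intro sum.mono_neutral_left) (auto simp: V'_def V_def)
    finally show ?thesis using False by simp
  qed
  finally have R: "(\<Sum>rs\<in>?L. berns rs (1 :: 'a mseries)) = (\<Sum>rs\<in>V n. bern (int p) (berns rs 1))
     + (if n = 0 then 0 else \<Sum>rs\<in>V (n - 1). bern (int p - 1) (berns rs 1))" .
  have bern_IH: "bern k (eperp n (berns ps (1 :: 'a mseries)))
      = mconst ((- 1) ^ n) * (\<Sum>rs\<in>V n. bern k (berns rs 1))" for k n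
    by (simp add: IH bern_scale bern_sum hspan_symfun hspan_berns symfun_sum)
  show ?case
  proof (cases n)
    case 0
    then show ?thesis unfolding R using bern_IH[of "int p" 0] by simp
  next
    case (Suc n')
    have "eperp n (berns (p # ps) (1 :: 'a mseries))
      = bern (int p) (eperp n (berns ps 1)) - bern (int p - 1) (eperp n' (berns ps 1))"
      by (simp add: Suc eperp_Suc_bern hspan_symfun hspan_berns)
    then show ?thesis unfolding R bern_IH neg_one_power_mult[symmetric]
      by (simp add: Suc algebra_simps)
  qed
qed

section \<open>Partitions, strips and conjugation\<close>

lemma part_antimono: "i \<le> j \<Longrightarrow> part lam j \<le> part lam i"
  using part[of lam] by (auto simp: antimono_def)

lemma finite_part_support [simp]: "finite {i. part lam i \<noteq> 0}"
  using part[of lam] by auto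

lemma partition_eqI: "(\<And>i. part lam i = part mu i) \<Longrightarrow> lam = mu"
  by (auto simp: part_inject[symmetric] fun_eq_iff)

lemma down_closed_iff_less_card:
  fixes S :: "nat set"
  assumes "finite S" "\<And>i j. j \<in> S \<Longrightarrow> i \<le> j \<Longrightarrow> i \<in> S"
  shows "i \<in> S \<longleftrightarrow> i < card S"
proof -
  have *: "{..<card S} = S"
  proof (cases "S = {}")
    case False
    have "S = {..Max S}" using assms(1) False by (auto intro: assms(2)[OF Max_in])
    then have "card S = Suc (Max S)" by (metis card_atMost)
    with \<open>S = {..Max S}\<close> show ?thesis by (simp add: lessThan_Suc_atMost)
  qed simp
  show ?thesis by (subst *[symmetric]) simp
qed

lemma part_neq_0_iff: "part lam i \<noteq> 0 \<longleftrightarrow> i < plength lam"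
  unfolding plength_def
  using down_closed_iff_less_card[of "{i. part lam i \<noteq> 0}" i] part_antimono[of _ _ lam]
  by (metis (mono_tags, lifting) finite_part_support le_zero_eq mem_Collect_eq)

lemma part_eq_0: "plength lam \<le> i \<Longrightarrow> part lam i = 0"
  using part_neq_0_iff[of lam i] by simp

lemma plength_le_iff: "plength lam \<le> k \<longleftrightarrow> part lam k = 0"
  using part_neq_0_iff[of lam k] by auto

lemma finite_cells [simp]: "finite (cells lam)"
proof -
  have "i < plength lam \<and> j < part lam 0" if "j < part lam i" for i j
    using that part_antimono[of 0 i lam] part_neq_0_iff[of lam i] by auto
  then have "cells lam \<subseteq> {..<plength lam} \<times> {..<part lam 0}" by (auto simp: cells_def)
  then show ?thesis by (rule finite_subset) simp
qed

lemma cells_eq_Sigma: "plength lam \<le> k \<Longrightarrow> cells lam = (SIGMA i:{..<k}. {..<part lam i})"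
  by (auto simp: cells_def) (metis less_le_trans not_less_zero part_neq_0_iff)

lemma psize_eq_sum: "plength lam \<le> k \<Longrightarrow> psize lam = (\<Sum>i<k. part lam i)"
  unfolding psize_def by (rule sum.mono_neutral_left) (auto simp: part_eq_0)

lemma card_cells: "card (cells lam) = psize lam"
  by (simp add: cells_eq_Sigma[OF le_refl] psize_def)

text \<open>This symmetric form replaces the cardinality in the definition of \<open>pconj\<close>:
  parts are compared through the numbers below them, where conjugation just swaps row and
  column.\<close>

lemma less_pconj_iff: "i < part (pconj lam) j \<longleftrightarrow> j < part lam i"
proof -
  have "finite {i. j < part lam i}"
    by (rule finite_subset[OF _ finite_part_support[of lam]]) auto
  then have "i \<in> {i. j < part lam i} \<longleftrightarrow> i < card {i. j < part lam i}"
    using part_antimono[of _ _ lam] by (intro down_closed_iff_less_card) (auto intro: less_le_trans)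
  then show ?thesis by (simp add: pconj.rep_eq)
qed

lemma nat_eq_iff_less: "x = y \<longleftrightarrow> (\<forall>i::nat. i < x \<longleftrightarrow> i < y)"
  by (metis linorder_neqE_nat less_irrefl)

lemma pconj_pconj [simp]: "pconj (pconj lam) = lam"
  by (rule partition_eqI, subst nat_eq_iff_less) (simp add: less_pconj_iff)

lemma psize_pconj [simp]: "psize (pconj lam) = psize lam"
proof -
  have "cells (pconj lam) = prod.swap ` cells lam"
    by (force simp: cells_def less_pconj_iff)
  then have "card (cells (pconj lam)) = card (cells lam)"
    by (simp add: card_image)
  then show ?thesis by (simp add: card_cells)
qed

lemma finite_psize_le: "finite {lam. psize lam \<le> n}"
proof (rule finite_imageD)
  have bound: "part lam i \<le> n" and len: "plength lam \<le> n" if "psize lam \<le> n" for lam i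
  proof -
    have "part lam 0 \<le> psize lam"
    proof (cases "plength lam = 0")
      case False
      then show ?thesis unfolding psize_def by (intro member_le_sum) auto
    qed (simp add: part_eq_0)
    then show "part lam i \<le> n" using that part_antimono[of 0 i lam] by simp
    have "(\<Sum>i<plength lam. 1) \<le> psize lam" unfolding psize_def
      by (intro sum_mono) (use part_neq_0_iff[of lam] in \<open>simp add: Suc_le_eq\<close>)
    then show "plength lam \<le> n" using that by simp
  qed
  show "finite ((\<lambda>lam. map (part lam) [0..<n]) ` {lam. psize lam \<le> n})"
    by (rule finite_subset[OF _ finite_lists_length_eq[of "{..n}" n]]) (auto simp: bound)
  show "inj_on (\<lambda>lam. map (part lam) [0..<n]) {lam. psize lam \<le> n}"
  proof (rule inj_onI, rule partition_eqI)
    fix lam mu i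
    assume le: "lam \<in> {lam. psize lam \<le> n}" "mu \<in> {lam. psize lam \<le> n}"
      and eq: "map (part lam) [0..<n] = map (part mu) [0..<n]"
    show "part lam i = part mu i"
    proof (cases "i < n")
      case True
      then show ?thesis using eq by simp
    next
      case False
      then show ?thesis using len[of lam] len[of mu] le by (simp add: part_eq_0)
    qed
  qed
qed

lemma finite_psize_eq [simp]: "finite {lam. psize lam = n}"
  by (rule finite_subset[OF _ finite_psize_le[of n]]) auto

text \<open>Interlacing says that the cells of \<open>lam\<close> outside \<open>mu\<close> form a
  horizontal strip, with no two in the same column.\<close>

definition hstrip :: "nat_partition \<Rightarrow> nat_partition \<Rightarrow> bool" where
  "hstrip mu lam \<longleftrightarrow> (\<forall>i. part lam (Suc i) \<le> part mu i \<and> part mu i \<le> part lam i)"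

definition vstrip :: "nat_partition \<Rightarrow> nat_partition \<Rightarrow> bool" where
  "vstrip mu lam \<longleftrightarrow> (\<forall>i. part mu i \<le> part lam i \<and> part lam i \<le> Suc (part mu i))"

lemma nat_le_iff_less: "(x::nat) \<le> y \<longleftrightarrow> (\<forall>i. i < x \<longrightarrow> i < y)"
  by (meson less_irrefl less_le_trans not_le)

lemma nat_le_Suc_iff_less: "x \<le> Suc y \<longleftrightarrow> (\<forall>i. Suc i < x \<longrightarrow> i < y)"
  by (cases x) (auto simp: nat_le_iff_less[of _ y])

text \<open>Transposing turns at most one extra cell per column into at most one per row.\<close>

lemma hstrip_pconj_iff: "hstrip (pconj mu) (pconj lam) \<longleftrightarrow> vstrip mu lam"
  unfolding hstrip_def vstrip_def nat_le_Suc_iff_less nat_le_iff_less[of "part _ _" "part _ _"]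
    less_pconj_iff by blast

section \<open>Strips of partitions, read as lists padded with zeros\<close>

definition plist :: "nat \<Rightarrow> nat_partition \<Rightarrow> nat list" where
  "plist k lam = map (part lam) [0..<k]"

definition nth0 :: "nat list \<Rightarrow> nat \<Rightarrow> nat" where
  "nth0 xs i = (if i < length xs then xs ! i else 0)"

lemma length_plist [simp]: "length (plist k lam) = k"
  by (simp add: plist_def)

lemma nth_plist [simp]: "i < k \<Longrightarrow> plist k lam ! i = part lam i"
  by (simp add: plist_def)

lemma nth0_plist: "plength lam \<le> k \<Longrightarrow> nth0 (plist k lam) i = part lam i"
  by (simp add: nth0_def part_eq_0)

lemma sum_list_plist: "plength lam \<le> k \<Longrightarrow> sum_list (plist k lam) = psize lam"
  by (simp add: plist_def psize_eq_sum sum_list_sum_nth atLeast0LessThan)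

lemma sorted_plist: "sorted_wrt (\<ge>) (plist k lam)"
  by (auto simp: sorted_wrt_iff_nth_less part_antimono)

lemma inj_on_plist: "inj_on (plist k) {lam. plength lam \<le> k}"
  by (rule inj_onI, rule partition_eqI) (metis mem_Collect_eq nth0_plist)

lemma ex_plist:
  assumes "\<And>i. nth0 rs (Suc i) \<le> nth0 rs i"
  obtains mu where "plength mu \<le> length rs" "rs = plist (length rs) mu"
proof -
  have "antimono (nth0 rs)"
    unfolding antimono_iff_le_Suc using assms by simp
  moreover have "finite {i. nth0 rs i \<noteq> 0}"
    by (rule finite_subset[of _ "{..<length rs}"]) (auto simp: nth0_def)
  ultimately have part: "part (Abs_nat_partition (nth0 rs)) = nth0 rs"
    by (intro Abs_nat_partition_inverse) simp
  show ?thesis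
  proof
    show "plength (Abs_nat_partition (nth0 rs)) \<le> length rs"
      by (simp add: plength_le_iff part nth0_def)
    show "rs = plist (length rs) (Abs_nat_partition (nth0 rs))"
      by (intro nth_equalityI) (auto simp: part nth0_def)
  qed
qed

lemma nth0_Cons_simps [simp]: "nth0 (x # xs) 0 = x" "nth0 (x # xs) (Suc i) = nth0 xs i" "nth0 [] i = 0"
  by (simp_all add: nth0_def)

lemma hd0_eq_nth0: "hd0 xs = nth0 xs 0"
  by (cases xs) auto

lemma all_nat_split: "(\<forall>i. P i) \<longleftrightarrow> P 0 \<and> (\<forall>i. P (Suc i))"
  by (metis nat.exhaust)

lemma dstrips_iff:
  "rs \<in> dstrips ps \<longleftrightarrow> length rs = length ps \<and>
    (\<forall>i. nth0 ps (Suc i) \<le> nth0 rs i \<and> nth0 rs i \<le> nth0 ps i)"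
proof (induction ps arbitrary: rs)
  case (Cons p ps)
  show ?case
  proof (cases rs)
    case (Cons r rs')
    then show ?thesis
      using Cons.IH[of rs'] by (subst all_nat_split) (auto simp: hd0_eq_nth0)
  qed auto
qed (auto simp: nth0_def)

lemma ustrips_iff:
  "rs \<in> ustrips M ps \<longleftrightarrow> length rs = Suc (length ps) \<and> nth0 rs 0 \<le> M \<and>
    (\<forall>i. nth0 rs (Suc i) \<le> nth0 ps i \<and> nth0 ps i \<le> nth0 rs i)"
proof (induction ps arbitrary: M rs)
  case Nil
  then show ?case by (cases rs) (auto simp: nth0_def)
next
  case (Cons q ps)
  show ?case
  proof (cases rs)
    case (Cons r rs')
    then show ?thesis
      using Cons.IH[of rs' q] by (subst all_nat_split) auto
  qed auto
qed

lemma vstrips_iff: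
  "rs \<in> vstrips ps \<longleftrightarrow> length rs = length ps \<and>
    (\<forall>i. nth0 rs i \<le> nth0 ps i \<and> nth0 ps i \<le> Suc (nth0 rs i)) \<and> (\<forall>i. nth0 rs (Suc i) \<le> nth0 rs i)"
proof (induction ps arbitrary: rs)
  case (Cons p ps)
  show ?case
  proof (cases rs)
    case (Cons r rs')
    then show ?thesis
      using Cons.IH[of rs'] by (subst (1 2) all_nat_split) (auto simp: hd0_eq_nth0)
  qed auto
qed (auto simp: nth0_def)

text \<open>
  This turns out to be \<open>schur lam\<close> (\<open>schur_eq_bschur\<close>). The Pieri rules are easier to prove for the
  product of Bernstein operators than for the generating function of tableaux.
\<close>

definition bschur :: "nat_partition \<Rightarrow> 'a::comm_ring_1 mseries" where
  "bschur lam = berns (plist (plength lam) lam) 1"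

text \<open>Padding is harmless because \<open>bern 0 1 = hz 0 = 1\<close>.\<close>

lemma berns_plist: "plength lam \<le> k \<Longrightarrow> berns (plist k lam) 1 = bschur lam"
proof (induction k)
  case 0
  then show ?case by (simp add: bschur_def)
next
  case (Suc k)
  show ?case
  proof (cases "plength lam = Suc k")
    case False
    with Suc have le: "plength lam \<le> k" by simp
    then have "plist (Suc k) lam = plist k lam @ [0]" by (simp add: plist_def part_eq_0)
    with Suc le show ?thesis by (simp add: berns_append)
  qed (simp add: bschur_def)
qed

lemma hspan_bschur: "bschur lam \<in> hspan"
  by (simp add: bschur_def hspan_berns)

lemma sum_plist_image:
  assumes "S \<subseteq> {lam. plength lam \<le> k}"
  shows "(\<Sum>rs\<in>plist k ` S. berns rs 1) = (\<Sum>lam\<in>S. bschur lam)"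
proof -
  have "inj_on (plist k) S" using inj_on_plist assms by (rule inj_on_subset)
  then have "(\<Sum>rs\<in>plist k ` S. berns rs 1) = (\<Sum>lam\<in>S. berns (plist k lam) 1)"
    by (simp add: sum.reindex)
  also have "\<dots> = (\<Sum>lam\<in>S. bschur lam)"
    using assms by (intro sum.cong) (auto simp: berns_plist)
  finally show ?thesis .
qed

lemma hstrip_plength:
  assumes "hstrip mu lam"
  shows "plength mu \<le> plength lam" "plength lam \<le> Suc (plength mu)"
  using assms part_eq_0[of lam, OF le_refl] part_eq_0[of mu, OF le_refl]
  unfolding hstrip_def plength_le_iff by (metis le_zero_eq)+

lemma vstrip_plength: "vstrip mu lam \<Longrightarrow> plength mu \<le> plength lam"
  using part_eq_0[of lam, OF le_refl] unfolding vstrip_def plength_le_iff by (metis le_zero_eq)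

lemma hperp_bschur:
  "hperp c (bschur lam) = (\<Sum>mu\<in>{mu. hstrip mu lam \<and> psize mu + c = psize lam}. bschur mu)"
proof -
  define k where "k = plength lam"
  have "{rs \<in> dstrips (plist k lam). sum_list rs + c = sum_list (plist k lam)}
      = plist k ` {mu. hstrip mu lam \<and> psize mu + c = psize lam}"
  proof (intro equalityI subsetI)
    fix rs assume rs: "rs \<in> {rs \<in> dstrips (plist k lam). sum_list rs + c = sum_list (plist k lam)}"
    then have iff: "length rs = k" "part lam (Suc i) \<le> nth0 rs i" "nth0 rs i \<le> part lam i" for i
      by (simp_all add: dstrips_iff nth0_plist k_def)
    obtain mu where mu: "plength mu \<le> length rs" "rs = plist (length rs) mu"
      using iff by (metis ex_plist le_trans)
    have nth0: "nth0 rs i = part mu i" for i using nth0_plist[OF mu(1)] mu(2) by simp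
    then have "hstrip mu lam" using iff by (simp add: hstrip_def)
    moreover have "psize mu + c = psize lam"
      using rs sum_list_plist[OF mu(1)] sum_list_plist[of lam k] by (simp add: mu(2)[symmetric] k_def)
    ultimately show "rs \<in> plist k ` {mu. hstrip mu lam \<and> psize mu + c = psize lam}"
      using mu iff(1) by auto
  next
    fix rs assume "rs \<in> plist k ` {mu. hstrip mu lam \<and> psize mu + c = psize lam}"
    then obtain mu where "rs = plist k mu" "hstrip mu lam" "psize mu + c = psize lam" by auto
    then show "rs \<in> {rs \<in> dstrips (plist k lam). sum_list rs + c = sum_list (plist k lam)}"
      using hstrip_plength(1)[of mu lam]
      by (auto simp: dstrips_iff nth0_plist k_def sum_list_plist hstrip_def)
  qed
  then show ?thesis
    unfolding bschur_def[of lam] k_def[symmetric]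
    by (subst hperp_berns[OF sorted_plist])
      (auto intro!: sum_plist_image dest: hstrip_plength simp: k_def)
qed

lemma eperp_bschur:
  "eperp n (bschur lam) = (- 1) ^ n * (\<Sum>mu\<in>{mu. vstrip mu lam \<and> psize mu + n = psize lam}. bschur mu)"
proof -
  define k where "k = plength lam"
  have "{rs \<in> vstrips (plist k lam). sum_list rs + n = sum_list (plist k lam)}
      = plist k ` {mu. vstrip mu lam \<and> psize mu + n = psize lam}"
  proof (intro equalityI subsetI)
    fix rs assume rs: "rs \<in> {rs \<in> vstrips (plist k lam). sum_list rs + n = sum_list (plist k lam)}"
    then have iff: "length rs = k" "nth0 rs (Suc i) \<le> nth0 rs i"
      "nth0 rs i \<le> part lam i" "part lam i \<le> Suc (nth0 rs i)" for i
      by (simp_all add: vstrips_iff nth0_plist k_def)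
    obtain mu where mu: "plength mu \<le> length rs" "rs = plist (length rs) mu"
      using iff by (metis ex_plist)
    have nth0: "nth0 rs i = part mu i" for i using nth0_plist[OF mu(1)] mu(2) by simp
    then have "vstrip mu lam" using iff by (simp add: vstrip_def)
    moreover have "psize mu + n = psize lam"
      using rs sum_list_plist[OF mu(1)] sum_list_plist[of lam k] by (simp add: mu(2)[symmetric] k_def)
    ultimately show "rs \<in> plist k ` {mu. vstrip mu lam \<and> psize mu + n = psize lam}"
      using mu iff(1) by auto
  next
    fix rs assume "rs \<in> plist k ` {mu. vstrip mu lam \<and> psize mu + n = psize lam}"
    then obtain mu where "rs = plist k mu" "vstrip mu lam" "psize mu + n = psize lam" by auto
    then show "rs \<in> {rs \<in> vstrips (plist k lam). sum_list rs + n = sum_list (plist k lam)}"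
      using vstrip_plength[of mu lam]
      by (auto simp: vstrips_iff nth0_plist k_def sum_list_plist vstrip_def part_antimono)
  qed
  then show ?thesis
    unfolding bschur_def[of lam] k_def[symmetric]
    by (subst eperp_berns[OF sorted_plist])
      (auto intro!: sum_plist_image arg_cong2[where f = "(*)"] dest: vstrip_plength simp: k_def)
qed

lemma hsym_mult_bschur:
  "hsym n * bschur lam = (\<Sum>mu\<in>{mu. hstrip lam mu \<and> psize mu = psize lam + n}. bschur mu)"
proof -
  define k where "k = plength lam"
  \<comment> \<open>All rows grow, so the first one gains at most \<open>n\<close>; the cap
    \<open>part lam 0 + n\<close> for \<open>ustrips\<close> excludes nothing.\<close>
  have M: "part mu 0 \<le> part lam 0 + n" if "hstrip lam mu" "psize mu = psize lam + n" for mu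
  proof -
    have remove: "psize nu = part nu 0 + (\<Sum>i\<in>{..<Suc k} - {0}. part nu i)"
      if "plength nu \<le> Suc k" for nu
      unfolding psize_eq_sum[OF that] by (rule sum.remove) auto
    have "psize mu = part mu 0 + (\<Sum>i\<in>{..<Suc k} - {0}. part mu i)"
      using hstrip_plength(2)[OF that(1)] by (intro remove) (simp add: k_def)
    moreover have "psize lam = part lam 0 + (\<Sum>i\<in>{..<Suc k} - {0}. part lam i)"
      by (intro remove) (simp add: k_def)
    moreover have "(\<Sum>i\<in>{..<Suc k} - {0}. part lam i) \<le> (\<Sum>i\<in>{..<Suc k} - {0}. part mu i)"
      using that(1) by (intro sum_mono) (auto simp: hstrip_def)
    ultimately show ?thesis using that(2) by linarith
  qed
  have "{rs \<in> ustrips (part lam 0 + n) (plist k lam). sum_list rs = sum_list (plist k lam) + n}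
      = plist (Suc k) ` {mu. hstrip lam mu \<and> psize mu = psize lam + n}" (is "?L = ?R")
  proof (intro equalityI subsetI)
    fix rs assume rs: "rs \<in> ?L"
    then have iff: "length rs = Suc k" "nth0 rs (Suc i) \<le> part lam i" "part lam i \<le> nth0 rs i" for i
      by (simp_all add: ustrips_iff nth0_plist k_def)
    obtain mu where mu: "plength mu \<le> length rs" "rs = plist (length rs) mu"
      using iff by (metis ex_plist le_trans)
    have nth0: "nth0 rs i = part mu i" for i using nth0_plist[OF mu(1)] mu(2) by simp
    then have "hstrip lam mu" using iff by (simp add: hstrip_def)
    moreover have "psize mu = psize lam + n"
      using rs sum_list_plist[OF mu(1)] sum_list_plist[of lam k] by (simp add: mu(2)[symmetric] k_def)
    ultimately show "rs \<in> ?R" using mu iff(1) by auto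
  next
    fix rs assume "rs \<in> ?R"
    then obtain mu where "rs = plist (Suc k) mu" "hstrip lam mu" "psize mu = psize lam + n" by auto
    then show "rs \<in> ?L"
      using hstrip_plength[of lam mu] M[of mu]
      by (auto simp: ustrips_iff nth0_plist k_def sum_list_plist hstrip_def)
  qed
  moreover have "hd0 (plist k lam) = part lam 0"
    by (simp add: hd0_eq_nth0 nth0_plist k_def)
  ultimately show ?thesis
    unfolding bschur_def[of lam] k_def[symmetric]
    by (subst hsym_mult_berns[OF sorted_plist, where M = "part lam 0 + n"])
      (auto intro!: sum_plist_image dest: hstrip_plength simp: k_def)
qed

section \<open>Semistandard tableaux\<close>

definition ssyt_content :: "nat_partition \<Rightarrow> nat multiset \<Rightarrow> (nat \<times> nat \<Rightarrow> nat) set" where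
  "ssyt_content lam m = {T \<in> ssyt lam. image_mset T (mset_set (cells lam)) = m}"

lemma mcoeff_schur: "mcoeff (schur lam) m = of_nat (card (ssyt_content lam m))"
  by (simp add: schur.rep_eq ssyt_content_def)

lemma ssyt_contentD:
  assumes "T \<in> ssyt_content lam m"
  shows "T \<in> extensional (cells lam)" "image_mset T (mset_set (cells lam)) = m"
    "(i, Suc j) \<in> cells lam \<Longrightarrow> T (i, j) \<le> T (i, Suc j)"
    "(Suc i, j) \<in> cells lam \<Longrightarrow> T (i, j) < T (Suc i, j)"
  using assms by (auto simp: ssyt_content_def ssyt_def)

lemma ssyt_content_set: "T \<in> ssyt_content lam m \<Longrightarrow> x \<in> cells lam \<Longrightarrow> T x \<in># m"
  using ssyt_contentD(2)[of T lam m] by (metis finite_cells finite_set_mset_mset_set imageI set_image_mset)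

lemma finite_ssyt_content [simp]: "finite (ssyt_content lam m)"
proof (rule finite_subset)
  show "ssyt_content lam m \<subseteq> cells lam \<rightarrow>\<^sub>E set_mset m"
  proof
    fix T assume T: "T \<in> ssyt_content lam m"
    show "T \<in> cells lam \<rightarrow>\<^sub>E set_mset m"
      unfolding PiE_iff using ssyt_content_set[OF T] ssyt_contentD(1)[OF T] by blast
  qed
  show "finite (cells lam \<rightarrow>\<^sub>E set_mset m)" by (intro finite_PiE) auto
qed

lemma cells_eq_iff: "cells lam = cells mu \<longleftrightarrow> lam = mu"
proof
  assume eq: "cells lam = cells mu"
  show "lam = mu"
  proof (rule partition_eqI, subst nat_eq_iff_less, intro allI)
    fix i j show "j < part lam i \<longleftrightarrow> j < part mu i"
      using eq by (auto simp: cells_def set_eq_iff)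
  qed
qed simp

lemma cells_down: "(i, j) \<in> cells lam \<Longrightarrow> i' \<le> i \<Longrightarrow> j' \<le> j \<Longrightarrow> (i', j') \<in> cells lam"
  using part_antimono[of i' i lam] by (auto simp: cells_def)

lemma ssyt_row_mono:
  assumes "T \<in> ssyt_content lam m" "(i, j') \<in> cells lam" "j \<le> j'"
  shows "T (i, j) \<le> T (i, j')"
  using assms(3,2)
proof (induction j' rule: dec_induct)
  case (step n)
  have "(i, n) \<in> cells lam" using step.prems by (rule cells_down) auto
  then show ?case using step.IH ssyt_contentD(3)[OF assms(1) step.prems] by simp
qed simp

definition ssyt_extend :: "nat_partition \<Rightarrow> nat \<Rightarrow> nat_partition \<Rightarrow> (nat \<times> nat \<Rightarrow> nat) \<Rightarrow> nat \<times> nat \<Rightarrow> nat"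
  where "ssyt_extend lam r mu T = (\<lambda>x. if x \<in> cells mu then T x else if x \<in> cells lam then r else undefined)"

lemma hstrip_cells: "hstrip mu lam \<Longrightarrow> cells mu \<subseteq> cells lam"
  unfolding hstrip_def cells_def by (auto intro: less_le_trans)

lemma hstrip_cells_Suc: "hstrip mu lam \<Longrightarrow> (Suc i, j) \<in> cells lam \<Longrightarrow> (i, j) \<in> cells mu"
  unfolding hstrip_def cells_def by (auto intro: less_le_trans)

lemma image_mset_mset_set_cong:
  "finite A \<Longrightarrow> (\<And>x. x \<in> A \<Longrightarrow> f x = g x) \<Longrightarrow> image_mset f (mset_set A) = image_mset g (mset_set A)"
  by (intro image_mset_cong) auto

lemma ssyt_extend_in:
  assumes T: "T \<in> ssyt_content mu m" and m: "set_mset m \<subseteq> {..<r}"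
    and strip: "hstrip mu lam" "psize mu + c = psize lam"
  shows "ssyt_extend lam r mu T \<in> ssyt_content lam (m + replicate_mset c r)"
proof -
  let ?E = "ssyt_extend lam r mu T"
  have sub: "cells mu \<subseteq> cells lam" using strip(1) by (rule hstrip_cells)
  have less: "T x < r" if "x \<in> cells mu" for x using ssyt_content_set[OF T that] m by auto
  have "?E \<in> extensional (cells lam)"
    using sub by (auto simp: ssyt_extend_def extensional_def)
  moreover have "?E (i, j) \<le> ?E (i, Suc j)" if "(i, Suc j) \<in> cells lam" for i j
  proof -
    have "(i, j) \<in> cells lam" using that by (rule cells_down) auto
    moreover have "(i, j) \<in> cells mu" if "(i, Suc j) \<in> cells mu" using that by (rule cells_down) auto
    ultimately show ?thesis
      using that less[of "(i, j)"] ssyt_contentD(3)[OF T, of i j] by (auto simp: ssyt_extend_def)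
  qed
  moreover have "?E (i, j) < ?E (Suc i, j)" if "(Suc i, j) \<in> cells lam" for i j
    using hstrip_cells_Suc[OF strip(1) that] that less[of "(i, j)"] ssyt_contentD(4)[OF T, of i j]
    by (auto simp: ssyt_extend_def)
  moreover have "image_mset ?E (mset_set (cells lam)) = m + replicate_mset c r"
  proof -
    have "mset_set (cells lam) = mset_set (cells mu) + mset_set (cells lam - cells mu)"
      using sub by (subst mset_set_Union[symmetric]) (auto simp: Un_absorb1)
    moreover have "image_mset ?E (mset_set (cells mu)) = image_mset T (mset_set (cells mu))"
      by (rule image_mset_mset_set_cong) (auto simp: ssyt_extend_def)
    moreover have "image_mset ?E (mset_set (cells lam - cells mu))
        = image_mset (\<lambda>_. r) (mset_set (cells lam - cells mu))"
      by (rule image_mset_mset_set_cong) (auto simp: ssyt_extend_def)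
    moreover have "card (cells lam - cells mu) = c"
      using sub strip(2) by (simp add: card_Diff_subset card_cells)
    ultimately show ?thesis
      using ssyt_contentD(2)[OF T] by (simp add: image_mset_const_eq)
  qed
  ultimately show ?thesis by (simp add: ssyt_content_def ssyt_def)
qed

text \<open>Columns increase strictly and \<open>r\<close> is the largest possible entry, so each
  column contains \<open>r\<close> at most once: the cells filled with \<open>r\<close> form a
  horizontal strip.\<close>

lemma ssyt_extend_surj:
  assumes T: "T \<in> ssyt_content lam (m + replicate_mset c r)" and m: "set_mset m \<subseteq> {..<r}"
  obtains mu where "hstrip mu lam" "psize mu + c = psize lam"
    "restrict T (cells mu) \<in> ssyt_content mu m"
    "T = ssyt_extend lam r mu (restrict T (cells mu))"
proof -
  have le: "T x \<le> r" if "x \<in> cells lam" for x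
    using ssyt_content_set[OF T that] m by (auto simp: less_imp_le split: if_splits)
  \<comment> \<open>Row lengths of the subtableau of entries below \<open>r\<close>; weakly
    increasing rows make these cells an initial segment of each row.\<close>
  define p where "p = (\<lambda>i. card {j. (i, j) \<in> cells lam \<and> T (i, j) < r})"
  have p_iff: "j < p i \<longleftrightarrow> (i, j) \<in> cells lam \<and> T (i, j) < r" for i j
  proof -
    have "finite {j. (i, j) \<in> cells lam \<and> T (i, j) < r}"
      by (rule finite_subset[of _ "{..<part lam i}"]) (auto simp: cells_def)
    moreover have "j \<in> {j. (i, j) \<in> cells lam \<and> T (i, j) < r}"
      if "j' \<in> {j. (i, j) \<in> cells lam \<and> T (i, j) < r}" "j \<le> j'" for j j'
      using that ssyt_row_mono[OF T, of i j' j] by (auto intro: cells_down)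
    ultimately have "j \<in> {j. (i, j) \<in> cells lam \<and> T (i, j) < r} \<longleftrightarrow> j < p i"
      unfolding p_def by (rule down_closed_iff_less_card)
    then show ?thesis by simp
  qed
  have p_le: "p i \<le> part lam i" for i
    using p_iff[of _ i] by (subst nat_le_iff_less) (auto simp: cells_def)
  have le_p: "part lam (Suc i) \<le> p i" for i
  proof (subst nat_le_iff_less, intro allI impI)
    fix j assume "j < part lam (Suc i)"
    then have j: "(Suc i, j) \<in> cells lam" by (simp add: cells_def)
    then have "T (i, j) < r" using ssyt_contentD(4)[OF T j] le[OF j] by simp
    with j show "j < p i" by (auto simp: p_iff intro: cells_down)
  qed
  have "antimono p"
    unfolding antimono_iff_le_Suc using p_le le_p le_trans by blast
  moreover have "finite {i. p i \<noteq> 0}"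
  proof (rule finite_subset[OF _ finite_part_support[of lam]], intro subsetI CollectI)
    fix i assume "i \<in> {i. p i \<noteq> 0}"
    then show "part lam i \<noteq> 0" using p_le[of i] by simp
  qed
  ultimately have part: "part (Abs_nat_partition p) = p"
    by (intro Abs_nat_partition_inverse) simp
  define mu where "mu = Abs_nat_partition p"
  have "(i, j) \<in> cells mu \<longleftrightarrow> (i, j) \<in> cells lam \<and> T (i, j) < r" for i j
    by (simp add: p_iff[symmetric] mu_def part cells_def[of "Abs_nat_partition p"])
  then have cells: "cells mu = {x \<in> cells lam. T x < r}" by auto
  have hs: "hstrip mu lam" using p_le le_p by (simp add: hstrip_def mu_def part)
  have "image_mset T (mset_set (cells mu))
      = filter_mset (\<lambda>i. i < r) (image_mset T (mset_set (cells lam)))"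
    by (simp add: cells filter_mset_image_mset filter_mset_mset_set)
  also have "\<dots> = filter_mset (\<lambda>i. i < r) m + filter_mset (\<lambda>i. i < r) (replicate_mset c r)"
    unfolding ssyt_contentD(2)[OF T] by simp
  also have "filter_mset (\<lambda>i. i < r) m = m" using m by (auto simp: filter_mset_eq_conv)
  also have "filter_mset (\<lambda>i. i < r) (replicate_mset c r) = {#}"
    by (rule multiset_eqI) auto
  finally have content: "image_mset T (mset_set (cells mu)) = m" by simp
  have "size (image_mset T (mset_set (cells lam))) = size (m + replicate_mset c r)"
    using ssyt_contentD(2)[OF T] by simp
  moreover have "size (image_mset T (mset_set (cells mu))) = size m" using content by simp
  ultimately have size: "psize mu + c = psize lam" by (simp add: card_cells)
  have "restrict T (cells mu) (i, j) \<le> restrict T (cells mu) (i, Suc j)" if "(i, Suc j) \<in> cells mu" for i j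
    using that ssyt_contentD(3)[OF T, of i j] cells_down[OF that, of i j] by (auto simp: cells)
  moreover have "restrict T (cells mu) (i, j) < restrict T (cells mu) (Suc i, j)"
    if "(Suc i, j) \<in> cells mu" for i j
    using that ssyt_contentD(4)[OF T, of i j] cells_down[OF that, of i j] by (auto simp: cells)
  moreover have "image_mset (restrict T (cells mu)) (mset_set (cells mu)) = m"
    unfolding content[symmetric] by (rule image_mset_mset_set_cong) auto
  ultimately have in': "restrict T (cells mu) \<in> ssyt_content mu m"
    by (simp add: ssyt_content_def ssyt_def)
  have "T x = ssyt_extend lam r mu (restrict T (cells mu)) x" for x
    using le[of x] extensional_arb[OF ssyt_contentD(1)[OF T], of x]
    by (cases "x \<in> cells lam") (auto simp: ssyt_extend_def cells)
  then show ?thesis using that[OF hs size in'] by blast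
qed

text \<open>The branching rule: the entries below \<open>r\<close> recover both the smaller shape
  and its tableau, so erasing \<open>r\<close> is a bijection.\<close>

lemma card_ssyt_content_extend:
  assumes m: "set_mset m \<subseteq> {..<r}"
  shows "card (ssyt_content lam (m + replicate_mset c r))
    = (\<Sum>mu\<in>{mu. hstrip mu lam \<and> psize mu + c = psize lam}. card (ssyt_content mu m))"
proof -
  define I where "I = {mu. hstrip mu lam \<and> psize mu + c = psize lam}"
  have fin: "finite I"
    by (rule finite_subset[OF _ finite_psize_le[of "psize lam"]]) (auto simp: I_def)
  have cells: "cells mu = {x \<in> cells lam. ssyt_extend lam r mu T x < r}"
    if "hstrip mu lam" "T \<in> ssyt_content mu m" for mu T
    using hstrip_cells[OF that(1)] ssyt_content_set[OF that(2)] m by (auto simp: ssyt_extend_def)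
  have "bij_betw (\<lambda>(mu, T). ssyt_extend lam r mu T) (SIGMA mu:I. ssyt_content mu m)
      (ssyt_content lam (m + replicate_mset c r))"
  proof (rule bij_betw_imageI)
    show "inj_on (\<lambda>(mu, T). ssyt_extend lam r mu T) (SIGMA mu:I. ssyt_content mu m)"
    proof (rule inj_onI, clarify)
      fix mu T nu U
      assume mu: "mu \<in> I" "T \<in> ssyt_content mu m" and nu: "nu \<in> I" "U \<in> ssyt_content nu m"
        and eq: "ssyt_extend lam r mu T = ssyt_extend lam r nu U"
      have "mu = nu"
        using cells[of mu T] cells[of nu U] mu nu eq unfolding cells_eq_iff[symmetric] I_def by auto
      moreover have "T = U"
      proof (rule extensionalityI[of T "cells nu"])
        show "T x = U x" if "x \<in> cells nu" for x
          using fun_cong[OF eq, of x] that unfolding ssyt_extend_def \<open>mu = nu\<close> by simp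
      qed (use ssyt_contentD(1) mu nu \<open>mu = nu\<close> in blast)+
      ultimately show "mu = nu \<and> T = U" by auto
    qed
    show "(\<lambda>(mu, T). ssyt_extend lam r mu T) ` (SIGMA mu:I. ssyt_content mu m)
        = ssyt_content lam (m + replicate_mset c r)"
    proof (intro equalityI subsetI)
      fix T assume "T \<in> ssyt_content lam (m + replicate_mset c r)"
      from ssyt_extend_surj[OF this m] obtain mu where
        "hstrip mu lam" "psize mu + c = psize lam" "restrict T (cells mu) \<in> ssyt_content mu m"
        "T = ssyt_extend lam r mu (restrict T (cells mu))" .
      then show "T \<in> (\<lambda>(mu, T). ssyt_extend lam r mu T) ` (SIGMA mu:I. ssyt_content mu m)"
        by (intro image_eqI[of _ _ "(mu, restrict T (cells mu))"]) (auto simp: I_def)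
    qed (auto simp: I_def intro: ssyt_extend_in[OF _ m])
  qed
  then have "card (ssyt_content lam (m + replicate_mset c r)) = card (SIGMA mu:I. ssyt_content mu m)"
    by (metis bij_betw_same_card)
  then show ?thesis using fin by (simp add: card_SigmaI I_def[symmetric])
qed

lemma mcoeff_schur_extend:
  "set_mset m \<subseteq> {..<r} \<Longrightarrow> mcoeff (schur lam) (m + replicate_mset c r)
    = (\<Sum>mu\<in>{mu. hstrip mu lam \<and> psize mu + c = psize lam}. mcoeff (schur mu) m)"
  by (simp add: mcoeff_schur card_ssyt_content_extend)

lemma split_max_entry:
  fixes m :: "nat multiset"
  assumes "set_mset m \<subseteq> {..<Suc r}"
  obtains m' c where "m = m' + replicate_mset c r" "set_mset m' \<subseteq> {..<r}"
proof
  show "m = filter_mset (\<lambda>i. i \<noteq> r) m + replicate_mset (count m r) r"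
    by (rule multiset_eqI) auto
  show "set_mset (filter_mset (\<lambda>i. i \<noteq> r) m) \<subseteq> {..<r}" using assms by (auto simp: less_Suc_eq)
qed

text \<open>With positive index every summand has a factor h_{a+i} of positive degree. This is the
  source of the value 0 for more than k rows.\<close>

lemma mcoeff_bern_empty: "f \<in> symfun \<Longrightarrow> 0 < a \<Longrightarrow> mcoeff (bern a f) {#} = 0"
  using symfun_deg[of f] by (auto simp: bern_eq_sum hz_def intro!: sum.neutral)

lemma psize_0_iff: "psize lam = 0 \<longleftrightarrow> plength lam = 0"
proof
  assume "psize lam = 0"
  then have "\<not> 0 < plength lam" using part_neq_0_iff[of lam 0] by (auto simp: psize_def)
  then show "plength lam = 0" by simp
qed (simp add: psize_def)

lemma mcoeff_bschur_empty: "mcoeff (bschur lam) {#} = (if psize lam = 0 then 1 else 0)"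
proof (cases "plength lam")
  case 0
  then show ?thesis by (simp add: bschur_def plist_def psize_0_iff)
next
  case (Suc k)
  then have "plist (plength lam) lam = part lam 0 # map (part lam) [1..<Suc k]"
    by (simp add: plist_def upt_conv_Cons del: upt_Suc)
  moreover have "0 < part lam 0" using part_neq_0_iff[of lam 0] Suc by simp
  ultimately show ?thesis
    using Suc by (simp add: bschur_def psize_0_iff mcoeff_bern_empty hspan_symfun hspan_berns del: upt_Suc)
qed

lemma mcoeff_schur_size: "mcoeff (schur lam) m \<noteq> 0 \<Longrightarrow> size m = psize lam"
proof -
  assume "mcoeff (schur lam) m \<noteq> 0"
  then have "ssyt_content lam m \<noteq> {}" by (auto simp: mcoeff_schur)
  then obtain T where "T \<in> ssyt_content lam m" by blast
  then show ?thesis using ssyt_contentD(2) by (fastforce simp: card_cells)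
qed

lemma mcoeff_schur_empty: "mcoeff (schur lam) {#} = (if psize lam = 0 then 1 else 0)"
proof (cases "psize lam = 0")
  case True
  then have "cells lam = {}" using card_cells[of lam] by simp
  then have "ssyt_content lam {#} = {\<lambda>x. undefined}"
    by (auto simp: ssyt_content_def ssyt_def)
  with True show ?thesis by (simp add: mcoeff_schur)
next
  case False
  then show ?thesis using mcoeff_schur_size[of lam "{#}"] by fastforce
qed

text \<open>Removing the largest variable gives the same recursion on both sides: by branching for
  tableaux, and by \<open>hperp_bschur\<close> for the operator product, whose symmetry is already
  known. The symmetry of Schur functions is then a consequence.\<close>

lemma schur_eq_bschur: "schur lam = bschur lam"
proof (rule mseries_eqI)
  fix m :: "nat multiset"
  obtain r where "set_mset m \<subseteq> {..<r}"
    using finite_nat_set_iff_bounded[of "set_mset m"] by blast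
  then show "mcoeff (schur lam :: 'a mseries) m = mcoeff (bschur lam) m"
  proof (induction r arbitrary: m lam)
    case 0
    then show ?case by (simp add: mcoeff_schur_empty mcoeff_bschur_empty)
  next
    case (Suc r)
    obtain m' c where m: "m = m' + replicate_mset c r" "set_mset m' \<subseteq> {..<r}"
      by (rule split_max_entry[OF Suc.prems])
    show ?case
      unfolding m(1) mcoeff_schur_extend[OF m(2)]
        mcoeff_eq_hperp[OF hspan_symfun[OF hspan_bschur] m(2)] hperp_bschur
      by (simp add: Suc.IH[OF m(2)])
  qed
qed

lemma hspan_schur: "schur lam \<in> hspan"
  by (simp add: schur_eq_bschur hspan_bschur)

lemma symfun_schur: "schur lam \<in> symfun"
  by (intro hspan_symfun hspan_schur)

lemmas eperp_schur = eperp_bschur[folded schur_eq_bschur]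
lemmas hsym_mult_schur = hsym_mult_bschur[folded schur_eq_bschur]

lemma ex_empty_partition:
  obtains emp where "{lam. psize lam = 0} = {emp}" "schur emp = (1 :: 'a::comm_ring_1 mseries)"
proof -
  have "part (Abs_nat_partition (\<lambda>_. 0)) = (\<lambda>_. 0)"
    by (rule Abs_nat_partition_inverse) (simp add: antimono_def)
  then have emp: "psize (Abs_nat_partition (\<lambda>_. 0)) = 0" by (simp add: psize_def)
  have "part lam i = 0" if "psize lam = 0" for lam i
    using that part_eq_0[of lam i] by (simp add: psize_0_iff)
  with emp have "{lam. psize lam = 0} = {Abs_nat_partition (\<lambda>_. 0)}"
    by (auto intro!: partition_eqI)
  moreover have "schur (Abs_nat_partition (\<lambda>_. 0)) = (1 :: 'a mseries)"
    using emp by (simp add: schur_eq_bschur bschur_def plist_def psize_0_iff)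
  ultimately show ?thesis by (rule that)
qed


section \<open>The Schur basis\<close>

text \<open>The monomial x^\<lambda>, as the content of the tableau whose row i is filled with
  i.\<close>

definition pmono :: "nat_partition \<Rightarrow> nat multiset" where
  "pmono lam = image_mset fst (mset_set (cells lam))"

lemma size_pmono [simp]: "size (pmono lam) = psize lam"
  by (simp add: pmono_def card_cells)

lemma count_pmono [simp]: "count (pmono lam) i = part lam i"
proof -
  have "count (pmono lam) i = card {x \<in> cells lam. i = fst x}"
    by (simp add: pmono_def count_image_mset')
  also have "{x \<in> cells lam. i = fst x} = Pair i ` {..<part lam i}" by (auto simp: cells_def)
  finally show ?thesis by (simp add: card_image inj_on_def)
qed

lemma pmono_inject: "pmono lam = pmono mu \<longleftrightarrow> lam = mu"
  by (metis count_pmono partition_eqI)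

lemma ssyt_entry_ge: "T \<in> ssyt_content lam m \<Longrightarrow> (i, j) \<in> cells lam \<Longrightarrow> i \<le> T (i, j)"
proof (induction i)
  case (Suc i)
  then have "(i, j) \<in> cells lam" by (auto intro: cells_down)
  with Suc show ?case using ssyt_contentD(4)[OF Suc.prems] by fastforce
qed simp

text \<open>Columns increase strictly, so every entry is at least its row index. The sum of all
  entries can thus replace the dominance order.\<close>

lemma mcoeff_schur_pmono_le:
  assumes "mcoeff (schur lam) m \<noteq> 0"
  shows "sum_mset (pmono lam) \<le> sum_mset m" "sum_mset (pmono lam) = sum_mset m \<Longrightarrow> m = pmono lam"
proof -
  have "ssyt_content lam m \<noteq> {}" using assms by (auto simp: mcoeff_schur)
  then obtain T where T: "T \<in> ssyt_content lam m" by blast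
  have m: "sum_mset m = (\<Sum>x\<in>cells lam. T x)" "sum_mset (pmono lam) = (\<Sum>x\<in>cells lam. fst x)"
    using ssyt_contentD(2)[OF T] by (auto simp: sum_unfold_sum_mset pmono_def)
  have ge: "fst x \<le> T x" if "x \<in> cells lam" for x
    using ssyt_entry_ge[OF T, of "fst x" "snd x"] that by simp
  then show "sum_mset (pmono lam) \<le> sum_mset m" unfolding m by (intro sum_mono)
  assume eq: "sum_mset (pmono lam) = sum_mset m"
  have "T x = fst x" if "x \<in> cells lam" for x
  proof (rule ccontr)
    assume "T x \<noteq> fst x"
    with ge[OF that] have "fst x < T x" by simp
    then have "(\<Sum>x\<in>cells lam. fst x) < (\<Sum>x\<in>cells lam. T x)"
      using ge that by (intro sum_strict_mono_ex1 ballI bexI[of _ x]) simp_all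
    then show False using eq m by simp
  qed
  then have "image_mset T (mset_set (cells lam)) = image_mset fst (mset_set (cells lam))"
    by (intro image_mset_mset_set_cong) auto
  then show "m = pmono lam" using ssyt_contentD(2)[OF T] by (simp add: pmono_def)
qed

lemma mcoeff_schur_pmono [simp]: "mcoeff (schur lam) (pmono lam) = 1"
proof -
  have "T = restrict fst (cells lam)" if T: "T \<in> ssyt_content lam (pmono lam)" for T
  proof -
    have "(\<Sum>x\<in>cells lam. T x) = (\<Sum>x\<in>cells lam. fst x)"
      using arg_cong[OF ssyt_contentD(2)[OF T], of sum_mset] by (simp add: sum_unfold_sum_mset pmono_def)
    moreover have ge: "fst x \<le> T x" if "x \<in> cells lam" for x
      using ssyt_entry_ge[OF T, of "fst x" "snd x"] that by simp
    ultimately have "T x = fst x" if "x \<in> cells lam" for x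
      using sum_strict_mono_ex1[of "cells lam" fst T] that by (metis finite_cells le_neq_implies_less less_irrefl)
    then show ?thesis
      using ssyt_contentD(1)[OF T] by (auto simp: restrict_def extensional_def fun_eq_iff)
  qed
  moreover have "restrict fst (cells lam) \<in> ssyt_content lam (pmono lam)"
  proof -
    have "image_mset (restrict fst (cells lam)) (mset_set (cells lam)) = pmono lam"
      unfolding pmono_def by (rule image_mset_mset_set_cong) auto
    moreover have "restrict fst (cells lam) (i, j) \<le> restrict fst (cells lam) (i, Suc j)"
      if "(i, Suc j) \<in> cells lam" for i j
      using that cells_down[OF that, of i j] by simp
    moreover have "restrict fst (cells lam) (i, j) < restrict fst (cells lam) (Suc i, j)"
      if "(Suc i, j) \<in> cells lam" for i j
      using that cells_down[OF that, of i j] by simp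
    ultimately show ?thesis by (simp add: ssyt_content_def ssyt_def)
  qed
  ultimately have "ssyt_content lam (pmono lam) = {restrict fst (cells lam)}" by blast
  then show ?thesis by (simp add: mcoeff_schur)
qed

text \<open>Among the images of \<open>m\<close> under permutations, one with minimal sum has weakly decreasing multiplicities.\<close>

lemma ex_permute_pmono:
  fixes m :: "nat multiset"
  obtains \<sigma> mu where "bij \<sigma>" "image_mset \<sigma> m = pmono mu"
proof -
  obtain \<sigma> :: "nat \<Rightarrow> nat" where *: "bij \<sigma> \<and>
      (\<forall>\<tau>. bij \<tau> \<longrightarrow> sum_mset (image_mset \<sigma> m) \<le> sum_mset (image_mset \<tau> m))"
    using ex_has_least_nat[of bij id "\<lambda>\<sigma>. sum_mset (image_mset \<sigma> m)", OF bij_id] by (rule exE)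
  then have \<sigma>: "bij \<sigma>" by (rule conjunct1)
  have min: "sum_mset (image_mset \<sigma> m) \<le> sum_mset (image_mset \<tau> m)" if "bij \<tau>" for \<tau>
    using conjunct2[OF *] that by blast
  define n where "n = image_mset \<sigma> m"
  have "count n (Suc i) \<le> count n i" for i
  proof (rule ccontr)
    assume less: "\<not> count n (Suc i) \<le> count n i"
    define \<tau> where "\<tau> = (\<lambda>x. if x = i then Suc i else if x = Suc i then i else x)"
    have "bij (\<tau> \<circ> \<sigma>)" unfolding \<tau>_def using \<sigma> by (intro bij_comp bij_swap)
    from min[OF this] have "sum_mset n \<le> sum_mset (image_mset \<tau> n)"
      unfolding n_def multiset.map_comp .
    moreover have "sum_mset (image_mset \<tau> n) + count n (Suc i) = sum_mset n + count n i"
    proof (induction n)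
      case (add x n)
      then show ?case by (cases "x = i"; cases "x = Suc i") (simp_all add: \<tau>_def)
    qed simp
    ultimately show False using less by linarith
  qed
  then have "antimono (count n)" by (simp add: antimono_iff_le_Suc)
  then have "part (Abs_nat_partition (count n)) = count n"
    by (intro Abs_nat_partition_inverse) simp
  then have "n = pmono (Abs_nat_partition (count n))" by (intro multiset_eqI) simp
  then show ?thesis using that[OF \<sigma>] by (simp add: n_def)
qed

lemma symmetric_eqI:
  assumes "f \<in> symfun" "g \<in> symfun" "\<And>mu. mcoeff f (pmono mu) = mcoeff g (pmono mu)"
  shows "f = g"
proof (rule mseries_eqI)
  fix m :: "nat multiset"
  obtain \<sigma> mu where "bij \<sigma>" "image_mset \<sigma> m = pmono mu" by (rule ex_permute_pmono)
  then show "mcoeff f m = mcoeff g m"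
    using symfunD[OF assms(1)] symfunD[OF assms(2)] assms(3) by metis
qed

text \<open>
  The matrix of coefficients of Schur functions is unitriangular with respect to the size and the
  weight \<open>\<Sum>\<^sub>i i \<cdot> \<lambda>\<^sub>i\<close>; \<open>scoord f\<close> solves the triangular system for the Schur coordinates of \<open>f\<close>.
\<close>

function scoord :: "'a::comm_ring_1 mseries \<Rightarrow> nat_partition \<Rightarrow> 'a" where
  "scoord f mu = mcoeff f (pmono mu) -
     (\<Sum>lam\<in>{lam. psize lam = psize mu \<and> sum_mset (pmono lam) < sum_mset (pmono mu)}.
        scoord f lam * mcoeff (schur lam) (pmono mu))"
  by auto
termination by (relation "measure (\<lambda>(f, mu). sum_mset (pmono mu))") auto

declare scoord.simps [simp del]

text \<open>By triangularity only \<open>mu\<close> and the partitions of smaller weight contribute,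
  exactly those of the recursion.\<close>

lemma mcoeff_eq_sum_scoord:
  "mcoeff f (pmono mu) = (\<Sum>lam\<in>{lam. psize lam = psize mu}. scoord f lam * mcoeff (schur lam) (pmono mu))"
proof -
  let ?L = "{lam. psize lam = psize mu \<and> sum_mset (pmono lam) < sum_mset (pmono mu)}"
  have fin: "finite ?L" by (rule finite_subset[OF _ finite_psize_eq[of "psize mu"]]) auto
  have "(\<Sum>lam\<in>{lam. psize lam = psize mu}. scoord f lam * mcoeff (schur lam) (pmono mu))
      = (\<Sum>lam\<in>insert mu ?L. scoord f lam * mcoeff (schur lam) (pmono mu))"
  proof (rule sum.mono_neutral_right)
    show "\<forall>lam\<in>{lam. psize lam = psize mu} - insert mu ?L. scoord f lam * mcoeff (schur lam) (pmono mu) = 0"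
    proof
      fix lam assume lam: "lam \<in> {lam. psize lam = psize mu} - insert mu ?L"
      have "mcoeff (schur lam :: 'a mseries) (pmono mu) = 0"
      proof (rule ccontr)
        assume "mcoeff (schur lam :: 'a mseries) (pmono mu) \<noteq> 0"
        from mcoeff_schur_pmono_le[OF this] lam show False by (auto simp: pmono_inject)
      qed
      then show "scoord f lam * mcoeff (schur lam) (pmono mu) = 0" by simp
    qed
  qed auto
  also have "\<dots> = mcoeff f (pmono mu)"
    using fin by (simp add: scoord.simps[of f mu])
  finally show ?thesis by simp
qed

lemma schur_expansion:
  assumes "f \<in> symfun" "deg_le d f"
  shows "f = (\<Sum>lam\<in>{lam. psize lam \<le> d}. mconst (scoord f lam) * schur lam)"
proof (rule symmetric_eqI)
  fix mu
  have size: "mcoeff (schur lam :: 'a mseries) (pmono mu) = 0" if "psize lam \<noteq> psize mu" for lam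
    using that mcoeff_schur_size[of lam "pmono mu", where 'a = 'a] by fastforce
  show "mcoeff f (pmono mu) = mcoeff (\<Sum>lam\<in>{lam. psize lam \<le> d}. mconst (scoord f lam) * schur lam) (pmono mu)"
  proof (cases "psize mu \<le> d")
    case True
    then show ?thesis unfolding mcoeff_eq_sum_scoord[of f mu] mcoeff_sum mcoeff_mconst_mult
      by (intro sum.mono_neutral_left) (auto simp: finite_psize_le size)
  next
    case False
    then have "mcoeff f (pmono mu) = 0" using assms(2) by (intro deg_leD) auto
    moreover have "(\<Sum>lam\<in>{lam. psize lam \<le> d}. scoord f lam * mcoeff (schur lam) (pmono mu)) = 0"
      using False by (intro sum.neutral) (auto simp: size)
    ultimately show ?thesis by simp
  qed
qed (auto intro!: assms symfun_sum symfun_mult symfun_schur)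

lemma scoord_lin: "scoord (mconst c * f + g) mu = c * scoord f mu + scoord g mu"
proof (induction "sum_mset (pmono mu)" arbitrary: mu rule: less_induct)
  case less
  let ?L = "{lam. psize lam = psize mu \<and> sum_mset (pmono lam) < sum_mset (pmono mu)}"
  have "(\<Sum>lam\<in>?L. scoord (mconst c * f + g) lam * mcoeff (schur lam) (pmono mu))
     = (\<Sum>lam\<in>?L. (c * scoord f lam + scoord g lam) * mcoeff (schur lam) (pmono mu))"
    by (intro sum.cong) (auto simp: less.hyps)
  also have "\<dots> = c * (\<Sum>lam\<in>?L. scoord f lam * mcoeff (schur lam) (pmono mu))
     + (\<Sum>lam\<in>?L. scoord g lam * mcoeff (schur lam) (pmono mu))"
    by (simp add: distrib_right sum.distrib sum_distrib_left mult.assoc)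
  finally have eq: "(\<Sum>lam\<in>?L. scoord (mconst c * f + g) lam * mcoeff (schur lam) (pmono mu)) = \<dots>" .
  show ?case unfolding scoord.simps[of _ mu] eq mcoeff_simps mcoeff_mconst_mult
    by (simp add: algebra_simps)
qed

lemma scoord_eq_0:
  "(\<And>m. size m = psize mu \<Longrightarrow> mcoeff f m = 0) \<Longrightarrow> scoord f mu = 0"
proof (induction "sum_mset (pmono mu)" arbitrary: mu rule: less_induct)
  case less
  have "mcoeff f (pmono mu) = 0" by (rule less.prems) simp
  moreover have "scoord f lam = 0"
    if "psize lam = psize mu" "sum_mset (pmono lam) < sum_mset (pmono mu)" for lam
    using that by (intro less.hyps) (auto intro: less.prems)
  ultimately show ?case by (subst scoord.simps) simp
qed

lemma scoord_0 [simp]: "scoord 0 mu = 0"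
  by (rule scoord_eq_0) simp

lemma scoord_sum: "scoord (\<Sum>x\<in>A. mconst (c x) * f x) mu = (\<Sum>x\<in>A. c x * scoord (f x) mu)"
  by (induction A rule: infinite_finite_induct) (auto simp: scoord_lin)

lemma scoord_schur: "scoord (schur nu :: 'a::comm_ring_1 mseries) mu = (if mu = nu then 1 else 0)"
proof (induction "sum_mset (pmono mu)" arbitrary: mu rule: less_induct)
  case less
  let ?L = "{lam. psize lam = psize mu \<and> sum_mset (pmono lam) < sum_mset (pmono mu)}"
  have fin: "finite ?L" by (rule finite_subset[OF _ finite_psize_eq[of "psize mu"]]) auto
  have "(\<Sum>lam\<in>?L. scoord (schur nu) lam * mcoeff (schur lam) (pmono mu))
     = (\<Sum>lam\<in>?L. (if lam = nu then 1 else 0) * mcoeff (schur lam :: 'a mseries) (pmono mu))"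
    by (intro sum.cong) (auto simp: less.hyps)
  also have "\<dots> = (\<Sum>lam\<in>?L. if lam = nu then mcoeff (schur lam) (pmono mu) else 0)"
    by (intro sum.cong) auto
  also have "\<dots> = (if nu \<in> ?L then mcoeff (schur nu) (pmono mu) else 0)"
    using fin by (simp add: sum.delta)
  finally have eq: "scoord (schur nu :: 'a mseries) mu
    = mcoeff (schur nu) (pmono mu) - (if nu \<in> ?L then mcoeff (schur nu) (pmono mu) else 0)"
    by (simp add: scoord.simps[of _ mu])
  show ?case
  proof (cases "mu = nu")
    case False
    have "mcoeff (schur nu :: 'a mseries) (pmono mu) = 0" if "nu \<notin> ?L"
    proof (rule ccontr)
      assume nz: "mcoeff (schur nu :: 'a mseries) (pmono mu) \<noteq> 0"
      from mcoeff_schur_pmono_le[OF nz] mcoeff_schur_size[OF nz] that False show False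
        by (auto simp: pmono_inject)
    qed
    with False show ?thesis unfolding eq by auto
  next
    case True
    then show ?thesis unfolding eq by simp
  qed
qed


section \<open>The Hall inner product\<close>

text \<open>The form with orthonormal Schur functions, which will witness that the choice in
  \<open>hall\<close> succeeds.\<close>

definition schur_form :: "'a::comm_ring_1 mseries \<Rightarrow> 'a mseries \<Rightarrow> 'a" where
  "schur_form f g = Sum_any (\<lambda>lam. scoord f lam * scoord g lam)"

lemma scoord_deg: "deg_le d f \<Longrightarrow> d < psize mu \<Longrightarrow> scoord f mu = 0"
  by (rule scoord_eq_0) (simp add: deg_leD)

lemma schur_form_eq_sum:
  assumes "deg_le d f \<or> deg_le d g"
  shows "schur_form f g = (\<Sum>lam\<in>{lam. psize lam \<le> d}. scoord f lam * scoord g lam)"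
proof -
  have "psize lam \<le> d" if "scoord f lam * scoord g lam \<noteq> 0" for lam
  proof (rule ccontr)
    assume "\<not> psize lam \<le> d"
    then have "scoord f lam = 0 \<or> scoord g lam = 0"
      using assms scoord_deg[of d f lam] scoord_deg[of d g lam] by auto
    with that show False by auto
  qed
  then show ?thesis unfolding schur_form_def
    by (intro Sum_any.expand_superset finite_psize_le) auto
qed

lemma schur_form_commute: "schur_form f g = schur_form g f"
  by (simp add: schur_form_def mult.commute)

text \<open>A degree bound on one argument makes the supports finite; otherwise
  \<open>Sum_any\<close> need not be additive.\<close>

lemma schur_form_lin_right:
  assumes "u \<in> symfun"
  shows "schur_form u (mconst c * f + g) = c * schur_form u f + schur_form u g"
proof -
  obtain d where d: "deg_le d u" using assms by (auto simp: symfun_iff)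
  show ?thesis
    unfolding schur_form_eq_sum[OF disjI1[OF d]]
    by (simp add: scoord_lin distrib_left sum.distrib sum_distrib_left mult.left_commute)
qed

lemma schur_form_lin_left:
  "u \<in> symfun \<Longrightarrow> schur_form (mconst c * f + g) u = c * schur_form f u + schur_form g u"
  using schur_form_lin_right[of u c f g] by (simp add: schur_form_commute)

text \<open>Indexing by monomials instead of partitions lets a variable be added or renamed without
  sorting the exponents.\<close>

definition hmono :: "nat multiset \<Rightarrow> 'a::comm_ring_1 mseries" where
  "hmono m = (\<Prod>i\<in>set_mset m. hsym (count m i))"

lemma hmono_empty [simp]: "hmono {#} = 1"
  by (simp add: hmono_def)

lemma hmono_add_replicate:
  assumes "r \<notin># m"
  shows "hmono (m + replicate_mset c r) = hsym c * (hmono m :: 'a::comm_ring_1 mseries)"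
proof (cases "c = 0")
  case False
  have "(\<Prod>i\<in>set_mset m. hsym (count (m + replicate_mset c r) i))
      = (\<Prod>i\<in>set_mset m. hsym (count m i) :: 'a mseries)"
    using assms by (intro prod.cong) auto
  moreover have "count m r = 0" using assms by (simp add: not_in_iff)
  ultimately show ?thesis using False assms by (simp add: hmono_def insert_absorb Un_commute)
qed (simp add: hsym_0)

lemma count_image_mset_inj: "inj \<sigma> \<Longrightarrow> count (image_mset \<sigma> m) (\<sigma> x) = count m x"
  by (induction m) (auto simp: inj_def)

lemma hmono_image: "inj \<sigma> \<Longrightarrow> hmono (image_mset \<sigma> m) = hmono m"
  by (simp add: hmono_def prod.reindex inj_on_subset[of \<sigma> UNIV] count_image_mset_inj)

lemma hmono_shiftm: "hmono (shiftm c m) = hsym c * hmono m"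
proof -
  have "0 \<notin># image_mset Suc m" by auto
  from hmono_add_replicate[OF this, of c] show ?thesis
    by (simp add: shiftm_def add.commute hmono_image)
qed

lemma hprod_eq_hmono: "hprod lam = hmono (pmono lam)"
proof -
  have "set_mset (pmono lam) = {..<plength lam}"
    using part_neq_0_iff[of lam] by (auto simp: set_mset_def)
  then show ?thesis by (simp add: hprod_def hmono_def)
qed

text \<open>The coefficients are Kostka numbers. One more variable of exponent c is a Pieri step on
  the left and a branching step on the right, both over horizontal strips of size c.\<close>

lemma hmono_expansion:
  "hmono m = (\<Sum>lam\<in>{lam. psize lam = size m}. mconst (mcoeff (schur lam) m) * (schur lam :: 'a::comm_ring_1 mseries))"
proof -
  obtain r where "set_mset m \<subseteq> {..<r}"
    using finite_nat_set_iff_bounded[of "set_mset m"] by blast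
  then show ?thesis
  proof (induction r arbitrary: m)
    case 0
    obtain emp where "{lam. psize lam = 0} = {emp}" "schur emp = (1 :: 'a mseries)"
      by (rule ex_empty_partition)
    with 0 show ?case by simp
  next
    case (Suc r)
    obtain m' c where m: "m = m' + replicate_mset c r" "set_mset m' \<subseteq> {..<r}"
      by (rule split_max_entry[OF Suc.prems])
    define n where "n = size m'"
    define S where "S = (\<lambda>mu. schur mu :: 'a mseries)"
    have fin: "finite {lam. psize lam = n}" "finite {lam. psize lam = n + c}" by simp_all
    have "hmono m = hsym c * (hmono m' :: 'a mseries)"
      unfolding m(1) using m(2) by (intro hmono_add_replicate) auto
    also have "\<dots> = (\<Sum>mu\<in>{mu. psize mu = n}. mconst (mcoeff (S mu) m') * (hsym c * S mu))"
      by (simp add: Suc.IH[OF m(2)] sum_distrib_left mult.left_commute n_def S_def)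
    also have "\<dots> = (\<Sum>mu\<in>{mu. psize mu = n}. \<Sum>lam\<in>{lam \<in> {lam. psize lam = n + c}. hstrip mu lam}.
        mconst (mcoeff (S mu) m') * S lam)"
      by (intro sum.cong refl) (auto simp: S_def hsym_mult_schur sum_distrib_left intro!: sum.cong)
    also have "\<dots> = (\<Sum>lam\<in>{lam. psize lam = n + c}. \<Sum>mu\<in>{mu \<in> {mu. psize mu = n}. hstrip mu lam}.
        mconst (mcoeff (S mu) m') * S lam)"
      by (rule sum.swap_restrict[OF fin])
    also have "\<dots> = (\<Sum>lam\<in>{lam. psize lam = n + c}. mconst (mcoeff (S lam) m) * S lam)"
    proof (rule sum.cong[OF refl])
      fix lam assume lam: "lam \<in> {lam. psize lam = n + c}"
      have "{mu \<in> {mu. psize mu = n}. hstrip mu lam} = {mu. hstrip mu lam \<and> psize mu + c = psize lam}"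
        using lam by auto
      moreover have "(\<Sum>x\<in>A. mconst (g x) * S lam) = mconst (sum g A) * S lam" for A and g :: "nat_partition \<Rightarrow> 'a"
        by (induction A rule: infinite_finite_induct) (auto simp: mconst_ring distrib_right)
      ultimately show "(\<Sum>mu\<in>{mu \<in> {mu. psize mu = n}. hstrip mu lam}. mconst (mcoeff (S mu) m') * S lam)
          = mconst (mcoeff (S lam) m) * S lam"
        unfolding m(1) S_def mcoeff_schur_extend[OF m(2)] by simp
    qed
    finally show ?case by (simp add: S_def n_def m(1))
  qed
qed

lemma symfun_hmono: "hmono m \<in> symfun"
  unfolding hmono_expansion by (intro symfun_sum symfun_mult symfun_mconst symfun_schur)

text \<open>Both sides expand into Kostka numbers times Schur coordinates of \<open>g\<close>. Hence
  complete and monomial functions are dual, as \<open>hall_form\<close> demands.\<close>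

lemma schur_form_hmono:
  assumes "g \<in> symfun"
  shows "schur_form (hmono m) g = mcoeff g m"
proof -
  obtain e where e: "deg_le e g" using assms by (auto simp: symfun_iff)
  define d where "d = max e (size m)"
  have d: "deg_le d g" using e by (rule deg_le_mono) (simp add: d_def)
  have size: "mcoeff (schur lam :: 'a mseries) m = 0" if "psize lam \<noteq> size m" for lam
    using that mcoeff_schur_size[of lam m, where 'a = 'a] by fastforce
  have "scoord (hmono m) lam = mcoeff (schur lam :: 'a mseries) m" for lam
  proof -
    have "scoord (hmono m) lam = (\<Sum>nu\<in>{nu. psize nu = size m}. if lam = nu then mcoeff (schur nu :: 'a mseries) m else 0)"
      unfolding hmono_expansion scoord_sum by (intro sum.cong) (auto simp: scoord_schur)
    then show ?thesis by (simp add: sum.delta size)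
  qed
  then have "schur_form (hmono m) g = (\<Sum>lam\<in>{lam. psize lam \<le> d}. scoord g lam * mcoeff (schur lam) m)"
    by (simp add: schur_form_eq_sum[OF disjI2[OF d]] mult.commute)
  also have "\<dots> = mcoeff (\<Sum>lam\<in>{lam. psize lam \<le> d}. mconst (scoord g lam) * schur lam) m"
    by simp
  also have "\<dots> = mcoeff g m" using schur_expansion[OF assms d] by simp
  finally show ?thesis .
qed

section \<open>Monomial functions and the existence of the Hall form\<close>

lemma mcoeff_msym: "mcoeff (msym mu) m = (if \<exists>\<sigma>. bij \<sigma> \<and> (\<forall>i. count m (\<sigma> i) = part mu i) then 1 else 0)"
  by (simp add: msym.rep_eq)

text \<open>Rearranging parts does not change how many exceed a given j, so the conjugates agree,
  and then the partitions.\<close>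

lemma mcoeff_msym_pmono: "mcoeff (msym mu) (pmono lam) = (if lam = mu then 1 else 0)"
proof -
  have "lam = mu" if "bij \<sigma>" and eq: "\<And>i. part lam (\<sigma> i) = part mu i" for \<sigma>
  proof -
    have "{i. j < part lam i} = \<sigma> ` {i. j < part mu i}" for j
      using that(1) by (auto simp: eq[symmetric] image_iff) (metis bij_pointE)
    then have "card {i. j < part lam i} = card {i. j < part mu i}" for j
      using that(1) by (simp add: card_image bij_is_inj inj_on_subset[of \<sigma> UNIV])
    then have "pconj lam = pconj mu" by (intro partition_eqI) (simp add: pconj.rep_eq)
    then show ?thesis by (metis pconj_pconj)
  qed
  moreover have "\<exists>\<sigma>::nat \<Rightarrow> nat. bij \<sigma> \<and> (\<forall>i. part mu (\<sigma> i) = part mu i)"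
    by (intro exI[of _ id]) simp
  ultimately have "(\<exists>\<sigma>. bij \<sigma> \<and> (\<forall>i. part lam (\<sigma> i) = part mu i)) \<longleftrightarrow> lam = mu"
    by blast
  then show ?thesis by (simp add: mcoeff_msym)
qed

lemma symfun_msym: "msym mu \<in> symfun"
proof -
  have "mcoeff (msym mu) (image_mset \<tau> m) = mcoeff (msym mu) m" if \<tau>: "bij \<tau>" for \<tau> m
  proof -
    have count: "count (image_mset \<tau> m) (\<tau> i) = count m i" for i
      using \<tau> by (simp add: count_image_mset_inj bij_is_inj)
    have "(\<exists>\<sigma>. bij \<sigma> \<and> (\<forall>i. count (image_mset \<tau> m) (\<sigma> i) = part mu i))
      \<longleftrightarrow> (\<exists>\<sigma>. bij \<sigma> \<and> (\<forall>i. count m (\<sigma> i) = part mu i))" (is "?A \<longleftrightarrow> ?B")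
    proof
      assume ?A
      then obtain \<sigma> where \<sigma>: "bij \<sigma>" "\<And>i. count (image_mset \<tau> m) (\<sigma> i) = part mu i" by blast
      have "count m ((inv \<tau> \<circ> \<sigma>) i) = part mu i" for i
        using \<sigma>(2)[of i] count[of "inv \<tau> (\<sigma> i)"] \<tau> by (simp add: bij_is_surj surj_f_inv_f)
      moreover have "bij (inv \<tau> \<circ> \<sigma>)" using \<sigma>(1) \<tau> by (intro bij_comp bij_imp_bij_inv)
      ultimately show ?B by blast
    next
      assume ?B
      then obtain \<sigma> where \<sigma>: "bij \<sigma>" "\<And>i. count m (\<sigma> i) = part mu i" by blast
      then have "count (image_mset \<tau> m) ((\<tau> \<circ> \<sigma>) i) = part mu i" for i by (simp add: count)
      moreover have "bij (\<tau> \<circ> \<sigma>)" using \<sigma>(1) \<tau> by (intro bij_comp)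
      ultimately show ?A by blast
    qed
    then show ?thesis by (simp add: mcoeff_msym)
  qed
  moreover have "size m \<le> psize mu" if "mcoeff (msym mu :: 'a mseries) m \<noteq> 0" for m
  proof -
    obtain \<sigma> where "bij \<sigma>" "\<And>i. count m (\<sigma> i) = part mu i"
      using \<open>mcoeff (msym mu) m \<noteq> 0\<close> by (auto simp: mcoeff_msym split: if_splits)
    then have "m = image_mset \<sigma> (pmono mu)"
      by (intro multiset_eqI) (metis bij_pointE bij_is_inj count_image_mset_inj count_pmono)
    then show ?thesis by simp
  qed
  ultimately show ?thesis by (auto simp: symfun_iff symmetric_def deg_le_def)
qed

lemma hall_form_schur_form: "hall_form schur_form"
  unfolding hall_form_def
  by (auto simp: schur_form_lin_left schur_form_lin_right hprod_eq_hmono schur_form_hmono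
      symfun_msym mcoeff_msym_pmono)

lemma hall_form_hall: "hall_form hall"
  unfolding hall_def by (rule someI[of hall_form, OF hall_form_schur_form])

lemma hall_hprod_msym: "hall (hprod lam) (msym mu) = (if lam = mu then 1 else 0)"
  using hall_form_hall unfolding hall_form_def by blast

lemma hall_lin:
  assumes "f \<in> symfun" "g \<in> symfun" "u \<in> symfun"
  shows "hall (mconst c * f + g) u = c * hall f u + hall g u"
    "hall u (mconst c * f + g) = c * hall u f + hall u g"
  using hall_form_hall assms unfolding hall_form_def by blast+

lemma hall_0:
  assumes "u \<in> symfun"
  shows "hall 0 u = 0" "hall u 0 = 0"
  using hall_lin[of 0 0 u "-1"] assms by simp_all

lemma hall_sum_right:
  assumes "u \<in> symfun" "\<And>x. x \<in> A \<Longrightarrow> f x \<in> symfun"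
  shows "hall u (\<Sum>x\<in>A. mconst (c x) * f x) = (\<Sum>x\<in>A. c x * hall u (f x))"
  using assms(2)
  by (induction A rule: infinite_finite_induct)
    (auto simp: hall_0 hall_lin assms(1) symfun_sum symfun_mult)

lemma msym_expansion:
  assumes "g \<in> symfun" "deg_le d g"
  shows "g = (\<Sum>mu\<in>{mu. psize mu \<le> d}. mconst (mcoeff g (pmono mu)) * msym mu)"
proof (rule symmetric_eqI)
  fix lam
  have "(\<Sum>mu\<in>{mu. psize mu \<le> d}. mcoeff g (pmono mu) * mcoeff (msym mu) (pmono lam))
      = (\<Sum>mu\<in>{mu. psize mu \<le> d}. if lam = mu then mcoeff g (pmono mu) else 0)"
    by (intro sum.cong) (auto simp: mcoeff_msym_pmono)
  also have "\<dots> = mcoeff g (pmono lam)"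
    using deg_leD[OF assms(2), of "pmono lam"] by (simp add: sum.delta finite_psize_le)
  finally show "mcoeff g (pmono lam) =
      mcoeff (\<Sum>mu\<in>{mu. psize mu \<le> d}. mconst (mcoeff g (pmono mu)) * msym mu) (pmono lam)"
    by simp
qed (auto intro!: assms symfun_sum symfun_mult symfun_msym)

text \<open>The axioms speak of partitions only: \<open>m\<close> is sorted into a partition and
  \<open>g\<close> expanded in monomial functions.\<close>

lemma hall_hmono:
  assumes "g \<in> symfun"
  shows "hall (hmono m) g = mcoeff g m"
proof -
  obtain d where d: "deg_le d g" using assms by (auto simp: symfun_iff)
  obtain \<sigma> lam where \<sigma>: "bij \<sigma>" "image_mset \<sigma> m = pmono lam" by (rule ex_permute_pmono)
  have eq: "hmono m = hprod lam" using \<sigma> by (metis hmono_image bij_is_inj hprod_eq_hmono)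
  have "hall (hmono m) g = (\<Sum>mu\<in>{mu. psize mu \<le> d}. mcoeff g (pmono mu) * hall (hmono m) (msym mu))"
    by (subst msym_expansion[OF assms d]) (rule hall_sum_right[OF symfun_hmono symfun_msym])
  also have "\<dots> = (\<Sum>mu\<in>{mu. psize mu \<le> d}. if lam = mu then mcoeff g (pmono mu) else 0)"
    unfolding eq by (intro sum.cong) (auto simp: hall_hprod_msym)
  also have "\<dots> = mcoeff g (pmono lam)"
    using deg_leD[OF d, of "pmono lam"] by (simp add: sum.delta finite_psize_le)
  also have "\<dots> = mcoeff g m" using symfunD[OF assms \<sigma>(1), of m] \<sigma>(2) by simp
  finally show ?thesis .
qed

lemma hspan_eq_symfun: "hspan = symfun"
proof (intro equalityI subsetI)
  fix f :: "'a mseries" assume f: "f \<in> symfun"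
  then obtain d where "deg_le d f" by (auto simp: symfun_iff)
  from schur_expansion[OF f this] show "f \<in> hspan"
    by (metis (no_types, lifting) hspan_scale hspan_schur hspan_sum)
qed (rule hspan_symfun)

text \<open>In contrast to \<open>hspan\<close> there is no product rule, so a statement linear in a
  function is proved on the functions \<open>hmono m\<close> alone.\<close>

inductive_set hmspan :: "'a::comm_ring_1 mseries set" where
  hmspan_0: "0 \<in> hmspan"
| hmspan_hmono: "hmono m \<in> hmspan"
| hmspan_lin: "f \<in> hmspan \<Longrightarrow> g \<in> hmspan \<Longrightarrow> mconst c * f + g \<in> hmspan"

lemma hmspan_hsym_mult: "f \<in> hmspan \<Longrightarrow> hsym n * f \<in> hmspan"
proof (induction rule: hmspan.induct)
  case (hmspan_hmono m)
  then show ?case using hmspan.hmspan_hmono[of "shiftm n m"] by (simp add: hmono_shiftm)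
next
  case (hmspan_lin f g c)
  then show ?case using hmspan.hmspan_lin[of "hsym n * f" "hsym n * g" c] by (simp add: algebra_simps)
qed (simp add: hmspan_0)

lemma symfun_subset_hmspan: "f \<in> symfun \<Longrightarrow> f \<in> hmspan"
  unfolding hspan_eq_symfun[symmetric]
proof (induction rule: hspan.induct)
  case hspan_1
  then show ?case using hmspan_hmono[of "{#}"] by simp
next
  case (hspan_hz_mult f n)
  then show ?case by (cases "n < 0") (simp_all add: hz_def hmspan_0 hmspan_hsym_mult)
qed (auto intro: hmspan.intros)

lemma hmspan_symfun: "f \<in> hmspan \<Longrightarrow> f \<in> symfun"
  by (induction rule: hmspan.induct) (auto intro: symfun_add symfun_mult symfun_hmono symfun_mconst)

section \<open>Multiplication by h_n and \<open>hperp n\<close> are adjoint\<close>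

lemma hall_eq_schur_form:
  assumes "f \<in> symfun" "g \<in> symfun"
  shows "hall f g = schur_form f g"
  using symfun_subset_hmspan[OF assms(1)]
proof (induction rule: hmspan.induct)
  case hmspan_0
  then show ?case using assms(2) by (simp add: hall_0 schur_form_def)
qed (simp_all add: hall_hmono schur_form_hmono assms(2) hall_lin schur_form_lin_left hmspan_symfun)

text \<open>On \<open>hmono m\<close> the factor h_k adds a variable x_0 of exponent k, and
  \<open>hperp k\<close> reads off just that exponent.\<close>

lemma hall_hsym_mult:
  assumes "f \<in> symfun" "v \<in> symfun"
  shows "hall (hsym k * f) v = hall f (hperp k v)"
  using symfun_subset_hmspan[OF assms(1)]
proof (induction rule: hmspan.induct)
  case (hmspan_hmono m)
  then show ?case using assms(2) by (simp add: hall_hmono symfun_hperp flip: hmono_shiftm)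
next
  case (hmspan_lin f g c)
  have "hsym k * (mconst c * f + g) = mconst c * (hsym k * f) + hsym k * g"
    by (simp add: algebra_simps)
  with hmspan_lin assms(2) show ?case
    by (simp add: hall_lin symfun_hperp symfun_mult hmspan_symfun)
qed (simp add: hall_0 symfun_hperp assms(2))

lemma hall_add:
  assumes "f \<in> symfun" "g \<in> symfun" "u \<in> symfun"
  shows "hall (f + g) u = hall f u + hall g u" "hall u (f + g) = hall u f + hall u g"
  using hall_lin[OF assms, of 1] by simp_all

lemma hall_sum:
  assumes "u \<in> symfun" "\<And>x. x \<in> A \<Longrightarrow> f x \<in> symfun"
  shows "hall (\<Sum>x\<in>A. f x) u = (\<Sum>x\<in>A. hall (f x) u)" "hall u (\<Sum>x\<in>A. f x) = (\<Sum>x\<in>A. hall u (f x))"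
  using assms(2)
  by (induction A rule: infinite_finite_induct; simp add: hall_0 hall_add assms(1) symfun_sum)+

lemma hall_hz_mult:
  "f \<in> symfun \<Longrightarrow> v \<in> symfun \<Longrightarrow> hall (hz z * f) v = (if z < 0 then 0 else hall f (hperp (nat z) v))"
  by (simp add: hz_def hall_0 hall_hsym_mult)

text \<open>For h_k f in place of f, both sides become the sum over i \<le> min(n,k) of
  \<open>hall f (hsym (n - i) * hperp (k - i) v)\<close>, by the product rules for
  \<open>hperp n\<close> on the left and \<open>hperp k\<close> on the right.\<close>

lemma hall_hperp:
  assumes "f \<in> symfun" "v \<in> symfun"
  shows "hall (hperp n f) v = hall f (hsym n * v)"
  using assms unfolding hspan_eq_symfun[symmetric, where 'a = 'a]
proof (induction arbitrary: n v rule: hspan.induct)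
  case hspan_0
  then show ?case by (simp add: hall_0 symfun_mult hspan_symfun)
next
  case hspan_1
  have "hall 1 g = mcoeff g {#}" if "g \<in> symfun" for g :: "'a mseries"
    using hall_hmono[OF that, of "{#}"] by simp
  then show ?case using hspan_1 by (simp add: hall_0 symfun_mult hspan_symfun)
next
  case (hspan_hz_mult f z)
  have f: "f \<in> symfun" and v: "v \<in> symfun" using hspan_hz_mult by (simp_all add: hspan_symfun)
  show ?case
  proof (cases "z < 0")
    case True
    then show ?thesis using v by (simp add: hz_neg hall_0 symfun_mult)
  next
    case False
    define k where "k = nat z"
    have z: "z = int k" using False by (simp add: k_def)
    have "hall (hperp n (hz z * f)) v
       = (\<Sum>i\<le>n. if k < i then 0 else hall (hperp (n - i) f) (hperp (k - i) v))"
      unfolding hperp_hz_mult using f v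
      by (subst hall_sum)
        (auto simp: z hall_hz_mult symfun_hperp nat_diff_distrib intro!: symfun_mult sum.cong)
    also have "\<dots> = (\<Sum>i\<in>{i. i \<le> n \<and> i \<le> k}. hall f (hsym (n - i) * hperp (k - i) v))"
      using v by (intro sum.mono_neutral_cong_right)
        (auto simp: hspan_hz_mult.IH hspan_eq_symfun symfun_hperp)
    \<comment> \<open>The terms added for i > n have complete functions of negative index.\<close>
    also have "\<dots> = (\<Sum>i\<le>k. hall f (hz (int n - int i) * hperp (k - i) v))"
    proof (rule sum.mono_neutral_cong_left)
      show "\<forall>i\<in>{..k} - {i. i \<le> n \<and> i \<le> k}. hall f (hz (int n - int i) * hperp (k - i) v) = 0"
      proof
        fix i assume "i \<in> {..k} - {i. i \<le> n \<and> i \<le> k}"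
        then have "int n - int i < 0" by auto
        then show "hall f (hz (int n - int i) * hperp (k - i) v) = 0"
          using f by (simp add: hz_neg hall_0)
      qed
      show "hall f (hsym (n - i) * hperp (k - i) v) = hall f (hz (int n - int i) * hperp (k - i) v)"
        if "i \<in> {i. i \<le> n \<and> i \<le> k}" for i
        using that by (simp flip: hz_of_nat add: of_nat_diff)
    qed auto
    also have "\<dots> = hall f (hperp k (hsym n * v))"
      using f v hperp_hz_mult[of k "int n" v]
      by (simp add: hall_sum symfun_mult symfun_hperp)
    also have "\<dots> = hall (hz z * f) (hsym n * v)"
      using f v by (simp add: z hall_hsym_mult symfun_mult)
    finally show ?thesis .
  qed
next
  case (hspan_lin f g c)
  then show ?case by (simp add: hall_lin symfun_hperp hspan_symfun symfun_mult)
qed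


section \<open>The adjoint of multiplication\<close>

lemma hall_schur: "u \<in> symfun \<Longrightarrow> hall u (schur lam) = scoord u lam"
proof -
  assume u: "u \<in> symfun"
  have deg: "deg_le (psize lam) (schur lam :: 'a mseries)"
    using mcoeff_schur_size[of lam, where 'a = 'a] by (fastforce simp: deg_le_def)
  have "hall u (schur lam) = (\<Sum>mu\<in>{mu. psize mu \<le> psize lam}. if mu = lam then scoord u mu else 0)"
    unfolding hall_eq_schur_form[OF u symfun_schur] schur_form_eq_sum[OF disjI2[OF deg]]
    by (intro sum.cong) (auto simp: scoord_schur)
  then show ?thesis by (simp add: sum.delta finite_psize_le)
qed

text \<open>Pairing with Schur functions yields all Schur coordinates.\<close>

lemma hall_nondegenerate:
  assumes "u \<in> symfun" "u' \<in> symfun" "\<And>v. v \<in> symfun \<Longrightarrow> hall u v = hall u' v"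
  shows "u = u'"
proof -
  obtain d d' where "deg_le d u" "deg_le d' u'" using assms by (auto simp: symfun_iff)
  then have d: "deg_le (max d d') u" "deg_le (max d d') u'"
    by (auto intro: deg_le_mono[OF _ max.cobounded1] deg_le_mono[OF _ max.cobounded2])
  have "scoord u lam = scoord u' lam" for lam
    using assms hall_schur[of u lam] hall_schur[of u' lam] symfun_schur by metis
  then show ?thesis
    using schur_expansion[OF assms(1) d(1)] schur_expansion[OF assms(2) d(2)] by simp
qed

lemma perp_eqI:
  assumes "u \<in> symfun" "\<And>v. v \<in> symfun \<Longrightarrow> hall u v = hall f (g * v)"
  shows "perp g f = u"
  unfolding perp_def
proof (rule the_equality)
  show "u' = u" if "u' \<in> symfun \<and> (\<forall>v\<in>symfun. hall u' v = hall f (g * v))" for u'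
    using that assms by (intro hall_nondegenerate) auto
qed (use assms in blast)

text \<open>The adjoint is built along the generators of \<open>g\<close>: for h_n g it is the
  adjoint for g applied after \<open>hperp n\<close>. Together with nondegeneracy this makes the
  \<open>THE\<close> in \<open>perp\<close> denote.\<close>

lemma ex_perp:
  fixes f g :: "'a::comm_ring_1 mseries"
  assumes "g \<in> symfun" "f \<in> symfun"
  shows "\<exists>u\<in>symfun. \<forall>v\<in>symfun. hall u v = hall f (g * v)"
  using assms unfolding hspan_eq_symfun[symmetric, where 'a = 'a]
proof (induction arbitrary: f rule: hspan.induct)
  case hspan_0
  then show ?case by (intro bexI[of _ 0]) (auto simp: hall_0 hspan_symfun)
next
  case hspan_1
  then show ?case by auto
next
  case (hspan_hz_mult g n)
  show ?case
  proof (cases "n < 0")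
    case True
    with hspan_hz_mult.prems show ?thesis
      by (intro bexI[of _ 0]) (auto simp: hall_0 hspan_symfun hz_neg)
  next
    case False
    then have hz: "hz n = (hsym (nat n) :: 'a mseries)" by (simp add: hz_def)
    from hspan_hz_mult.IH[OF hspan_hperp[OF hspan_hz_mult.prems]] obtain u where
      u: "u \<in> hspan" "\<And>v. v \<in> hspan \<Longrightarrow> hall u v = hall (hperp (nat n) f) (g * v)" by blast
    show ?thesis
    proof (intro bexI[of _ u] ballI u(1))
      fix v assume "v \<in> (hspan :: 'a mseries set)"
      with hspan_hz_mult.hyps hspan_hz_mult.prems show "hall u v = hall f (hz n * g * v)"
        by (simp add: u(2) hall_hperp hspan_symfun symfun_mult hz mult.assoc)
    qed
  qed
next
  case (hspan_lin g g' c)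
  obtain u where u: "u \<in> hspan" "\<And>v. v \<in> hspan \<Longrightarrow> hall u v = hall f (g * v)"
    using hspan_lin.IH(1)[OF hspan_lin.prems] by blast
  obtain u' where u': "u' \<in> hspan" "\<And>v. v \<in> hspan \<Longrightarrow> hall u' v = hall f (g' * v)"
    using hspan_lin.IH(2)[OF hspan_lin.prems] by blast
  show ?case
  proof (intro bexI[of _ "mconst c * u + u'"] ballI hspan.hspan_lin u(1) u'(1))
    fix v assume "v \<in> (hspan :: 'a mseries set)"
    with hspan_lin.hyps hspan_lin.prems u(1) u'(1)
    show "hall (mconst c * u + u') v = hall f ((mconst c * g + g') * v)"
      by (simp add: u(2) u'(2) hall_lin hspan_symfun symfun_mult distrib_right mult.assoc)
  qed
qed

lemma
  assumes "g \<in> symfun" "f \<in> symfun"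
  shows symfun_perp: "perp g f \<in> symfun"
    and hall_perp: "v \<in> symfun \<Longrightarrow> hall (perp g f) v = hall f (g * v)"
proof -
  obtain u where u: "u \<in> symfun" "\<And>v. v \<in> symfun \<Longrightarrow> hall u v = hall f (g * v)"
    using ex_perp[OF assms] by blast
  have "perp g f = u" by (rule perp_eqI[OF u])
  with u show "perp g f \<in> symfun" "v \<in> symfun \<Longrightarrow> hall (perp g f) v = hall f (g * v)" by auto
qed

lemma perp_1: "f \<in> symfun \<Longrightarrow> perp 1 f = f"
  by (rule perp_eqI) auto

lemma perp_lin:
  "g \<in> symfun \<Longrightarrow> g' \<in> symfun \<Longrightarrow> f \<in> symfun \<Longrightarrow>
    perp (mconst c * g + g') f = mconst c * perp g f + perp g' f"
  by (rule perp_eqI)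
    (auto simp: symfun_perp hall_lin hall_perp symfun_mult distrib_right mult.assoc intro: symfun_add)

lemma perp_lin_right:
  "g \<in> symfun \<Longrightarrow> f \<in> symfun \<Longrightarrow> f' \<in> symfun \<Longrightarrow>
    perp g (mconst c * f + f') = mconst c * perp g f + perp g f'"
  by (rule perp_eqI)
    (auto simp: symfun_perp hall_lin hall_perp symfun_mult intro: symfun_add)

lemma perp_0_left: "f \<in> symfun \<Longrightarrow> perp 0 f = 0"
  by (rule perp_eqI) (auto simp: hall_0)

lemma perp_0_right: "g \<in> symfun \<Longrightarrow> perp g 0 = 0"
  by (rule perp_eqI) (auto simp: hall_0 symfun_mult)

lemma perp_uminus_right: "g \<in> symfun \<Longrightarrow> f \<in> symfun \<Longrightarrow> perp g (- f) = - perp g f"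
  using perp_lin_right[of g f 0 "-1"] by (simp add: mconst_ring perp_0_right)

lemma perp_sum_left:
  "f \<in> symfun \<Longrightarrow> (\<And>x. x \<in> A \<Longrightarrow> g x \<in> symfun) \<Longrightarrow>
    perp (\<Sum>x\<in>A. mconst (c x) * g x) f = (\<Sum>x\<in>A. mconst (c x) * perp (g x) f)"
  by (induction A rule: infinite_finite_induct)
    (auto simp: perp_0_left perp_lin symfun_sum symfun_mult)

lemma perp_sum_right:
  "g \<in> symfun \<Longrightarrow> (\<And>x. x \<in> A \<Longrightarrow> f x \<in> symfun) \<Longrightarrow>
    perp g (\<Sum>x\<in>A. f x) = (\<Sum>x\<in>A. perp g (f x))"
  using perp_lin_right[of g _ _ 1]
  by (induction A rule: infinite_finite_induct) (auto simp: perp_0_right symfun_sum)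

lemma perp_hsym_mult:
  "g \<in> symfun \<Longrightarrow> f \<in> symfun \<Longrightarrow> perp (hsym n * g) f = perp g (hperp n f)"
  by (rule perp_eqI)
    (auto simp: symfun_perp symfun_hperp hall_perp hall_hperp symfun_mult mult.assoc)

lemma perp_hperp:
  "g \<in> symfun \<Longrightarrow> f \<in> symfun \<Longrightarrow> perp g (hperp n f) = hperp n (perp g f)"
  by (rule perp_eqI)
    (auto simp: symfun_perp symfun_hperp hall_perp hall_hperp symfun_mult mult.left_commute)

lemma perp_eperp:
  "f \<in> symfun \<Longrightarrow> g \<in> symfun \<Longrightarrow> perp g (eperp n f) = eperp n (perp g f)"
proof (induction n f rule: eperp.induct)
  case (2 n f)
  then show ?case
    by (simp add: eperp_Suc perp_uminus_right perp_sum_right symfun_sum symfun_eperp symfun_hperp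
        perp_hperp)
qed simp

text \<open>All of \<open>g * v\<close> lies in degrees above d, where the Schur coordinates of
  \<open>f\<close> vanish.\<close>

lemma perp_eq_0:
  assumes "g \<in> symfun" "f \<in> symfun" "deg_le d f" "\<And>m. size m \<le> d \<Longrightarrow> mcoeff g m = 0"
  shows "perp g f = 0"
proof (rule perp_eqI)
  fix v assume v: "v \<in> (symfun :: 'a mseries set)"
  have "scoord (g * v) lam = 0" if "psize lam \<le> d" for lam
  proof (rule scoord_eq_0)
    fix m :: "nat multiset" assume m: "size m = psize lam"
    have "mcoeff g p * mcoeff v q = 0" if "p + q = m" for p q
    proof -
      have "size p \<le> d" using that m \<open>psize lam \<le> d\<close> by auto
      then show ?thesis using assms(4) by simp
    qed
    then show "mcoeff (g * v) m = 0" by (auto simp: mcoeff_times intro!: sum.neutral)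
  qed
  then have "hall f (g * v) = 0"
    using assms v by (simp add: hall_eq_schur_form symfun_mult schur_form_eq_sum[OF disjI1[OF assms(3)]])
  then show "hall 0 v = hall f (g * v)" using v by (simp add: hall_0)
qed simp

lemma perp_schur_eq_0: "f \<in> symfun \<Longrightarrow> deg_le d f \<Longrightarrow> d < psize lam \<Longrightarrow> perp (schur lam) f = 0"
proof -
  assume f: "f \<in> symfun" "deg_le d f" and less: "d < psize lam"
  have "mcoeff (schur lam :: 'a mseries) m = 0" if "size m \<le> d" for m
  proof (rule ccontr)
    assume "mcoeff (schur lam :: 'a mseries) m \<noteq> 0"
    from mcoeff_schur_size[OF this] that less show False by simp
  qed
  then show ?thesis by (rule perp_eq_0[OF symfun_schur f])
qed


section \<open>Elementary functions\<close>

text \<open>At a monomial of degree n the coefficient is a signed count of its squarefree divisors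
  p; moving a fixed variable x into or out of p reverses the sign.\<close>

lemma esym_hsym_convolution:
  assumes "0 < n"
  shows "(\<Sum>i\<le>n. (- 1) ^ i * esym i * hsym (n - i)) = (0 :: 'a::comm_ring_1 mseries)"
proof (rule mseries_eqI)
  fix m
  define sqfree where "sqfree = (\<lambda>p :: nat multiset. \<forall>i. count p i \<le> 1)"
  have "mcoeff (\<Sum>i\<le>n. (- 1) ^ i * esym i * (hsym (n - i) :: 'a mseries)) m
     = (\<Sum>i\<le>n. \<Sum>(p, q)\<in>msplits m. (- 1) ^ i * ((if size p = i \<and> sqfree p then 1 else 0) *
          (if size q = n - i then 1 else 0)))"
    unfolding mcoeff_sum mult.assoc neg_one_power_mult mcoeff_mconst_mult unfolding mcoeff_times
    by (simp add: sqfree_def sum_distrib_left case_prod_unfold)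
  also have "\<dots> = (\<Sum>(p, q)\<in>msplits m. \<Sum>i\<le>n. (- 1) ^ i * ((if size p = i \<and> sqfree p then 1 else 0) *
          (if size q = n - i then 1 else 0)))"
    by (subst sum.swap) (simp add: case_prod_unfold)
  also have "\<dots> = (\<Sum>(p, q)\<in>msplits m. if size m = n \<and> sqfree p then (- 1) ^ size p else 0)"
  proof (intro sum.cong refl, clarify)
    fix p q assume "(p, q) \<in> msplits m"
    then have size: "size m = size p + size q" by auto
    have "(\<Sum>i\<le>n. (- 1) ^ i * ((if size p = i \<and> sqfree p then 1 else 0) * (if size q = n - i then 1 else 0)))
        = (\<Sum>i\<le>n. if size p = i then (if sqfree p \<and> size q = n - i then (- 1) ^ i else 0) else (0 :: 'a))"
      by (intro sum.cong) auto
    also have "\<dots> = (if size m = n \<and> sqfree p then (- 1) ^ size p else 0)"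
      using size by (auto simp: sum.delta)
    finally show "(\<Sum>i\<le>n. (- 1) ^ i * ((if size p = i \<and> sqfree p then 1 else 0) * (if size q = n - i then 1 else 0)))
        = (if size m = n \<and> sqfree p then (- 1) ^ size p else (0 :: 'a))" .
  qed
  also have "\<dots> = 0"
  proof (cases "size m = n")
    case True
    with assms obtain x where x: "x \<in># m" by (metis multiset_nonemptyE size_empty less_irrefl)
    define S where "S = {(p, q) \<in> msplits m. sqfree p}"
    have "(\<Sum>(p, q)\<in>msplits m. if size m = n \<and> sqfree p then (- 1) ^ size p else (0 :: 'a))
        = (\<Sum>(p, q)\<in>S. (- 1) ^ size p)"
      using True unfolding S_def by (intro sum.mono_neutral_cong_right) (auto split: if_splits)
    also have "\<dots> = 0"
    proof -
      define \<tau> where "\<tau> = (\<lambda>(p, q). if x \<in># p then (p - {#x#}, add_mset x q)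
        else (add_mset x p, q - {#x#}))"
      define f :: "nat multiset \<times> nat multiset \<Rightarrow> 'a" where "f = (\<lambda>(p, q). (- 1) ^ size p)"
      have "finite S" unfolding S_def by (rule finite_subset[OF _ finite_msplits[of m]]) auto
      moreover have "\<tau> s \<in> S \<and> \<tau> (\<tau> s) = s \<and> f (\<tau> s) = - f s \<and> \<tau> s \<noteq> s" if "s \<in> S" for s
      proof -
        obtain p q where s: "s = (p, q)" "p + q = m" "sqfree p" using \<open>s \<in> S\<close> by (auto simp: S_def)
        show ?thesis
        proof (cases "x \<in># p")
          case True
          then obtain p' where p: "p = add_mset x p'" by (meson multi_member_split)
          have le: "count p i \<le> 1" for i using s(3) by (simp add: sqfree_def)
          have "x \<notin># p'" using le[of x] by (simp add: p not_in_iff)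
          moreover have "sqfree p'" unfolding sqfree_def
          proof
            fix i show "count p' i \<le> 1" using le[of i] by (simp add: p split: if_splits)
          qed
          ultimately show ?thesis using s by (auto simp: p S_def \<tau>_def f_def)
        next
          case False
          then have "x \<in># q" using x s(2) by auto
          then obtain q' where q: "q = add_mset x q'" by (meson multi_member_split)
          have "sqfree (add_mset x p)" using False s(3) by (auto simp: sqfree_def not_in_iff)
          then show ?thesis using s False by (auto simp: q S_def \<tau>_def f_def)
        qed
      qed
      ultimately have "sum f S = 0" by (intro sum_involution_eq_0[of S \<tau> f]) auto
      then show ?thesis by (simp add: f_def)
    qed
    finally show ?thesis .
  qed (simp add: case_prod_unfold)
  finally show "mcoeff (\<Sum>i\<le>n. (- 1) ^ i * esym i * (hsym (n - i) :: 'a mseries)) m = mcoeff 0 m"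
    by simp
qed

lemma esym_0: "esym 0 = 1"
  by (rule mseries_eqI) auto

lemma symfun_esym: "esym n \<in> symfun"
proof -
  have "mcoeff (esym n) (image_mset \<sigma> m) = mcoeff (esym n) m" if "bij \<sigma>" for \<sigma> m
  proof -
    have "(\<forall>i. count (image_mset \<sigma> m) i \<le> 1) \<longleftrightarrow> (\<forall>i. count m i \<le> 1)"
      using that by (metis bij_is_inj bij_pointE count_image_mset_inj)
    then show ?thesis by simp
  qed
  then have "symmetric (esym n)" unfolding symmetric_def by blast
  moreover have "deg_le n (esym n)" by (simp add: deg_le_def)
  ultimately show ?thesis by (auto simp: symfun_iff)
qed

text \<open>Under \<open>perp\<close> the alternating relation between elementary and complete
  functions becomes the recursion that defines \<open>eperp\<close>.\<close>

lemma perp_esym: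
  assumes "f \<in> symfun"
  shows "(- 1) ^ n * perp (esym n) f = eperp n (f :: 'a::comm_ring_1 mseries)"
  using assms
proof (induction n arbitrary: f rule: less_induct)
  case (less n)
  show ?case
  proof (cases n)
    case 0
    then show ?thesis using less.prems by (simp add: esym_0 perp_1)
  next
    case (Suc n')
    have "0 = perp (\<Sum>i\<le>n. mconst ((- 1) ^ i) * (hsym (n - i) * esym i)) f"
      using esym_hsym_convolution[of n, where 'a = 'a] Suc less.prems
      by (simp add: neg_one_power_mult perp_0_left mult.assoc mult.commute[of "esym _"] del: sum.atMost_Suc)
    also have "\<dots> = (\<Sum>i\<le>n. mconst ((- 1) ^ i) * perp (hsym (n - i) * esym i) f)"
      using less.prems by (intro perp_sum_left) (auto intro: symfun_mult symfun_esym symfun_hsym)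
    also have "\<dots> = (\<Sum>i\<le>n. (- 1) ^ i * perp (esym i) (hperp (n - i) f))"
      using less.prems by (simp add: perp_hsym_mult symfun_esym neg_one_power_mult)
    also have "\<dots> = (\<Sum>i\<le>n'. (- 1) ^ i * perp (esym i) (hperp (n - i) f))
        + (- 1) ^ n * perp (esym n) (hperp 0 f)"
      by (simp add: Suc)
    also have "(\<Sum>i\<le>n'. (- 1) ^ i * perp (esym i) (hperp (n - i) f)) = - eperp n f"
      using less.prems by (simp add: Suc eperp_Suc less.IH symfun_hperp)
    finally show ?thesis using less.prems by (simp add: hperp_0_idx)
  qed
qed

lemma RS_eq_bern: "f \<in> symfun \<Longrightarrow> RS a f = bern (int a) f"
proof -
  assume f: "f \<in> symfun"
  have "(- 1) ^ i * hsym (a + i) * perp (esym i) f = hz (int a + int i) * eperp i f" for i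
    unfolding perp_esym[OF f, symmetric] by (simp add: mult_ac flip: hz_of_nat)
  then show ?thesis by (simp add: RS_def bern_def)
qed

section \<open>Convolution with the antipode\<close>

text \<open>
  \<open>s\<^sub>\<mu> \<mapsto> (-1)\<^sup>|\<^sup>\<mu>\<^sup>| s\<^sub>\<mu>\<^sub>'\<close> is the antipode \<open>S\<close> of the Hopf algebra of symmetric functions, so
  \<open>kerop N T\<close> is the convolution of \<open>T \<circ> S\<close> with the identity (in degrees at most \<open>N\<close>).
\<close>

definition kerop ::
  "nat \<Rightarrow> ('a::comm_ring_1 mseries \<Rightarrow> 'a mseries) \<Rightarrow> 'a mseries \<Rightarrow> 'a mseries" where
  "kerop N T f = (\<Sum>mu\<in>{mu. psize mu \<le> N}.
     mconst ((- 1) ^ psize mu) * (T (schur mu) * perp (schur (pconj mu)) f))"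

definition linear_symfun :: "('a::comm_ring_1 mseries \<Rightarrow> 'a mseries) \<Rightarrow> bool" where
  "linear_symfun T \<longleftrightarrow>
     (\<forall>c. \<forall>f\<in>symfun. \<forall>g\<in>symfun. T (mconst c * f + g) = mconst c * T f + T g)"

lemma linear_symfun_0: "linear_symfun T \<Longrightarrow> T 0 = 0"
proof -
  assume "linear_symfun T"
  then have "T (mconst (-1) * 0 + 0) = mconst (-1) * T 0 + T 0"
    unfolding linear_symfun_def using symfun_0 by blast
  then show ?thesis by (simp add: mconst_ring)
qed

lemma linear_symfun_sum_scaled:
  assumes "linear_symfun T" "\<And>x. x \<in> A \<Longrightarrow> f x \<in> symfun"
  shows "T (\<Sum>x\<in>A. mconst (c x) * f x) = (\<Sum>x\<in>A. mconst (c x) * T (f x))"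
  using assms(2)
proof (induction A rule: infinite_finite_induct)
  case (insert x A)
  then have "(\<Sum>x\<in>A. mconst (c x) * f x) \<in> symfun" "f x \<in> symfun"
    by (auto intro!: symfun_sum symfun_mult)
  then have "T (mconst (c x) * f x + (\<Sum>x\<in>A. mconst (c x) * f x))
      = mconst (c x) * T (f x) + T (\<Sum>x\<in>A. mconst (c x) * f x)"
    using assms(1) unfolding linear_symfun_def by blast
  with insert show ?case by simp
qed (simp_all add: linear_symfun_0 assms(1))

lemma linear_symfun_sum:
  "linear_symfun T \<Longrightarrow> (\<And>x. x \<in> A \<Longrightarrow> f x \<in> symfun) \<Longrightarrow> T (\<Sum>x\<in>A. f x) = (\<Sum>x\<in>A. T (f x))"
  using linear_symfun_sum_scaled[of T A f "\<lambda>_. 1"] by simp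

text \<open>Multiplication by h_i adds horizontal strips to the conjugate of \<open>nu\<close>,
  hence vertical strips to \<open>nu\<close>. Partitions larger than N annihilate f, so the sum
  stays within the truncation.\<close>

lemma perp_schur_pconj_hperp:
  assumes f: "f \<in> symfun" "deg_le N f"
  shows "perp (schur (pconj nu)) (hperp i f)
    = (\<Sum>mu\<in>{mu \<in> {mu. psize mu \<le> N}. vstrip nu mu \<and> psize nu + i = psize mu}. perp (schur (pconj mu)) f)"
proof -
  have "perp (schur (pconj nu)) (hperp i f) = perp (hsym i * schur (pconj nu)) f"
    using f(1) by (simp add: perp_hsym_mult symfun_schur)
  also have "\<dots> = perp (\<Sum>kappa\<in>{kappa. hstrip (pconj nu) kappa \<and> psize kappa = psize (pconj nu) + i}.
      mconst 1 * schur kappa) f"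
    by (simp add: hsym_mult_schur)
  also have "\<dots> = (\<Sum>kappa\<in>{kappa. hstrip (pconj nu) kappa \<and> psize kappa = psize (pconj nu) + i}.
      perp (schur kappa) f)"
    using f(1) by (subst perp_sum_left) (auto simp: symfun_schur)
  also have "\<dots> = (\<Sum>mu\<in>{mu. vstrip nu mu \<and> psize nu + i = psize mu}. perp (schur (pconj mu)) f)"
    by (rule sum.reindex_bij_witness[where i = pconj and j = pconj])
      (auto simp flip: hstrip_pconj_iff)
  also have "\<dots> = (\<Sum>mu\<in>{mu \<in> {mu. psize mu \<le> N}. vstrip nu mu \<and> psize nu + i = psize mu}.
      perp (schur (pconj mu)) f)"
  proof (rule sum.mono_neutral_right)
    show "finite {mu. vstrip nu mu \<and> psize nu + i = psize mu}"
      by (rule finite_subset[OF _ finite_psize_eq[of "psize nu + i"]]) auto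
    show "\<forall>mu\<in>{mu. vstrip nu mu \<and> psize nu + i = psize mu}
        - {mu \<in> {mu. psize mu \<le> N}. vstrip nu mu \<and> psize nu + i = psize mu}.
        perp (schur (pconj mu)) f = 0"
      by (auto intro!: perp_schur_eq_0[OF f])
  qed auto
  finally show ?thesis .
qed

text \<open>Both sides sum over pairs of partitions differing by a vertical strip of size i:
  e_i^perp removes it from \<open>mu\<close>, h_i adds it to \<open>nu\<close>. In other words, the
  antipode exchanges e_i and h_i up to sign.\<close>

lemma kerop_eperp:
  assumes f: "f \<in> symfun" "deg_le N f" and T: "linear_symfun T"
  shows "kerop N (\<lambda>x. T (eperp i x)) f = kerop N T (hperp i f)"
proof -
  define P where "P = {mu. psize mu \<le> N}"
  define R where "R = (\<lambda>nu mu. vstrip nu mu \<and> psize nu + i = psize mu)"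
  have fin: "finite P" by (simp add: P_def finite_psize_le)
  have strip: "mconst ((- 1) ^ psize mu) * (T (eperp i (schur mu)) * u)
      = (\<Sum>nu\<in>{nu \<in> P. R nu mu}. mconst ((- 1) ^ psize nu) * (T (schur nu) * u))"
    if "mu \<in> P" for mu u
  proof -
    have set: "{nu \<in> P. R nu mu} = {nu. vstrip nu mu \<and> psize nu + i = psize mu}"
      using that by (auto simp: P_def R_def)
    have "T (eperp i (schur mu)) = T (\<Sum>nu\<in>{nu \<in> P. R nu mu}. mconst ((- 1) ^ i) * schur nu)"
      by (simp add: eperp_schur set neg_one_power_mult sum_distrib_left)
    also have "\<dots> = (\<Sum>nu\<in>{nu \<in> P. R nu mu}. mconst ((- 1) ^ i) * T (schur nu))"
      by (rule linear_symfun_sum_scaled[OF T]) (rule symfun_schur)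
    finally have "mconst ((- 1) ^ psize mu) * (T (eperp i (schur mu)) * u)
      = (\<Sum>nu\<in>{nu \<in> P. R nu mu}. mconst ((- 1) ^ psize mu * (- 1) ^ i) * (T (schur nu) * u))"
      by (simp add: sum_distrib_left sum_distrib_right mconst_ring mult.assoc)
    also have "\<dots> = (\<Sum>nu\<in>{nu \<in> P. R nu mu}. mconst ((- 1) ^ psize nu) * (T (schur nu) * u))"
    proof (rule sum.cong[OF refl])
      fix nu assume "nu \<in> {nu \<in> P. R nu mu}"
      then have "psize mu = psize nu + i" by (simp add: R_def)
      \<comment> \<open>The sign in \<open>eperp\<close> compensates for the i removed
        cells.\<close>
      then have "(- 1) ^ psize mu * (- 1) ^ i = (- 1 :: 'a) ^ psize nu"
        by (simp add: power_add mult.assoc flip: power_mult_distrib)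
      then show "mconst ((- 1) ^ psize mu * (- 1) ^ i) * (T (schur nu) * u)
        = mconst ((- 1) ^ psize nu) * (T (schur nu) * u)" by simp
    qed
    finally show ?thesis .
  qed
  have "kerop N (\<lambda>x. T (eperp i x)) f = (\<Sum>mu\<in>P. \<Sum>nu\<in>{nu \<in> P. R nu mu}.
      mconst ((- 1) ^ psize nu) * (T (schur nu) * perp (schur (pconj mu)) f))"
    unfolding kerop_def P_def[symmetric] by (intro sum.cong refl strip)
  also have "\<dots> = (\<Sum>nu\<in>P. \<Sum>mu\<in>{mu \<in> P. R nu mu}.
      mconst ((- 1) ^ psize nu) * (T (schur nu) * perp (schur (pconj mu)) f))"
    by (rule sum.swap_restrict[OF fin fin])
  also have "\<dots> = kerop N T (hperp i f)"
    unfolding kerop_def perp_schur_pconj_hperp[OF f] P_def R_def by (simp add: sum_distrib_left)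
  finally show ?thesis .
qed

lemma kerop_sum_right:
  "(\<And>x. x \<in> A \<Longrightarrow> f x \<in> symfun) \<Longrightarrow> kerop N T (\<Sum>x\<in>A. f x) = (\<Sum>x\<in>A. kerop N T (f x))"
  unfolding kerop_def
  by (subst sum.swap) (simp add: perp_sum_right symfun_schur sum_distrib_left)

lemma kerop_0: "kerop N T 0 = 0"
  by (simp add: kerop_def perp_0_right symfun_schur)

lemma linear_symfun_ident: "linear_symfun (\<lambda>x. x)"
  by (simp add: linear_symfun_def)

text \<open>\<open>S * id\<close> is the counit: it is killed by all \<open>e\<^sub>n\<^sup>\<bottom>\<close> with \<open>n > 0\<close>, hence it is constant.\<close>

lemma kerop_ident:
  assumes f: "f \<in> symfun" "deg_le N f"
  shows "kerop N (\<lambda>x. x) f = mconst (mcoeff f {#})"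
proof -
  define c where "c = kerop N (\<lambda>x. x) f"
  have c: "c \<in> symfun"
    unfolding c_def kerop_def using f(1)
    by (intro symfun_sum symfun_mult symfun_mconst symfun_schur symfun_perp)
  have eperp: "eperp n c = 0" if "0 < n" for n
  proof -
    have "eperp n c = (\<Sum>mu\<in>{mu. psize mu \<le> N}. \<Sum>j\<le>n. mconst ((- 1) ^ psize mu) *
        (eperp j (schur mu) * perp (schur (pconj mu)) (eperp (n - j) f)))"
      unfolding c_def kerop_def using f(1)
      by (simp add: eperp_mult hspan_schur symfun_perp symfun_schur perp_eperp sum_distrib_left)
    also have "\<dots> = (\<Sum>j\<le>n. kerop N (eperp j) (eperp (n - j) f))"
      by (subst sum.swap) (simp add: kerop_def)
    also have "\<dots> = (\<Sum>j\<le>n. kerop N (\<lambda>x. x) (hperp j (eperp (n - j) f)))"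
      using f
      by (intro sum.cong refl kerop_eperp[OF _ _ linear_symfun_ident] symfun_eperp deg_le_eperp)
    also have "\<dots> = kerop N (\<lambda>x. x) (\<Sum>j\<le>n. hperp j (eperp (n - j) f))"
      using f(1) by (simp add: kerop_sum_right symfun_hperp symfun_eperp)
    also have "\<dots> = 0"
      using f(1) that by (simp add: hperp_eperp_convolution kerop_0)
    finally show ?thesis .
  qed
  \<comment> \<open>In the inverse relation only the term with \<open>eperp 0\<close> survives, so
    the h_n^perp kill c as well.\<close>
  have "hperp n c = 0" if "0 < n" for n
  proof -
    have "(\<Sum>i\<le>n. hperp i (eperp (n - i) c)) = (\<Sum>i\<in>{n}. hperp i (eperp (n - i) c))"
      by (rule sum.mono_neutral_right) (auto simp: eperp)
    then show ?thesis using hperp_eperp_convolution[OF c, of n] that by simp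
  qed
  then have "c = mconst (mcoeff c {#})" by (rule hperp_0_unique[OF c])
  moreover have "mcoeff c {#} = mcoeff f {#}"
  proof -
    obtain emp where emp: "{lam. psize lam = 0} = {emp}" "schur emp = (1 :: 'a mseries)"
      by (rule ex_empty_partition)
    have "emp \<in> {lam. psize lam = 0}" unfolding emp(1) by (rule singletonI)
    then have psize: "psize emp = 0" by (rule CollectD)
    then have "pconj emp \<in> {lam. psize lam = 0}" by simp
    then have conj: "pconj emp = emp" unfolding emp(1) by (rule singletonD)
    have "mcoeff c {#} = (\<Sum>mu\<in>{mu. psize mu \<le> N}.
        (- 1) ^ psize mu * (mcoeff (schur mu) {#} * mcoeff (perp (schur (pconj mu)) f) {#}))"
      by (simp add: c_def kerop_def)
    also have "\<dots> = (\<Sum>mu\<in>{emp}.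
        (- 1) ^ psize mu * (mcoeff (schur mu) {#} * mcoeff (perp (schur (pconj mu)) f) {#}))"
      unfolding emp(1)[symmetric]
      by (rule sum.mono_neutral_right) (auto simp: finite_psize_le mcoeff_schur_empty)
    also have "\<dots> = mcoeff f {#}" using f(1) by (simp add: conj psize emp(2) perp_1)
    finally show ?thesis .
  qed
  ultimately show ?thesis by (simp add: c_def)
qed

lemma bern_funpow_lin:
  assumes "f \<in> symfun" "g \<in> symfun"
  shows "(bern a ^^ k) (mconst c * f + g) = mconst c * (bern a ^^ k) f + (bern a ^^ k) g
    \<and> (bern a ^^ k) f \<in> symfun \<and> (bern a ^^ k) g \<in> symfun"
  by (induction k) (use assms in \<open>auto simp: bern_add bern_scale symfun_mult symfun_bern\<close>)

lemma linear_bern_funpow_mult: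
  assumes "g \<in> symfun"
  shows "linear_symfun (\<lambda>x. (bern a ^^ k) (g * x))"
  unfolding linear_symfun_def
proof (intro allI ballI)
  fix c and x y :: "'a mseries" assume "x \<in> symfun" "y \<in> symfun"
  moreover have "g * (mconst c * x + y) = mconst c * (g * x) + g * y" by (simp add: algebra_simps)
  ultimately show "(bern a ^^ k) (g * (mconst c * x + y)) = mconst c * (bern a ^^ k) (g * x) + (bern a ^^ k) (g * y)"
    using bern_funpow_lin[of "g * x" "g * y" k a c] assms by (simp add: symfun_mult)
qed


section \<open>The column operator\<close>

text \<open>
  \<open>colop N a k 1 f\<close> is the sum over all \<open>\<beta>\<close> with \<open>k\<close> entries (at most \<open>N\<close>) of the coefficient of
  \<open>x\<^sup>\<beta>\<close> in \<open>f\<close> times the (possibly unstraightened) Schur function with index \<open>a\<^sup>k + \<beta>\<close>.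
\<close>

fun colop :: "nat \<Rightarrow> int \<Rightarrow> nat \<Rightarrow> 'a::comm_ring_1 mseries \<Rightarrow> 'a mseries \<Rightarrow> 'a mseries" where
  "colop N a 0 g f = mconst (mcoeff f {#}) * g"
| "colop N a (Suc k) g f = (\<Sum>j\<le>N. bern (a + int j) (colop N a k g (hperp j f)))"

lemma symfun_colop: "g \<in> symfun \<Longrightarrow> colop N a k g f \<in> symfun"
  by (induction k arbitrary: f) (auto intro!: symfun_mult symfun_sum symfun_bern)

lemma colop_0 [simp]: "colop N a k g 0 = 0"
  by (induction k) auto

lemma colop_add: "g \<in> symfun \<Longrightarrow> colop N a k g (f + f') = colop N a k g f + colop N a k g f'"
  by (induction k arbitrary: f f')
    (auto simp: mconst_ring distrib_right bern_add symfun_colop sum.distrib)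

lemma colop_sum: "g \<in> symfun \<Longrightarrow> colop N a k g (\<Sum>x\<in>A. f x) = (\<Sum>x\<in>A. colop N a k g (f x))"
  by (induction A rule: infinite_finite_induct) (auto simp: colop_add)

text \<open>As the \<open>hperp\<close> commute, an entry of \<beta> may be peeled off at the inner
  end, where its operator meets \<open>g\<close>.\<close>

lemma colop_Suc_inner:
  assumes "g \<in> symfun" "f \<in> symfun"
  shows "colop N a (Suc k) g f = (\<Sum>j\<le>N. colop N a k (bern (a + int j) g) (hperp j f))"
  using assms(2)
proof (induction k arbitrary: f)
  case 0
  then show ?case by (simp add: bern_scale assms(1))
next
  case (Suc k)
  have "colop N a (Suc (Suc k)) g f
      = (\<Sum>i\<le>N. bern (a + int i) (\<Sum>j\<le>N. colop N a k (bern (a + int j) g) (hperp j (hperp i f))))"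
    using Suc.IH[OF symfun_hperp[OF Suc.prems]] by (simp only: colop.simps(2)[of N a "Suc k"])
  also have "\<dots> = (\<Sum>i\<le>N. \<Sum>j\<le>N. bern (a + int i) (colop N a k (bern (a + int j) g) (hperp i (hperp j f))))"
    using assms(1) hperp_commute[OF Suc.prems]
    by (intro sum.cong refl) (simp add: bern_sum symfun_colop symfun_bern)
  also have "\<dots> = (\<Sum>j\<le>N. colop N a (Suc k) (bern (a + int j) g) (hperp j f))"
    by (subst sum.swap) simp
  finally show ?case .
qed

text \<open>The factor \<open>g\<close> collects the operators applied so far. Each
  \<open>bern a\<close> acts by \<open>bern_mult\<close>: its index grows by j while
  \<open>eperp j\<close> falls on the Schur function, and \<open>kerop_eperp\<close> moves that to f
  as h_j^perp.\<close>

lemma kerop_bern_funpow: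
  assumes "f \<in> symfun" "deg_le N f" "g \<in> hspan"
  shows "kerop N (\<lambda>x. (bern a ^^ k) (g * x)) f = colop N a k g f"
  using assms
proof (induction k arbitrary: f g)
  case 0
  have "kerop N (\<lambda>x. g * x) f = g * kerop N (\<lambda>x. x) f"
    by (simp add: kerop_def sum_distrib_left mult_ac)
  with 0 show ?case by (simp add: kerop_ident mult.commute)
next
  case (Suc k)
  have g: "g \<in> symfun" using Suc.prems(3) by (rule hspan_symfun)
  have "(bern a ^^ Suc k) (g * schur mu)
      = (\<Sum>j\<le>N. (bern a ^^ k) (bern (a + int j) g * eperp j (schur mu)))"
    if "psize mu \<le> N" for mu
  proof -
    have "deg_le N (schur mu :: 'a mseries)"
    proof (rule deg_leI, rule ccontr)
      fix m assume "N < size m" "mcoeff (schur mu :: 'a mseries) m \<noteq> 0"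
      then show False using mcoeff_schur_size[of mu m, where 'a = 'a] that by simp
    qed
    then have "bern a (g * schur mu) = (\<Sum>j\<le>N. bern (a + int j) g * eperp j (schur mu))"
      by (intro bern_mult Suc.prems symfun_schur)
    moreover have "linear_symfun (bern a ^^ k)"
      using linear_bern_funpow_mult[OF symfun_1, of k a] by simp
    ultimately show ?thesis using g
      by (simp only: funpow_Suc_right o_apply)
        (intro linear_symfun_sum, auto intro!: symfun_mult symfun_bern symfun_eperp symfun_schur)
  qed
  then have "kerop N (\<lambda>x. (bern a ^^ Suc k) (g * x)) f
      = (\<Sum>j\<le>N. kerop N (\<lambda>x. (bern a ^^ k) (bern (a + int j) g * eperp j x)) f)"
    unfolding kerop_def
    by (subst sum.swap) (intro sum.cong refl, simp add: sum_distrib_left sum_distrib_right del: funpow.simps)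
  also have "\<dots> = (\<Sum>j\<le>N. kerop N (\<lambda>x. (bern a ^^ k) (bern (a + int j) g * x)) (hperp j f))"
    using g by (intro sum.cong refl kerop_eperp Suc.prems linear_bern_funpow_mult symfun_bern)
  also have "\<dots> = (\<Sum>j\<le>N. colop N a k (bern (a + int j) g) (hperp j f))"
    using Suc.prems deg_le_mono[OF deg_le_hperp[OF Suc.prems(2)]]
    by (intro sum.cong refl Suc.IH symfun_hperp hspan_bern) auto
  also have "\<dots> = colop N a (Suc k) g f"
    using g Suc.prems(1) by (simp only: colop_Suc_inner)
  finally show ?case .
qed

lemma hspan_colop: "g \<in> hspan \<Longrightarrow> colop N a k g f \<in> hspan"
  by (simp add: hspan_eq_symfun symfun_colop)

text \<open>The product rule splits the exponent as l + j with l \<le> n and j \<le> d, so by n + d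
  \<le> N the truncation loses nothing.\<close>

lemma colop_hsym_mult_expand:
  assumes "g \<in> symfun" "deg_le d g" "n + d \<le> N"
  shows "colop N a (Suc k) 1 (hsym n * g)
    = (\<Sum>l\<le>n. \<Sum>j\<le>N. bern (a + int (l + j)) (colop N a k 1 (hz (int n - int l) * hperp j g)))"
proof -
  define \<phi> where "\<phi> = (\<lambda>l j. bern (a + int (l + j)) (colop N a k 1 (hz (int n - int l) * hperp j g)))"
  have hperp_0: "hperp j g = 0" if "N - n < j" for j
    using that assms(3) by (intro hperp_eq_0[OF assms(2)]) simp
  have zero: "\<phi> l j = 0" if "n < l \<or> N - n < j" for l j
    using that
  proof
    assume "n < l"
    then have "hz (int n - int l) = (0 :: 'a mseries)" by (intro hz_neg) simp
    then show ?thesis by (simp add: \<phi>_def)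
  qed (simp add: \<phi>_def hperp_0)
  have "colop N a (Suc k) 1 (hsym n * g) = (\<Sum>i\<le>N. \<Sum>l\<le>i. \<phi> l (i - l))"
    using hperp_hz_mult[of _ "int n" g]
    by (simp add: \<phi>_def colop_sum bern_sum symfun_colop)
  also have "\<dots> = (\<Sum>l\<le>n. \<Sum>j\<le>N - n. \<phi> l j)"
    using sum_triangle_rect[of n "N - n" \<phi>] zero assms(3) by simp
  also have "\<dots> = (\<Sum>l\<le>n. \<Sum>j\<le>N. \<phi> l j)"
    by (intro sum.cong refl sum.mono_neutral_left) (auto simp: zero)
  finally show ?thesis by (simp add: \<phi>_def)
qed

text \<open>
  Multiplication by \<open>h\<^sub>n\<close> amounts to adding \<open>n\<close> to the first entry: all other terms cancel in pairs
  by the antisymmetry of the products of Bernstein operators.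
\<close>

lemma colop_hsym_mult:
  assumes "g \<in> symfun" "deg_le d g" "n + d \<le> N"
  shows "colop N a (Suc k) 1 (hsym n * g)
    = (\<Sum>j\<le>N. bern (a + int n + int j) (colop N a k 1 (hperp j g)))"
  using assms
proof (induction k arbitrary: n g)
  case (0 n g)
  \<comment> \<open>Taking the constant term removes h_{n-l} unless l = n.\<close>
  have "colop N a (Suc 0) 1 (hsym n * g)
      = (\<Sum>l\<in>{n}. \<Sum>j\<le>N. bern (a + int (l + j)) (colop N a 0 1 (hz (int n - int l) * hperp j g)))"
    unfolding colop_hsym_mult_expand[OF 0]
    by (intro sum.mono_neutral_right) (auto simp: hz_def)
  then show ?case by (simp add: add.assoc)
next
  case (Suc k n g)
  define E where "E = (\<lambda>i j. colop N a k 1 (hperp i (hperp j g)))"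
  define \<psi> where "\<psi> = (\<lambda>(l, j, i). bern (a + int l + int j) (bern (a + (int n - int l) + int i) (E i j)))"
  have E: "E i j \<in> hspan" "E i j = E j i" for i j
    using hperp_commute[OF Suc.prems(1)] by (simp_all add: E_def hspan_colop)
  have step: "bern (a + int (l + j)) (colop N a (Suc k) 1 (hz (int n - int l) * hperp j g))
      = (\<Sum>i\<le>N. \<psi> (l, j, i))" if "l \<le> n" for l j
  proof -
    have hz: "hz (int n - int l) = (hsym (n - l) :: 'a mseries)"
      using that by (simp flip: hz_of_nat add: of_nat_diff)
    have "colop N a (Suc k) 1 (hsym (n - l) * hperp j g)
        = (\<Sum>i\<le>N. bern (a + int (n - l) + int i) (E i j))"
      unfolding E_def using Suc.prems deg_le_mono[OF deg_le_hperp[OF Suc.prems(2)]]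
      by (intro Suc.IH symfun_hperp) auto
    then show ?thesis
      using that E(1)
      by (simp add: hz \<psi>_def bern_sum hspan_symfun hspan_bern of_nat_diff add.assoc del: colop.simps)
  qed
  have "colop N a (Suc (Suc k)) 1 (hsym n * g) = (\<Sum>l\<le>n. \<Sum>j\<le>N. \<Sum>i\<le>N. \<psi> (l, j, i))"
    unfolding colop_hsym_mult_expand[OF Suc.prems] by (intro sum.cong refl step) simp
  \<comment> \<open>The terms with l = n give the claim. The others are permuted by taking l to n -
    1 - l and swapping i and j, which matches the exchange of the two outer operators.\<close>
  also have "\<dots> = (\<Sum>l<n. \<Sum>j\<le>N. \<Sum>i\<le>N. \<psi> (l, j, i)) + (\<Sum>j\<le>N. \<Sum>i\<le>N. \<psi> (n, j, i))"
    by (simp flip: lessThan_Suc_atMost)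
  also have "(\<Sum>l<n. \<Sum>j\<le>N. \<Sum>i\<le>N. \<psi> (l, j, i)) = sum \<psi> ({..<n} \<times> {..N} \<times> {..N})"
    by (simp add: sum.cartesian_product case_prod_unfold)
  also have "\<dots> = 0"
  proof (rule sum_involution_eq_0[where \<tau> = "\<lambda>(l, j, i). (n - 1 - l, i, j)"])
    fix x assume "x \<in> {..<n} \<times> {..N} \<times> {..N}"
    then obtain l j i where x: "x = (l, j, i)" "l < n" by auto
    then have l: "int (n - 1 - l) = int n - 1 - int l" by (simp add: of_nat_diff)
    have "\<psi> (n - 1 - l, i, j)
        = bern (a + (int n - int l) + int i - 1) (bern (a + int l + int j + 1) (E i j))"
      unfolding \<psi>_def prod.case l E(2)[of j i] by (simp add: algebra_simps)
    also have "\<dots> = - \<psi> (l, j, i)"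
      using bern_antisym[OF E(1), of "a + int l + int j" "a + (int n - int l) + int i" i j]
      by (simp add: \<psi>_def)
    finally show "\<psi> (case x of (l, j, i) \<Rightarrow> (n - 1 - l, i, j)) = - \<psi> x" by (simp add: x)
    assume "(case x of (l, j, i) \<Rightarrow> (n - 1 - l, i, j)) = x"
    then have "i = j" "n - 1 - l = l" unfolding x by (metis case_prod_conv prod.inject)+
    then have "int n - int l = int l + 1" using x(2) by linarith
    then have eq: "a + (int n - int l) + int i = a + int l + int j + 1" using \<open>i = j\<close> by simp
    show "\<psi> x = 0" unfolding x \<psi>_def prod.case eq by (rule bern_bern_Suc[OF E(1)])
  qed auto
  also have "(\<Sum>j\<le>N. \<Sum>i\<le>N. \<psi> (n, j, i)) = (\<Sum>j\<le>N. bern (a + int n + int j) (colop N a (Suc k) 1 (hperp j g)))"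
    using E(1) by (simp add: \<psi>_def E_def bern_sum hspan_symfun hspan_bern)
  finally show ?case by simp
qed

text \<open>\<open>colop_hsym_mult\<close> turns each h_{b+i} into a shift of the outer index;
  grouped by s = i + j, the sums of \<open>eperp i (hperp (s - i) f)\<close> vanish unless s = 0.
  The bound on N covers i \<le> d and the degree bound d that \<open>deg_le_eperp\<close>
  keeps.\<close>

lemma colop_bern:
  assumes f: "f \<in> symfun" "deg_le d f" and N: "b + 2 * d \<le> N"
  shows "colop N (int a) (Suc k) 1 (bern (int b) f) = bern (int (b + a)) (colop N (int a) k 1 f)"
proof -
  define \<phi> where "\<phi> = (\<lambda>i j. bern (int (a + b) + int (i + j)) (colop N (int a) k 1 (hperp j (eperp i f))))"
  have zero: "\<phi> i j = 0" if "d < i \<or> N < j" for i j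
  proof -
    have "hperp j (eperp i f) = 0"
      using that eperp_eq_0[OF f(2), of i] hperp_eq_0[OF deg_le_mono[OF deg_le_eperp[OF f(2)]], of N j i] N
      by auto
    then show ?thesis by (simp add: \<phi>_def)
  qed
  have "bern (int b) f = (\<Sum>i\<le>d. hsym (b + i) * eperp i f)"
    by (simp add: bern_eq_sum[OF f(2)] flip: hz_of_nat)
  then have "colop N (int a) (Suc k) 1 (bern (int b) f)
      = (\<Sum>i\<le>d. colop N (int a) (Suc k) 1 (hsym (b + i) * eperp i f))"
    by (simp only: colop_sum[OF symfun_1])
  also have "\<dots> = (\<Sum>i\<le>d. \<Sum>j\<le>N. \<phi> i j)"
  proof (rule sum.cong[OF refl])
    fix i assume "i \<in> {..d}"
    then have "b + i + d \<le> N" using N by simp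
    from colop_hsym_mult[OF symfun_eperp[OF f(1)] deg_le_eperp[OF f(2)] this, of "int a" k i]
    show "colop N (int a) (Suc k) 1 (hsym (b + i) * eperp i f) = (\<Sum>j\<le>N. \<phi> i j)"
      by (simp add: \<phi>_def ac_simps del: colop.simps)
  qed
  also have "\<dots> = (\<Sum>s\<le>d + N. \<Sum>i\<le>s. \<phi> i (s - i))"
    by (rule sum_triangle_rect[symmetric]) (rule zero)
  also have "\<dots> = (\<Sum>s\<le>d + N. bern (int (a + b) + int s)
      (colop N (int a) k 1 (\<Sum>i\<le>s. eperp i (hperp (s - i) f))))"
    by (simp add: \<phi>_def colop_sum bern_sum symfun_colop hperp_eperp_commute f(1))
  also have "\<dots> = (\<Sum>s\<in>{0}. bern (int (a + b) + int s)
      (colop N (int a) k 1 (\<Sum>i\<le>s. eperp i (hperp (s - i) f))))"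
    by (rule sum.mono_neutral_right) (auto simp: eperp_hperp_convolution f(1))
  also have "\<dots> = bern (int (b + a)) (colop N (int a) k 1 f)"
    by (simp add: hperp_0_idx f(1) add.commute)
  finally show ?thesis .
qed

text \<open>The operators may raise the degree, so the truncation bound depends on
  \<open>ps\<close>; beyond it the value is independent of N.\<close>

lemma colop_berns:
  assumes "f \<in> symfun"
  shows "\<exists>M. \<forall>N\<ge>M. colop N (int a) (length ps) 1 (berns ps f)
    = berns (map (\<lambda>p. p + a) ps) (mconst (mcoeff f {#}))"
proof (induction ps)
  case (Cons p ps)
  then obtain M where M: "\<And>N. M \<le> N \<Longrightarrow> colop N (int a) (length ps) 1 (berns ps f)
    = berns (map (\<lambda>p. p + a) ps) (mconst (mcoeff f {#}))" by blast
  have sym: "berns ps f \<in> symfun" using assms by (induction ps) (auto intro: symfun_bern)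
  then obtain d where d: "deg_le d (berns ps f)" by (auto simp: symfun_iff)
  show ?case
    using M colop_bern[OF sym d] by (intro exI[of _ "max M (p + 2 * d)"]) simp
qed simp

section \<open>The operator \<open>CS\<close> and the theorem\<close>

lemma CS_eq_colop:
  assumes f: "f \<in> symfun" "deg_le N f"
  shows "CS a k f = colop N (int a) k 1 f"
proof -
  have RS: "(RS a ^^ k) g = (bern (int a) ^^ k) g \<and> (RS a ^^ k) g \<in> symfun"
    if "g \<in> symfun" for g :: "'a mseries"
    by (induction k) (auto simp: that RS_eq_bern symfun_bern)
  have "CS a k f = (\<Sum>mu\<in>{mu. psize mu \<le> N}.
      (- 1) ^ psize mu * (RS a ^^ k) (schur mu) * perp (schur (pconj mu)) f)"
    unfolding CS_def
  proof (rule Sum_any.expand_superset)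
    have "psize mu \<le> N"
      if "(- 1) ^ psize mu * (RS a ^^ k) (schur mu) * perp (schur (pconj mu)) f \<noteq> 0" for mu
    proof (rule ccontr)
      assume "\<not> psize mu \<le> N"
      then have "perp (schur (pconj mu)) f = 0" by (intro perp_schur_eq_0[OF f]) simp
      with that show False by simp
    qed
    then show "{mu. (- 1) ^ psize mu * (RS a ^^ k) (schur mu) * perp (schur (pconj mu)) f \<noteq> 0}
      \<subseteq> {mu. psize mu \<le> N}" by blast
  qed (rule finite_psize_le)
  also have "\<dots> = kerop N (\<lambda>x. (bern (int a) ^^ k) (1 * x)) f"
    unfolding kerop_def using RS[OF symfun_schur]
    by (simp add: neg_one_power_mult mult.assoc)
  also have "\<dots> = colop N (int a) k 1 f"
    using f by (intro kerop_bern_funpow) auto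
  finally show ?thesis .
qed

text \<open>\<open>CS\<close> does not involve N, so N can be taken large enough for both
  \<open>CS_eq_colop\<close> and \<open>colop_berns\<close>.\<close>

lemma CS_berns:
  assumes "f \<in> symfun"
  shows "CS a (length ps) (berns ps f) = berns (map (\<lambda>p. p + a) ps) (mconst (mcoeff f {#}))"
proof -
  obtain M where M: "\<And>N. M \<le> N \<Longrightarrow> colop N (int a) (length ps) 1 (berns ps f)
    = berns (map (\<lambda>p. p + a) ps) (mconst (mcoeff f {#}))" using colop_berns[OF assms] by blast
  have sym: "berns ps f \<in> symfun" using assms by (induction ps) (auto intro: symfun_bern)
  then obtain d where "deg_le d (berns ps f)" by (auto simp: symfun_iff)
  then have "deg_le (max M d) (berns ps f)" by (rule deg_le_mono) simp
  from CS_eq_colop[OF sym this] show ?thesis by (simp add: M)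
qed

theorem mainTheorem17:
  fixes a k :: nat and lam :: nat_partition
  shows "(plength lam \<le> k \<longrightarrow>
            CS a k (schur lam :: 'a::comm_ring_1 mseries) = schur (padd lam a k)) \<and>
         (plength lam > k \<longrightarrow>
            CS a k (schur lam :: 'a mseries) = 0)"
proof (intro conjI impI)
  assume le: "plength lam \<le> k"
  have part: "part (padd lam a k) i = (if i < k then part lam i + a else 0)" for i
    using le by (simp add: padd.rep_eq part_eq_0)
  have "CS a k (schur lam :: 'a mseries) = CS a (length (plist k lam)) (berns (plist k lam) 1)"
    by (simp add: schur_eq_bschur berns_plist[OF le])
  also have "\<dots> = berns (map (\<lambda>p. p + a) (plist k lam)) 1"
    unfolding CS_berns[OF symfun_1] by simp
  also have "map (\<lambda>p. p + a) (plist k lam) = plist k (padd lam a k)"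
    by (simp add: plist_def part)
  also have "berns \<dots> 1 = (schur (padd lam a k) :: 'a mseries)"
    unfolding schur_eq_bschur by (rule berns_plist) (simp add: plength_le_iff part)
  finally show "CS a k (schur lam :: 'a mseries) = schur (padd lam a k)" .
next
  assume less: "k < plength lam"
  \<comment> \<open>The operators in \<open>CS\<close> use up the first k rows; the product
    \<open>f\<close> of the remaining ones enters only through its constant term, zero because row k
    is nonempty.\<close>
  define rest where "rest = map (part lam) [Suc k..<plength lam]"
  define f :: "'a mseries" where "f = berns (part lam k # rest) 1"
  have sym: "berns rest (1 :: 'a mseries) \<in> symfun" by (intro hspan_symfun hspan_berns hspan_1)
  have "[0..<plength lam] = [0..<k] @ k # [Suc k..<plength lam]"
    using less by (metis less_imp_le_nat upt_add_eq_append le0 le_add_diff_inverse upt_conv_Cons)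
  then have "plist (plength lam) lam = plist k lam @ part lam k # rest"
    by (simp add: plist_def rest_def)
  then have "CS a k (schur lam) = CS a (length (plist k lam)) (berns (plist k lam) f)"
    by (simp add: schur_eq_bschur bschur_def berns_append f_def)
  also have "\<dots> = berns (map (\<lambda>p. p + a) (plist k lam)) (mconst (mcoeff f {#}))"
    by (rule CS_berns) (simp add: f_def symfun_bern sym)
  also have "mcoeff f {#} = 0"
    using part_neq_0_iff[of lam k] less by (simp add: f_def mcoeff_bern_empty sym)
  also have "berns ps (mconst 0 :: 'a mseries) = 0" for ps
    by (induction ps) auto
  finally show "CS a k (schur lam :: 'a mseries) = 0" .
qed

end
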